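(* Let $n$ be a positive integer and let $R$ be a simply connected region that admits at least one order-$n$ ribbon tiling. Then $\alpha\mapsto G_R(\alpha)$ is a one-to-one correspondence between the order-$n$ ribbon tilings of $R$ and the acyclic orientations of the graph $G_R$ extending the partial orientation of $G_R$, under which local replacement moves correspond to edge reversals. Precisely: (1) For every order-$n$ ribbon tiling $\alpha$ of $R$, $G_R(\alpha)$ is an acyclic orientation extending the partial orientation of $G_R$. (2) If $\alpha$ and $\beta$ are order-$n$ ribbon tilings of $R$, then $\alpha=\beta$ if and only if $G_R(\alpha)=G_R(\beta)$. (3) Every acyclic orientation $A$ of $G_R$ that extends the partial orientation of $G_R$ is equal to $G_R(\alpha)$ for some order-$n$ ribbon tiling $\alpha$ of $R$. (4) Two order-$n$ ribbon tilings $\alpha$ and $\beta$ of $R$ differ by a local replacement move if and only if $G_R(\alpha)$ and $G_R(\beta)$ differ by an edge reversal.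
   Context: Squares of the grid $\mathbb Z^2$ are indexed by integer pairs; $s_{x,y}$ is the unit square at position $(x,y)$. Two squares are adjacent if they share an edge. The square $s_{x,y}$ has level $x+y$ and color $x+y \bmod n$. A ribbon tile of order $n$ is a connected (via adjacency) set of squares containing exactly one square of each of the $n$ colors (equivalently, a sequence of $n$ squares each directly above or directly to the right of its predecessor). A tile has level $c$ if $c$ is the level of its lowest-level square. A region $R$ is a finite set of squares connected via adjacency; it is simply connected if for every square $s\notin R$ there is no connected cycle of squares in $R$ that encircles $s$ with non-zero winding number. An order-$n$ ribbon tiling of $R$ is a partition of $R$ into ribbon tiles of order $n$. Two tilings differ by a local replacement move if one is obtained from the other by removing a single pair of tiles and adding another (different) pair of ribbon tiles in its place. $B_R$ is the set of squares not in $R$ that are adjacent to at least one square of $R$. The relation $\prec$: $s_{x,y}$ is directly left of $s_{x',y'}$ if $x+y=x'+y'$ and $x<x'$; it is indirectly left of $s_{x',y'}$ if $|(x+y)-(x'+y')|=1$, $x\le x'$ and $y\ge y'$. Write $s\prec s'$ for squares if $s$ is directly or indirectly left of $s'$. For a tile $t$ and a square $s$: $s\prec t$ if $s\prec s'$ for some $s'\in t$, and $t\prec s$ if $s'\prec s$ for some $s'\in t$. For distinct tiles $t_1,t_2$ of a tiling: $t_1\prec t_2$ if $s_1\prec s_2$ for some $s_1\in t_1$, $s_2\in t_2$. For disjoint ribbon tiles one cannot have both $t_1\prec t_2$ and $t_2\prec t_1$. For a tiling $\alpha$, $t_{c,i}(\alpha)$ ($i\ge1$) is the $i$-th tile of $\alpha$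 of level $c$ from left to right, when it exists. For fixed $R$, the set of pairs $(c,i)$ for which $t_{c,i}(\alpha)$ is defined does not depend on the tiling $\alpha$. The graph $G_R$: its vertices are the squares in $B_R$ together with one formal vertex $t_{c,i}$ for each pair $(c,i)$ such that $t_{c,i}(\alpha)$ is defined for some (equivalently every) tiling $\alpha$ of $R$. Distinct vertices are adjacent as follows: $t_{c,i}$ and $t_{d,j}$ are adjacent iff $|c-d|\le n$; $t_{c,i}$ and $s_{x,y}\in B_R$ are adjacent iff $c-1\le x+y\le c+n$; $s_{x,y},s_{x',y'}\in B_R$ are adjacent iff $|(x+y)-(x'+y')|\le 1$. (Two vertices are adjacent exactly when the corresponding tiles/squares are comparable under $\prec$ in some, equivalently every, tiling.) For a tiling $\alpha$, $G_R(\alpha)$ is the orientation of $G_R$ in which an edge $(a,b)$ is oriented from $a$ to $b$ iff $a\prec b$, where a tile vertex $t_{c,i}$ is interpreted as the tile $t_{c,i}(\alpha)$. An edge of $G_R$ is free if it joins two tile vertices $t_{c,i},t_{d,j}$ with $c\not\equiv d\pmod n$; all other edges are forced. Each forced edge has the same direction in $G_R(\alpha)$ for every tiling $\alpha$ of $R$; the partial orientation of $G_R$ gives each forced edge this common direction and leaves the free edges unoriented. An orientation of $G_R$ (an assignment of a direction to every edge) extends the partial orientation if it agrees with it on all forced edges; it is acyclic if it has no directed cycle. Two orientations differ by an edge reversal if they agree on all but exactly one edge. *)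

theory Defs
  imports "HOL-Complex_Analysis.Winding_Numbers" "HOL-Library.Disjoint_Sets"
begin

section \<open>Squares and regions\<close>

type_synonym square = "int \<times> int"

definition sq_level :: "square \<Rightarrow> int" where
  "sq_level s = fst s + snd s"

definition sq_color :: "nat \<Rightarrow> square \<Rightarrow> int" where
  "sq_color n s = sq_level s mod int n"

definition sq_adjacent :: "square \<Rightarrow> square \<Rightarrow> bool" where
  "sq_adjacent s s' \<longleftrightarrow> \<bar>fst s - fst s'\<bar> + \<bar>snd s - snd s'\<bar> = 1"

definition sq_connected :: "square set \<Rightarrow> bool" where
  "sq_connected S \<longleftrightarrow>
     (\<forall>s\<in>S. \<forall>s'\<in>S. (s, s') \<in> {(u, v). u \<in> S \<and> v \<in> S \<and> sq_adjacent u v}\<^sup>*)"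

definition region :: "square set \<Rightarrow> bool" where
  "region R \<longleftrightarrow> finite R \<and> sq_connected R"

definition boundary_squares :: "square set \<Rightarrow> square set" where
  "boundary_squares R = {s. s \<notin> R \<and> (\<exists>s'\<in>R. sq_adjacent s s')}"

text \<open>A cycle of squares is a closed walk, listed with its first square repeated at the
  end. It is traced by the polygonal line through the centers of its squares, in coordinates
  in which the center of the square at position \<open>(x, y)\<close> is \<open>x + y * \<i>\<close>. The line misses the
  center of every square that is not on the cycle.\<close>

definition sq_center :: "square \<Rightarrow> complex" where
  "sq_center s = Complex (of_int (fst s)) (of_int (snd s))"

fun polyline :: "complex list \<Rightarrow> real \<Rightarrow> complex" where
  "polyline [] = linepath 0 0"
| "polyline [a] = linepath a a"
| "polyline (a # b # zs) = linepath a b +++ polyline (b # zs)"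

definition sq_cycle :: "square set \<Rightarrow> square list \<Rightarrow> bool" where
  "sq_cycle R ws \<longleftrightarrow>
     ws \<noteq> [] \<and> set ws \<subseteq> R \<and> hd ws = last ws \<and> successively sq_adjacent ws"

definition simply_connected_region :: "square set \<Rightarrow> bool" where
  "simply_connected_region R \<longleftrightarrow> region R \<and>
     (\<forall>s. s \<notin> R \<longrightarrow>
        \<not> (\<exists>ws. sq_cycle R ws \<and>
             winding_number (polyline (map sq_center ws)) (sq_center s) \<noteq> 0))"

section \<open>Ribbon tilings\<close>

definition ribbon_tile :: "nat \<Rightarrow> square set \<Rightarrow> bool" where
  "ribbon_tile n t \<longleftrightarrow>
     sq_connected t \<and> (\<forall>k\<in>{0..<int n}. \<exists>!s. s \<in> t \<and> sq_color n s = k)"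

definition tile_level :: "square set \<Rightarrow> int" where
  "tile_level t = Min (sq_level ` t)"

definition ribbon_tiling :: "nat \<Rightarrow> square set \<Rightarrow> square set set \<Rightarrow> bool" where
  "ribbon_tiling n R \<alpha> \<longleftrightarrow> partition_on R \<alpha> \<and> (\<forall>t\<in>\<alpha>. ribbon_tile n t)"

definition local_replacement :: "nat \<Rightarrow> square set set \<Rightarrow> square set set \<Rightarrow> bool" where
  "local_replacement n \<alpha> \<beta> \<longleftrightarrow>
     (\<exists>t\<^sub>1 t\<^sub>2 u\<^sub>1 u\<^sub>2. t\<^sub>1 \<in> \<alpha> \<and> t\<^sub>2 \<in> \<alpha> \<and> t\<^sub>1 \<noteq> t\<^sub>2 \<and>
        ribbon_tile n u\<^sub>1 \<and> ribbon_tile n u\<^sub>2 \<and> u\<^sub>1 \<noteq> u\<^sub>2 \<and> {u\<^sub>1, u\<^sub>2} \<noteq> {t\<^sub>1, t\<^sub>2} \<and>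
        \<beta> = (\<alpha> - {t\<^sub>1, t\<^sub>2}) \<union> {u\<^sub>1, u\<^sub>2})"

section \<open>The left-of relation\<close>

definition directly_left :: "square \<Rightarrow> square \<Rightarrow> bool" where
  "directly_left s s' \<longleftrightarrow> sq_level s = sq_level s' \<and> fst s < fst s'"

definition indirectly_left :: "square \<Rightarrow> square \<Rightarrow> bool" where
  "indirectly_left s s' \<longleftrightarrow>
     \<bar>sq_level s - sq_level s'\<bar> = 1 \<and> fst s \<le> fst s' \<and> snd s \<ge> snd s'"

definition sq_left :: "square \<Rightarrow> square \<Rightarrow> bool" where
  "sq_left s s' \<longleftrightarrow> directly_left s s' \<or> indirectly_left s s'"

text \<open>The relation for two tiles, and, with a single square \<open>s\<close> given as \<open>{s}\<close>, also for a
  tile and a square and for two squares. A tile of order at least 2 is related to itself, so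
  uses below exclude equal arguments.\<close>

definition set_left :: "square set \<Rightarrow> square set \<Rightarrow> bool" where
  "set_left t t' \<longleftrightarrow> (\<exists>s\<in>t. \<exists>s'\<in>t'. sq_left s s')"

definition is_nth_tile :: "square set set \<Rightarrow> int \<Rightarrow> nat \<Rightarrow> square set \<Rightarrow> bool" where
  "is_nth_tile \<alpha> c i t \<longleftrightarrow> t \<in> \<alpha> \<and> tile_level t = c \<and>
     i = Suc (card {u \<in> \<alpha>. tile_level u = c \<and> u \<noteq> t \<and> set_left u t})"

definition nth_tile :: "square set set \<Rightarrow> int \<Rightarrow> nat \<Rightarrow> square set" where
  "nth_tile \<alpha> c i = (THE t. is_nth_tile \<alpha> c i t)"

section \<open>The graph and its orientations\<close>

datatype vertex = TileV int nat | SquareV square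

definition G_verts :: "nat \<Rightarrow> square set \<Rightarrow> vertex set" where
  "G_verts n R = SquareV ` boundary_squares R \<union>
     {TileV c i | c i. \<exists>\<alpha>. ribbon_tiling n R \<alpha> \<and> (\<exists>t. is_nth_tile \<alpha> c i t)}"

fun close_levels :: "nat \<Rightarrow> vertex \<Rightarrow> vertex \<Rightarrow> bool" where
  "close_levels n (TileV c i) (TileV d j) \<longleftrightarrow> \<bar>c - d\<bar> \<le> int n"
| "close_levels n (TileV c i) (SquareV s) \<longleftrightarrow> c - 1 \<le> sq_level s \<and> sq_level s \<le> c + int n"
| "close_levels n (SquareV s) (TileV c i) \<longleftrightarrow> c - 1 \<le> sq_level s \<and> sq_level s \<le> c + int n"
| "close_levels n (SquareV s) (SquareV s') \<longleftrightarrow> \<bar>sq_level s - sq_level s'\<bar> \<le> 1"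

definition G_adj :: "nat \<Rightarrow> square set \<Rightarrow> vertex \<Rightarrow> vertex \<Rightarrow> bool" where
  "G_adj n R a b \<longleftrightarrow> a \<in> G_verts n R \<and> b \<in> G_verts n R \<and> a \<noteq> b \<and> close_levels n a b"

fun vertex_squares :: "square set set \<Rightarrow> vertex \<Rightarrow> square set" where
  "vertex_squares \<alpha> (TileV c i) = nth_tile \<alpha> c i"
| "vertex_squares \<alpha> (SquareV s) = {s}"

text \<open>An orientation is the set of its directed edges: \<open>(a, b)\<close> is a member iff the edge
  between \<open>a\<close> and \<open>b\<close> points from \<open>a\<close> to \<open>b\<close>.\<close>

definition is_orientation :: "nat \<Rightarrow> square set \<Rightarrow> (vertex \<times> vertex) set \<Rightarrow> bool" where
  "is_orientation n R A \<longleftrightarrow> (\<forall>(a, b)\<in>A. G_adj n R a b) \<and>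
     (\<forall>a b. G_adj n R a b \<longrightarrow> ((a, b) \<in> A \<longleftrightarrow> (b, a) \<notin> A))"

definition G_orient :: "nat \<Rightarrow> square set \<Rightarrow> square set set \<Rightarrow> (vertex \<times> vertex) set" where
  "G_orient n R \<alpha> =
     {(a, b). G_adj n R a b \<and> set_left (vertex_squares \<alpha> a) (vertex_squares \<alpha> b)}"

fun free_pair :: "nat \<Rightarrow> vertex \<Rightarrow> vertex \<Rightarrow> bool" where
  "free_pair n (TileV c i) (TileV d j) \<longleftrightarrow> c mod int n \<noteq> d mod int n"
| "free_pair n _ _ \<longleftrightarrow> False"

definition forced_edge :: "nat \<Rightarrow> square set \<Rightarrow> vertex \<Rightarrow> vertex \<Rightarrow> bool" where
  "forced_edge n R a b \<longleftrightarrow> G_adj n R a b \<and> \<not> free_pair n a b"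

definition partial_orientation :: "nat \<Rightarrow> square set \<Rightarrow> (vertex \<times> vertex) set" where
  "partial_orientation n R =
     {(a, b). forced_edge n R a b \<and> (\<forall>\<alpha>. ribbon_tiling n R \<alpha> \<longrightarrow> (a, b) \<in> G_orient n R \<alpha>)}"

definition extends_partial :: "nat \<Rightarrow> square set \<Rightarrow> (vertex \<times> vertex) set \<Rightarrow> bool" where
  "extends_partial n R A \<longleftrightarrow>
     (\<forall>a b. forced_edge n R a b \<longrightarrow> ((a, b) \<in> A \<longleftrightarrow> (a, b) \<in> partial_orientation n R))"

definition edge_reversal :: "(vertex \<times> vertex) set \<Rightarrow> (vertex \<times> vertex) set \<Rightarrow> bool" where
  "edge_reversal A B \<longleftrightarrow> (\<exists>a b. (a, b) \<in> A \<and> a \<noteq> b \<and> B = insert (b, a) (A - {(a, b)}))"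

end

theory Submission imports Defs begin

text \<open>In the coordinates level and \<open>x - y\<close> the relation \<open>\<prec>\<close> compares \<open>x - y\<close> on squares whose levels
  differ by at most 1, so disjoint ribbons do not cross and \<open>G\<^sub>R\<close> is an interval graph whose
  orientations are acyclic as soon as they have no directed triangle. The numbers of level \<open>c\<close> tiles
  left of a square outside \<open>R\<close> do not depend on the tiling: counting the squares of \<open>R\<close> level by
  level shows that this independence passes between squares outside \<open>R\<close> that touch, even at a corner,
  and it is clear far away from \<open>R\<close>; simple connectivity excludes bounded exceptional parts. This fixes
  the edges at boundary squares, and then the edges between tiles whose levels differ by \<open>n\<close>. A tiling
  is recovered from its orientation by ranking the tiles present on each level. Finally, an edge of
  \<open>G\<^sub>R(\<alpha>)\<close> that reverses to an acyclic orientation joins two tiles with nothing between them; exchanging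
  their tails is a local replacement. Reversing such edges one by one transforms \<open>G\<^sub>R(\<alpha>)\<close> into any given
  acyclic extension of the partial orientation.\<close>

section \<open>Squares in diagonal coordinates\<close>

text \<open>A vertex \<open>TileV c i\<close> names one tile in each tiling, and these tiles may lie
  far apart, so no forced edge can be checked by looking at one place. Comparisons are therefore
  turned into counts. The tiles of one level on the left of a comparable ribbon form an initial
  segment of that level, and only its length matters. Every tile whose level lies in a window of
  \<open>n\<close> consecutive levels has exactly one square on the top level of the window, so
  counts summed over the window become counts of squares of \<open>R\<close>, and sliding the window
  by one level isolates one unknown count. Tiles \<open>n\<close> levels apart share no level but
  are still comparable, as are a tile and a square just below or above it; this is why level
  intervals are compared with a slack of one throughout. An edge on which \<alpha> disagrees with a
  prescribed orientation need not be reversible by itself, because a third vertex may lie between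
  its ends. Some disagreeing edge is free of this obstruction, and reversing it lowers the number of
  disagreements.\<close>

definition sq_pos :: "square \<Rightarrow> int" where
  "sq_pos s = fst s - snd s"

lemma sq_pos_level_eqI: "sq_level s = sq_level s' \<Longrightarrow> sq_pos s = sq_pos s' \<Longrightarrow> s = s'"
  by (auto simp: sq_level_def sq_pos_def prod_eq_iff)

lemma sq_pos_parity: "even (sq_pos s - sq_level s)"
  by (simp add: sq_level_def sq_pos_def)

text \<open>Level and position have the same parity, so two squares on neighbouring levels never
  share a position. Thus \<open>sq_pos\<close> orders the squares of any two consecutive levels
  linearly.\<close>

lemma sq_pos_neq:
  assumes "\<bar>sq_level s - sq_level s'\<bar> \<le> 1" "s \<noteq> s'"
  shows "sq_pos s \<noteq> sq_pos s'"
proof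
  assume eq: "sq_pos s = sq_pos s'"
  have "sq_level s = sq_level s'"
    using assms(1) eq by (auto simp: sq_level_def sq_pos_def) presburger
  with eq assms(2) show False by (simp add: sq_pos_level_eqI)
qed

lemma sq_adjacent_iff:
  "sq_adjacent s s' \<longleftrightarrow> \<bar>sq_level s - sq_level s'\<bar> = 1 \<and> \<bar>sq_pos s - sq_pos s'\<bar> = 1"
proof -
  have "\<bar>a\<bar> + \<bar>b\<bar> = 1 \<longleftrightarrow> \<bar>a + b\<bar> = 1 \<and> \<bar>a - b\<bar> = 1" for a b :: int by arith
  from this[of "fst s - fst s'" "snd s - snd s'"] show ?thesis
    by (simp add: sq_adjacent_def sq_level_def sq_pos_def algebra_simps)
qed

lemma sq_adjacent_sym: "sq_adjacent s s' \<longleftrightarrow> sq_adjacent s' s"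
  by (auto simp: sq_adjacent_iff)

text \<open>On levels that differ by one, the weak inequalities of \<open>indirectly_left\<close>
  cannot both be equalities, so they amount to a strict inequality between positions; this merges
  the direct and the indirect case.\<close>

lemma sq_left_iff:
  "sq_left s s' \<longleftrightarrow> \<bar>sq_level s - sq_level s'\<bar> \<le> 1 \<and> sq_pos s < sq_pos s'"
  by (cases s; cases s') (auto simp: sq_left_def directly_left_def indirectly_left_def
      sq_level_def sq_pos_def abs_if split: if_splits)

section \<open>Ribbons\<close>

text \<open>The end levels are free parameters so that a single square is also a ribbon; tiles and
  boundary squares then obey the same comparison lemmas. In diagonal coordinates the last clause is
  adjacency of consecutive squares.\<close>

definition ribbon :: "int \<Rightarrow> int \<Rightarrow> square set \<Rightarrow> bool" where
  "ribbon lo hi t \<longleftrightarrow> lo \<le> hi \<and> (\<forall>s\<in>t. lo \<le> sq_level s \<and> sq_level s \<le> hi) \<and>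
     (\<forall>k\<in>{lo..hi}. \<exists>!s. s \<in> t \<and> sq_level s = k) \<and>
     (\<forall>s\<in>t. \<forall>s'\<in>t. sq_level s' = sq_level s + 1 \<longrightarrow> \<bar>sq_pos s - sq_pos s'\<bar> = 1)"

definition sq_at :: "square set \<Rightarrow> int \<Rightarrow> square" where
  "sq_at t k = (THE s. s \<in> t \<and> sq_level s = k)"

lemma ribbon_le: "ribbon lo hi t \<Longrightarrow> lo \<le> hi"
  by (simp add: ribbon_def)

lemma ribbon_level: "ribbon lo hi t \<Longrightarrow> s \<in> t \<Longrightarrow> lo \<le> sq_level s \<and> sq_level s \<le> hi"
  by (simp add: ribbon_def)

lemma sq_at:
  assumes "ribbon lo hi t" "lo \<le> k" "k \<le> hi"
  shows "sq_at t k \<in> t" "sq_level (sq_at t k) = k"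
proof -
  have "\<exists>!s. s \<in> t \<and> sq_level s = k" using assms by (simp add: ribbon_def)
  from theI'[OF this] show "sq_at t k \<in> t" "sq_level (sq_at t k) = k" by (auto simp: sq_at_def)
qed

lemma ribbon_unique:
  assumes "ribbon lo hi t" "s \<in> t" "s' \<in> t" "sq_level s = sq_level s'"
  shows "s = s'"
proof -
  have "\<exists>!q. q \<in> t \<and> sq_level q = sq_level s"
    using assms ribbon_level[OF assms(1,2)] by (simp add: ribbon_def)
  with assms show ?thesis by metis
qed

lemma sq_at_level: "ribbon lo hi t \<Longrightarrow> s \<in> t \<Longrightarrow> sq_at t (sq_level s) = s"
  by (meson ribbon_level ribbon_unique sq_at)

lemma sq_at_eqI: "ribbon lo hi t \<Longrightarrow> s \<in> t \<Longrightarrow> sq_level s = k \<Longrightarrow> sq_at t k = s"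
  using sq_at_level by blast

lemma ribbon_eq_image: "ribbon lo hi t \<Longrightarrow> t = sq_at t ` {lo..hi}"
  by (auto simp: sq_at intro!: image_eqI[where x = "sq_level _"] dest: ribbon_level sq_at_level[symmetric])

lemma ribbon_finite: "ribbon lo hi t \<Longrightarrow> finite t"
  by (metis ribbon_eq_image finite_imageI finite_atLeastAtMost_int)

lemma ribbon_nonempty: "ribbon lo hi t \<Longrightarrow> t \<noteq> {}"
  using sq_at(1) ribbon_le by fastforce

lemma ribbon_step:
  assumes "ribbon lo hi t" "lo \<le> k" "k + 1 \<le> hi"
  shows "\<bar>sq_pos (sq_at t k) - sq_pos (sq_at t (k + 1))\<bar> = 1"
  using assms sq_at[OF assms(1), of k] sq_at[OF assms(1), of "k+1"] by (simp add: ribbon_def)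

lemma ribbon_singleton: "ribbon (sq_level s) (sq_level s) {s}"
  by (auto simp: ribbon_def)

lemma ribbon_card: "ribbon lo hi t \<Longrightarrow> int (card t) = hi - lo + 1"
proof -
  assume r: "ribbon lo hi t"
  have "inj_on (sq_at t) {lo..hi}"
    by (rule inj_onI) (metis atLeastAtMost_iff r sq_at(2))
  then have "card t = card {lo..hi}"
    using ribbon_eq_image[OF r] card_image by metis
  then show ?thesis using ribbon_le[OF r] by simp
qed

lemma ribbonI:
  assumes "lo \<le> hi" and t: "t = f ` {lo..hi}"
    and lev: "\<And>k. lo \<le> k \<Longrightarrow> k \<le> hi \<Longrightarrow> sq_level (f k) = k"
    and step: "\<And>k. lo \<le> k \<Longrightarrow> k + 1 \<le> hi \<Longrightarrow> \<bar>sq_pos (f k) - sq_pos (f (k + 1))\<bar> = 1"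
  shows "ribbon lo hi t"
proof -
  have "\<exists>!s. s \<in> t \<and> sq_level s = k" if "k \<in> {lo..hi}" for k
    using that lev by (intro ex1I[of _ "f k"]) (auto simp: t)
  moreover have "\<bar>sq_pos s - sq_pos s'\<bar> = 1"
    if "s \<in> t" "s' \<in> t" "sq_level s' = sq_level s + 1" for s s'
    using that lev step by (auto simp: t)
  ultimately show ?thesis using assms by (auto simp: ribbon_def t)
qed

lemma ribbon_tile_level: "ribbon lo hi t \<Longrightarrow> tile_level t = lo"
  unfolding tile_level_def
proof (rule Min_eqI)
  assume r: "ribbon lo hi t"
  show "finite (sq_level ` t)" using r by (simp add: ribbon_finite)
  show "lo \<le> y" if "y \<in> sq_level ` t" for y using that ribbon_level[OF r] by auto
  show "lo \<in> sq_level ` t" using sq_at[OF r, of lo] ribbon_le[OF r] by (metis imageI order_refl)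
qed

lemma rtrancl_crossing:
  assumes "(a, b) \<in> r\<^sup>*" "P a" "\<not> P b"
  shows "\<exists>u v. (u, v) \<in> r \<and> P u \<and> \<not> P v"
  using assms by (induction rule: rtrancl_induct) auto

lemma ribbon_connected:
  assumes r: "ribbon lo hi t"
  shows "sq_connected t"
proof -
  define E where "E = {(u, v). u \<in> t \<and> v \<in> t \<and> sq_adjacent u v}"
  have symE: "sym (E\<^sup>*)"
    by (rule sym_rtrancl) (auto simp: E_def sym_def sq_adjacent_sym)
  have up: "(sq_at t lo, sq_at t (lo + int m)) \<in> E\<^sup>*" if "lo + int m \<le> hi" for m
    using that
  proof (induction m)
    case (Suc m)
    have "(sq_at t (lo + int m), sq_at t (lo + int m + 1)) \<in> E"
      using ribbon_step[OF r, of "lo + int m"] sq_at[OF r, of "lo + int m"]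
        sq_at[OF r, of "lo + int m + 1"] Suc.prems
      by (auto simp: E_def sq_adjacent_iff)
    with Suc show ?case
      by (simp add: algebra_simps)
  qed simp
  have base: "(sq_at t lo, s) \<in> E\<^sup>*" if "s \<in> t" for s
    using up[of "nat (sq_level s - lo)"] ribbon_level[OF r that] sq_at_level[OF r that] by simp
  have "(s, s') \<in> E\<^sup>*" if "s \<in> t" "s' \<in> t" for s s'
    using base[OF that(1)] base[OF that(2)] symE
    by (meson symD rtrancl_trans)
  then show ?thesis by (simp add: sq_connected_def E_def)
qed

lemma ribbon_tile_if_ribbon:
  assumes n: "n > 0" and r: "ribbon c (c + int n - 1) t"
  shows "ribbon_tile n t"
  unfolding ribbon_tile_def
proof (intro conjI ballI)
  fix k assume k: "k \<in> {0..<int n}"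
  \<comment> \<open>The representative of the color \<open>k\<close> among the \<open>n\<close>
    levels starting at \<open>c\<close>.\<close>
  define l where "l = c + (k - c) mod int n"
  have "0 \<le> (k - c) mod int n" "(k - c) mod int n < int n" using n by simp_all
  then have l: "c \<le> l" "l \<le> c + int n - 1" by (simp_all add: l_def)
  have lk: "l mod int n = k"
    using k by (simp add: l_def mod_simps)
  show "\<exists>!s. s \<in> t \<and> sq_color n s = k"
  proof (rule ex1I[of _ "sq_at t l"])
    show "sq_at t l \<in> t \<and> sq_color n (sq_at t l) = k"
      using sq_at[OF r l] lk by (simp add: sq_color_def)
    fix s assume s: "s \<in> t \<and> sq_color n s = k"
    then have b: "c \<le> sq_level s" "sq_level s \<le> c + int n - 1" using ribbon_level[OF r] by auto
    have "sq_level s mod int n = l mod int n" using s lk by (simp add: sq_color_def)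
    then have "int n dvd sq_level s - l" by (simp add: mod_eq_dvd_iff)
    then have "sq_level s - l \<noteq> 0 \<Longrightarrow> int n \<le> \<bar>sq_level s - l\<bar>"
      using dvd_imp_le_int[of "sq_level s - l" "int n"] by simp
    then have "sq_level s = l" using b l by linarith
    then show "s = sq_at t l" using sq_at_eqI[OF r] s by metis
  qed
qed (rule ribbon_connected[OF r])

text \<open>Distinct colors force distinct levels, so the levels form a set of \<open>n\<close>
  integers. A walk inside the tile changes the level by one at each step, hence between the lowest
  and the highest square it crosses every pair of consecutive levels. Since each level has one
  square, the squares at such a crossing are the two squares of these levels, and they are
  adjacent.\<close>

lemma ribbon_if_ribbon_tile:
  assumes n: "n > 0" and t: "ribbon_tile n t"
  shows "\<exists>c. ribbon c (c + int n - 1) t"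
proof -
  define E where "E = {(u, v). u \<in> t \<and> v \<in> t \<and> sq_adjacent u v}"
  have con: "(s, s') \<in> E\<^sup>*" if "s \<in> t" "s' \<in> t" for s s'
    using t that by (simp add: ribbon_tile_def sq_connected_def E_def)
  have col: "\<exists>!s. s \<in> t \<and> sq_level s mod int n = k" if "0 \<le> k" "k < int n" for k
    using t that by (simp add: ribbon_tile_def sq_color_def)
  have mod_inj: "s = s'" if "s \<in> t" "s' \<in> t" "sq_level s mod int n = sq_level s' mod int n" for s s'
    using col[of "sq_level s mod int n"] that n by (metis pos_mod_bound pos_mod_sign of_nat_0_less_iff)
  have inj: "inj_on (\<lambda>s. sq_level s mod int n) t" by (rule inj_onI) (use mod_inj in auto)
  have img: "(\<lambda>s. sq_level s mod int n) ` t = {0..<int n}"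
  proof
    show "{0..<int n} \<subseteq> (\<lambda>s. sq_level s mod int n) ` t"
    proof
      fix k assume "k \<in> {0..<int n}"
      then obtain s where "s \<in> t" "sq_level s mod int n = k" using col[of k] by auto
      then show "k \<in> (\<lambda>s. sq_level s mod int n) ` t" by blast
    qed
  qed (use n in auto)
  have fin: "finite t" using inj img by (metis finite_atLeastLessThan_int finite_imageD)
  have cardt: "card t = n" using card_image[OF inj] img by simp
  have injL: "inj_on sq_level t" by (rule inj_onI) (use mod_inj in auto)
  define L where "L = sq_level ` t"
  have finL: "finite L" and cardL: "card L = n" using fin injL cardt by (auto simp: L_def card_image)
  have neL: "L \<noteq> {}" using cardL n by auto
  define lo where "lo = Min L"
  define hi where "hi = Max L"
  have lohi: "lo \<in> L" "hi \<in> L" "\<And>k. k \<in> L \<Longrightarrow> lo \<le> k \<and> k \<le> hi"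
    using finL neL by (auto simp: lo_def hi_def)
  have cross: "\<exists>u v. (u, v) \<in> E \<and> sq_level u = k \<and> sq_level v = k + 1" if "lo \<le> k" "k < hi" for k
  proof -
    obtain a b where ab: "a \<in> t" "sq_level a = lo" "b \<in> t" "sq_level b = hi"
      using lohi(1,2) by (auto simp: L_def)
    from rtrancl_crossing[OF con[OF ab(1,3)], of "\<lambda>s. sq_level s \<le> k"] that ab
    obtain u v where "(u, v) \<in> E" "sq_level u \<le> k" "\<not> sq_level v \<le> k" by auto
    then show ?thesis by (intro exI[of _ u] exI[of _ v]) (auto simp: E_def sq_adjacent_iff)
  qed
  have full: "L = {lo..hi}"
  proof
    show "{lo..hi} \<subseteq> L"
    proof
      fix k assume k: "k \<in> {lo..hi}"
      show "k \<in> L"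
      proof (cases "k = hi")
        case True then show ?thesis using lohi by simp
      next
        case False
        then obtain u v where "(u, v) \<in> E" "sq_level u = k" using cross[of k] k by auto
        then show ?thesis by (auto simp: E_def L_def)
      qed
    qed
  qed (use lohi(3) in auto)
  have hi: "hi = lo + int n - 1" using full cardL n by auto
  have adj: "\<bar>sq_pos s - sq_pos s'\<bar> = 1"
    if s: "s \<in> t" "s' \<in> t" "sq_level s' = sq_level s + 1" for s s'
  proof -
    have "lo \<le> sq_level s" "sq_level s < hi" using lohi(3) s by (force simp: L_def)+
    then obtain u v where uv: "(u, v) \<in> E" "sq_level u = sq_level s" "sq_level v = sq_level s + 1"
      using cross by blast
    then have "u = s" "v = s'" using s injL by (auto simp: E_def inj_on_def)
    with uv show ?thesis by (auto simp: E_def sq_adjacent_iff)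
  qed
  have "ribbon lo hi t"
    unfolding ribbon_def
  proof (intro conjI ballI impI)
    fix k assume "k \<in> {lo..hi}"
    then obtain s where "s \<in> t" "sq_level s = k" using full by (metis L_def imageE)
    then show "\<exists>!s. s \<in> t \<and> sq_level s = k" using injL by (auto simp: inj_on_def)
  qed (use lohi adj in \<open>auto simp: L_def\<close>)
  with hi show ?thesis by blast
qed

section \<open>Comparing disjoint ribbons\<close>

text \<open>One of the two compared squares moves a step along its ribbon towards its target. Its
  position changes by one, so the order could at worst become an equality, which
  \<open>sq_pos_neq\<close> excludes for squares of disjoint ribbons on close levels. The induction
  is on the total number of steps left.\<close>

lemma ribbon_order_steps:
  assumes r: "ribbon lo hi t" and r': "ribbon lo' hi' t'" and disj: "t \<inter> t' = {}"
    and "s \<in> t" "s' \<in> t'" "\<bar>sq_level s - sq_level s'\<bar> \<le> 1" "sq_pos s < sq_pos s'"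
    and "u \<in> t" "u' \<in> t'" "\<bar>sq_level u - sq_level u'\<bar> \<le> 1"
  shows "sq_pos u < sq_pos u'"
  using assms(4-)
proof (induction "nat (\<bar>sq_level s - sq_level u\<bar> + \<bar>sq_level s' - sq_level u'\<bar>)"
    arbitrary: s s' rule: less_induct)
  case less
  note lev = ribbon_level[OF r less.prems(1)] ribbon_level[OF r' less.prems(2)]
    ribbon_level[OF r less.prems(5)] ribbon_level[OF r' less.prems(6)]
  have move: "sq_pos u < sq_pos u'"
    if v: "v \<in> t" "v' \<in> t'" "\<bar>sq_level v - sq_level v'\<bar> \<le> 1"
      and adj: "(v = s \<and> \<bar>sq_pos v' - sq_pos s'\<bar> \<le> 1) \<or> (v' = s' \<and> \<bar>sq_pos v - sq_pos s\<bar> \<le> 1)"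
      and dec: "\<bar>sq_level v - sq_level u\<bar> + \<bar>sq_level v' - sq_level u'\<bar>
        < \<bar>sq_level s - sq_level u\<bar> + \<bar>sq_level s' - sq_level u'\<bar>" for v v'
  proof -
    have "v \<noteq> v'" using v disj by auto
    then have "sq_pos v \<noteq> sq_pos v'" using sq_pos_neq v(3) by blast
    then have "sq_pos v < sq_pos v'" using adj less.prems(4) by auto
    then show ?thesis using less.hyps[of v v'] dec v less.prems by auto
  qed
  have step: "\<bar>sq_pos (sq_at t (sq_level s + d)) - sq_pos s\<bar> \<le> 1 \<and> sq_at t (sq_level s + d) \<in> t
      \<and> sq_level (sq_at t (sq_level s + d)) = sq_level s + d"
    if "\<bar>d\<bar> = 1" "lo \<le> sq_level s + d" "sq_level s + d \<le> hi" for d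
  proof -
    have "\<bar>sq_pos (sq_at t (sq_level s + d)) - sq_pos (sq_at t (sq_level s))\<bar> = 1"
      using that lev ribbon_step[OF r, of "sq_level s"] ribbon_step[OF r, of "sq_level s - 1"]
      by (auto simp: abs_if split: if_splits)
    then show ?thesis using sq_at[OF r, of "sq_level s + d"] that sq_at_level[OF r less.prems(1)] by auto
  qed
  have step': "\<bar>sq_pos (sq_at t' (sq_level s' + d)) - sq_pos s'\<bar> \<le> 1 \<and> sq_at t' (sq_level s' + d) \<in> t'
      \<and> sq_level (sq_at t' (sq_level s' + d)) = sq_level s' + d"
    if "\<bar>d\<bar> = 1" "lo' \<le> sq_level s' + d" "sq_level s' + d \<le> hi'" for d
  proof -
    have "\<bar>sq_pos (sq_at t' (sq_level s' + d)) - sq_pos (sq_at t' (sq_level s'))\<bar> = 1"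
      using that lev ribbon_step[OF r', of "sq_level s'"] ribbon_step[OF r', of "sq_level s' - 1"]
      by (auto simp: abs_if split: if_splits)
    then show ?thesis using sq_at[OF r', of "sq_level s' + d"] that sq_at_level[OF r' less.prems(2)] by auto
  qed
  have move_s: "sq_pos u < sq_pos u'"
    if "\<bar>d\<bar> = 1" "\<bar>sq_level s + d - sq_level s'\<bar> \<le> 1"
      "\<bar>sq_level s + d - sq_level u\<bar> < \<bar>sq_level s - sq_level u\<bar>" for d
  proof -
    have "d = 1 \<or> d = -1" using that(1) by linarith
    then have "lo \<le> sq_level s + d" "sq_level s + d \<le> hi" using that(3) lev(1,3) by auto
    from step[OF that(1) this] show ?thesis
      using that less.prems by (intro move[of "sq_at t (sq_level s + d)" s']) auto
  qed
  have move_s': "sq_pos u < sq_pos u'"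
    if "\<bar>d\<bar> = 1" "\<bar>sq_level s - (sq_level s' + d)\<bar> \<le> 1"
      "\<bar>sq_level s' + d - sq_level u'\<bar> < \<bar>sq_level s' - sq_level u'\<bar>" for d
  proof -
    have "d = 1 \<or> d = -1" using that(1) by linarith
    then have "lo' \<le> sq_level s' + d" "sq_level s' + d \<le> hi'" using that(3) lev(2,4) by auto
    from step'[OF that(1) this] show ?thesis
      using that less.prems by (intro move[of s "sq_at t' (sq_level s' + d)"]) auto
  qed
  have eq: "s = u" if "sq_level s = sq_level u" using ribbon_unique[OF r less.prems(1,5) that] .
  have eq': "s' = u'" if "sq_level s' = sq_level u'" using ribbon_unique[OF r' less.prems(2,6) that] .
  \<comment> \<open>When \<open>s\<close> is not yet on the level of \<open>u\<close>, the square
    that trails in the direction of travel moves first (\<open>s\<close> in a tie), so the two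
    levels stay within one of each other.\<close>
  consider "sq_level s < sq_level u" "sq_level s \<le> sq_level s'"
    | "sq_level s < sq_level u" "sq_level s > sq_level s'"
    | "sq_level s > sq_level u" "sq_level s \<ge> sq_level s'"
    | "sq_level s > sq_level u" "sq_level s < sq_level s'"
    | "sq_level s = sq_level u" "sq_level s' < sq_level u'"
    | "sq_level s = sq_level u" "sq_level s' > sq_level u'"
    | "sq_level s = sq_level u" "sq_level s' = sq_level u'" by linarith
  then show ?case
  proof cases
    case 1 then show ?thesis using move_s[of 1] less.prems by auto
  next
    case 2 then show ?thesis using move_s'[of 1] less.prems by auto
  next
    case 3 then show ?thesis using move_s[of "-1"] less.prems by auto
  next
    case 4 then show ?thesis using move_s'[of "-1"] less.prems by auto
  next
    case 5 then show ?thesis using move_s'[of 1] less.prems by auto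
  next
    case 6 then show ?thesis using move_s'[of "-1"] less.prems by auto
  next
    case 7 then show ?thesis using eq eq' less.prems by auto
  qed
qed

text \<open>An existential over pairs of squares becomes a test on any one pair on close levels, so
  every later argument can choose the levels that suit it.\<close>

lemma set_left_iff:
  assumes "ribbon lo hi t" "ribbon lo' hi' t'" "t \<inter> t' = {}"
    and "s \<in> t" "s' \<in> t'" "\<bar>sq_level s - sq_level s'\<bar> \<le> 1"
  shows "set_left t t' \<longleftrightarrow> sq_pos s < sq_pos s'"
proof
  assume "set_left t t'"
  then obtain u u' where "u \<in> t" "u' \<in> t'" "\<bar>sq_level u - sq_level u'\<bar> \<le> 1" "sq_pos u < sq_pos u'"
    by (auto simp: set_left_def sq_left_iff)
  from ribbon_order_steps[OF assms(1-3) this assms(4-6)] show "sq_pos s < sq_pos s'" .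
next
  assume "sq_pos s < sq_pos s'"
  with assms(4-6) show "set_left t t'" unfolding set_left_def sq_left_iff by blast
qed

lemma touching_witness:
  assumes "ribbon lo hi t" "ribbon lo' hi' t'" "lo \<le> hi' + 1" "lo' \<le> hi + 1"
  obtains s s' where "s \<in> t" "s' \<in> t'" "\<bar>sq_level s - sq_level s'\<bar> \<le> 1"
proof -
  \<comment> \<open>Both ribbons reach up to level \<open>k - 1\<close> at least. One that ends just
    below \<open>k\<close> contributes its square of level \<open>k - 1\<close>, which is the slack
    of one in touching.\<close>
  define k where "k = max lo lo'"
  have "lo \<le> min hi k" "lo' \<le> min hi' k" using assms by (auto simp: k_def dest: ribbon_le)
  moreover have "min hi k \<in> {k - 1..k}" "min hi' k \<in> {k - 1..k}"
    using assms(1,2)[THEN ribbon_le] assms(3,4) by (auto simp: k_def)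
  ultimately show ?thesis
    using that[of "sq_at t (min hi k)" "sq_at t' (min hi' k)"] sq_at[OF assms(1), of "min hi k"]
      sq_at[OF assms(2), of "min hi' k"] by auto
qed

lemma set_left_total:
  assumes "ribbon lo hi t" "ribbon lo' hi' t'" "lo \<le> hi' + 1" "lo' \<le> hi + 1" "t \<inter> t' = {}"
  shows "set_left t t' \<longleftrightarrow> \<not> set_left t' t"
proof -
  obtain s s' where s: "s \<in> t" "s' \<in> t'" "\<bar>sq_level s - sq_level s'\<bar> \<le> 1"
    using touching_witness assms by metis
  have "s \<noteq> s'" using s assms(5) by auto
  then have "sq_pos s \<noteq> sq_pos s'" using s sq_pos_neq by blast
  then show ?thesis
    using set_left_iff[OF assms(1,2) assms(5) s] set_left_iff[OF assms(2,1) _ s(2,1)] assms(5) s(3)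
    by (auto simp: Int_commute abs_minus_commute)
qed

lemma set_left_touching:
  assumes "ribbon lo hi t" "ribbon lo' hi' t'" "set_left t t'"
  shows "lo \<le> hi' + 1 \<and> lo' \<le> hi + 1"
proof -
  obtain s s' where s: "s \<in> t" "s' \<in> t'" "\<bar>sq_level s - sq_level s'\<bar> \<le> 1"
    using assms(3) by (auto simp: set_left_def sq_left_iff)
  with ribbon_level[OF assms(1) s(1)] ribbon_level[OF assms(2) s(2)] show ?thesis by linarith
qed

text \<open>Three pairwise touching intervals have a common point up to rounding, so the three ribbons
  can be compared on three squares whose levels differ by at most one.\<close>

lemma set_left_trans:
  assumes "ribbon lo1 hi1 t1" "ribbon lo2 hi2 t2" "ribbon lo3 hi3 t3"
    and "t1 \<inter> t2 = {}" "t2 \<inter> t3 = {}" "t1 \<inter> t3 = {}"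
    and "set_left t1 t2" "set_left t2 t3" "lo1 \<le> hi3 + 1" "lo3 \<le> hi1 + 1"
  shows "set_left t1 t3"
proof -
  note touch = set_left_touching[OF assms(1,2,7)] set_left_touching[OF assms(2,3,8)] assms(9,10)
  define k where "k = max lo1 (max lo2 lo3)"
  have "lo1 \<le> min hi1 k" "lo2 \<le> min hi2 k" "lo3 \<le> min hi3 k"
    using assms(1-3) by (auto simp: k_def dest: ribbon_le)
  note at = sq_at[OF assms(1) this(1)] sq_at[OF assms(2) this(2)] sq_at[OF assms(3) this(3)]
  have ge: "min hi1 k \<in> {k - 1..k}" "min hi2 k \<in> {k - 1..k}" "min hi3 k \<in> {k - 1..k}"
    using touch assms(1-3)[THEN ribbon_le] by (auto simp: k_def)
  have near: "\<bar>min hi1 k - min hi2 k\<bar> \<le> 1" "\<bar>min hi2 k - min hi3 k\<bar> \<le> 1" "\<bar>min hi1 k - min hi3 k\<bar> \<le> 1"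
    using ge unfolding atLeastAtMost_iff by linarith+
  let ?s1 = "sq_at t1 (min hi1 k)" and ?s2 = "sq_at t2 (min hi2 k)" and ?s3 = "sq_at t3 (min hi3 k)"
  have "sq_pos ?s1 < sq_pos ?s2"
    using set_left_iff[OF assms(1,2,4), of ?s1 ?s2] at near assms(7) by auto
  moreover have "sq_pos ?s2 < sq_pos ?s3"
    using set_left_iff[OF assms(2,3,5), of ?s2 ?s3] at near assms(8) by auto
  ultimately show ?thesis
    using set_left_iff[OF assms(1,3,6), of ?s1 ?s3] at near by auto
qed

section \<open>Winding numbers of lattice cycles\<close>

text \<open>The winding number around \<open>s\<close> counts signed crossings of a ray which leaves \<open>s\<close> to the
  right, slightly above the row of \<open>s\<close>.\<close>

definition ray_crossing :: "square \<Rightarrow> square \<Rightarrow> square \<Rightarrow> int" where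
  "ray_crossing s a b =
     (if fst a = fst b \<and> fst a > fst s then
        (if snd a = snd s \<and> snd b = snd s + 1 then 1
         else if snd b = snd s \<and> snd a = snd s + 1 then - 1 else 0) else 0)"

fun crossings :: "square \<Rightarrow> square list \<Rightarrow> int" where
  "crossings s (a # b # ws) = ray_crossing s a b + crossings s (b # ws)"
| "crossings s _ = 0"

lemma crossings_append:
  "ws \<noteq> [] \<Longrightarrow> vs \<noteq> [] \<Longrightarrow>
     crossings s (ws @ vs) = crossings s ws + ray_crossing s (last ws) (hd vs) + crossings s vs"
proof (induction ws rule: induct_list012)
  case (2 a) then show ?case by (cases vs) auto
qed auto

lemma ray_crossing_swap: "ray_crossing s b a = - ray_crossing s a b"
  by (auto simp: ray_crossing_def)

lemma crossings_rev: "crossings s (rev ws) = - crossings s ws"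
proof (induction s ws rule: crossings.induct)
  case (1 s a b ws)
  have "crossings s (rev (a # b # ws)) = crossings s (rev (b # ws)) + ray_crossing s b a"
    using crossings_append[of "rev (b # ws)" "[a]" s] by (simp add: last_rev)
  with 1 show ?case by (simp add: ray_crossing_swap[of s b a])
qed auto

text \<open>The factor \<open>c\<close> cancels in the derivative, so it can be used to turn the cut
  of \<open>Ln\<close> away from the segment.\<close>

lemma inverse_has_contour_integral_linepath:
  assumes "c \<noteq> 0" and "\<And>w. w \<in> closed_segment a b \<Longrightarrow> c * (w - z) \<notin> \<real>\<^sub>\<le>\<^sub>0"
  shows "((\<lambda>w. 1 / (w - z)) has_contour_integral (Ln (c * (b - z)) - Ln (c * (a - z)))) (linepath a b)"
proof -
  have "((\<lambda>w. Ln (c * (w - z))) has_field_derivative 1 / (w - z)) (at w within closed_segment a b)"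
    if "w \<in> closed_segment a b" for w
    using assms(2)[OF that] assms(1)
    by (auto intro!: derivative_eq_intros simp: divide_simps)
  from contour_integral_primitive[OF this, of "linepath a b"] show ?thesis by simp
qed

text \<open>A branch of the logarithm that is cut just above the positive real axis.\<close>

definition ray_log :: "complex \<Rightarrow> complex" where
  "ray_log u = (if Im u = 0 \<and> Re u > 0 then Ln u + \<i> * pi else Ln (- u))"

text \<open>Against the principal branch, \<open>ray_log\<close> is shifted by opposite constants
  above the ray and on or below the row. The jump of \<open>2 * pi * \<i>\<close> is what one
  crossing of the ray contributes.\<close>

lemma ray_log_right:
  assumes "Re u > 0"
  shows "ray_log u = Ln u + (if Im u > 0 then - \<i> * pi else \<i> * pi)"
proof -
  have "u \<noteq> 0" using assms by auto
  then show ?thesis using Ln_minus[of u] assms by (auto simp: ray_log_def)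
qed

text \<open>An edge with an end to the right of \<open>s\<close> in its row stays in the open right
  half-plane, where \<open>Ln\<close> is a primitive and the change of its offset to
  \<open>ray_log\<close> is the crossing term. Every other edge stays strictly to the left of, above
  or below \<open>s\<close>, where \<open>Ln (- u)\<close> is a primitive that agrees with
  \<open>ray_log\<close> at both ends.\<close>

lemma lattice_edge_integral:
  assumes adj: "sq_adjacent a b" and ne: "a \<noteq> s" "b \<noteq> s"
  shows "((\<lambda>w. 1 / (w - sq_center s)) has_contour_integral
     (ray_log (sq_center b - sq_center s) - ray_log (sq_center a - sq_center s)
       + 2 * pi * \<i> * of_int (ray_crossing s a b))) (linepath (sq_center a) (sq_center b))
   \<and> sq_center s \<notin> closed_segment (sq_center a) (sq_center b)"
proof -
  define z where "z = sq_center s"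
  define a' where "a' = sq_center a"
  define b' where "b' = sq_center b"
  define ax where "ax = fst a - fst s"
  define ay where "ay = snd a - snd s"
  define bx where "bx = fst b - fst s"
  define b_y where "b_y = snd b - snd s"
  have re: "Re (a' - z) = of_int ax" "Im (a' - z) = of_int ay"
    "Re (b' - z) = of_int bx" "Im (b' - z) = of_int b_y"
    by (auto simp: a'_def b'_def z_def ax_def ay_def bx_def b_y_def sq_center_def)
  have adj': "\<bar>ax - bx\<bar> + \<bar>ay - b_y\<bar> = 1"
    using adj by (simp add: sq_adjacent_def ax_def ay_def bx_def b_y_def)
  have ne': "\<not> (ax = 0 \<and> ay = 0)" "\<not> (bx = 0 \<and> b_y = 0)"
    using ne by (auto simp: ax_def ay_def bx_def b_y_def prod_eq_iff)
  have cr: "ray_crossing s a b = (if ax = bx \<and> ax > 0 then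
        (if ay = 0 \<and> b_y = 1 then 1 else if b_y = 0 \<and> ay = 1 then - 1 else 0) else 0)"
    by (auto simp: ray_crossing_def ax_def ay_def bx_def b_y_def)
  have seg: "closed_segment a' b' \<subseteq> S" if "convex S" "a' \<in> S" "b' \<in> S" for S
    using that by (simp add: closed_segment_subset)
  have notin: "z \<notin> closed_segment a' b'"
    if "\<And>w. w \<in> closed_segment a' b' \<Longrightarrow> c * (w - z) \<notin> \<real>\<^sub>\<le>\<^sub>0" for c
    using that[of z] by auto
  show ?thesis
  proof (cases "(ax > 0 \<and> ay = 0) \<or> (bx > 0 \<and> b_y = 0)")
    case True
    then have pos: "ax > 0" "bx > 0" using adj' ne' by linarith+
    have "closed_segment a' b' \<subseteq> {w. Re w > Re z}"
      using pos re by (intro seg convex_halfspace_Re_gt) (auto simp: algebra_simps)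
    then have av: "1 * (w - z) \<notin> \<real>\<^sub>\<le>\<^sub>0" if "w \<in> closed_segment a' b'" for w
      using that by (auto simp: complex_nonpos_Reals_iff)
    have I: "((\<lambda>w. 1 / (w - z)) has_contour_integral (Ln (b' - z) - Ln (a' - z))) (linepath a' b')"
      using inverse_has_contour_integral_linepath[of 1, OF _ av] by simp
    have la: "ray_log (a' - z) = Ln (a' - z) + (if ay > 0 then - \<i> * pi else \<i> * pi)"
      and lb: "ray_log (b' - z) = Ln (b' - z) + (if b_y > 0 then - \<i> * pi else \<i> * pi)"
      using ray_log_right[of "a' - z"] ray_log_right[of "b' - z"] re pos by simp_all
    have "(if b_y > 0 then - \<i> * pi else \<i> * pi) - (if ay > 0 then - \<i> * pi else \<i> * pi)
        + 2 * pi * \<i> * of_int (ray_crossing s a b) = 0"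
    proof -
      \<comment> \<open>Either the edge stays on or below the row of \<open>s\<close>, or it crosses
        the ray upwards or downwards.\<close>
      have "(ay \<le> 0 \<and> b_y \<le> 0 \<and> ray_crossing s a b = 0) \<or> (ay = 0 \<and> b_y = 1 \<and> ray_crossing s a b = 1)
          \<or> (ay = 1 \<and> b_y = 0 \<and> ray_crossing s a b = -1)"
        using True adj' pos unfolding cr by (auto simp: abs_if split: if_splits)
      then show ?thesis by auto
    qed
    then have "ray_log (b' - z) - ray_log (a' - z) + 2 * pi * \<i> * of_int (ray_crossing s a b)
        = Ln (b' - z) - Ln (a' - z)"
      unfolding la lb by algebra
    with I notin[OF av] show ?thesis by (simp add: a'_def b'_def z_def)
  next
    case False
    have small: "\<bar>ay - b_y\<bar> \<le> 1" "ay \<noteq> b_y \<Longrightarrow> ax = bx" using adj' by linarith+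
    have "(ax < 0 \<and> bx < 0) \<or> (ay > 0 \<and> b_y > 0) \<or> (ay < 0 \<and> b_y < 0)"
    proof (cases "ay = 0 \<or> b_y = 0")
      case zero: True
      have "ay = 0 \<Longrightarrow> ax < 0" "b_y = 0 \<Longrightarrow> bx < 0" using False ne' by auto
      with zero small(2) show ?thesis by (cases "ay = b_y") auto
    next
      case nonzero: False
      with small(1) show ?thesis by linarith
    qed
    then consider "ax < 0" "bx < 0" | "ay > 0" "b_y > 0" | "ay < 0" "b_y < 0" by blast
    then have "closed_segment a' b' \<subseteq> {w. Re w < Re z} \<or> closed_segment a' b' \<subseteq> {w. Im w > Im z}
        \<or> closed_segment a' b' \<subseteq> {w. Im w < Im z}"
    proof cases
      case 1
      then have "closed_segment a' b' \<subseteq> {w. Re w < Re z}"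
        using re by (intro seg convex_halfspace_Re_lt) (auto simp: algebra_simps)
      then show ?thesis by blast
    next
      case 2
      then have "closed_segment a' b' \<subseteq> {w. Im w > Im z}"
        using re by (intro seg convex_halfspace_Im_gt) (auto simp: algebra_simps)
      then show ?thesis by blast
    next
      case 3
      then have "closed_segment a' b' \<subseteq> {w. Im w < Im z}"
        using re by (intro seg convex_halfspace_Im_lt) (auto simp: algebra_simps)
      then show ?thesis by blast
    qed
    then have av: "(-1) * (w - z) \<notin> \<real>\<^sub>\<le>\<^sub>0" if "w \<in> closed_segment a' b'" for w
      using that by (fastforce simp: complex_nonpos_Reals_iff)
    have I: "((\<lambda>w. 1 / (w - z)) has_contour_integral (Ln (- (b' - z)) - Ln (- (a' - z)))) (linepath a' b')"
      using inverse_has_contour_integral_linepath[of "-1", OF _ av] by simp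
    have "ray_log (a' - z) = Ln (- (a' - z))" "ray_log (b' - z) = Ln (- (b' - z))"
      unfolding ray_log_def re using False by auto
    moreover have "ray_crossing s a b = 0" unfolding cr using False by auto
    ultimately show ?thesis using I notin[OF av] by (simp add: a'_def b'_def z_def)
  qed
qed

text \<open>The edge integrals telescope; on a closed walk the two \<open>ray_log\<close> terms
  cancel and only the crossings remain. The facts on end points and image are carried along for
  joining the paths.\<close>

lemma polyline_integral:
  assumes "ws \<noteq> []" "successively sq_adjacent ws" "s \<notin> set ws"
  shows "valid_path (polyline (map sq_center ws)) \<and>
    pathstart (polyline (map sq_center ws)) = sq_center (hd ws) \<and>
    pathfinish (polyline (map sq_center ws)) = sq_center (last ws) \<and>
    sq_center s \<notin> path_image (polyline (map sq_center ws)) \<and>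
    ((\<lambda>w. 1 / (w - sq_center s)) has_contour_integral
     (ray_log (sq_center (last ws) - sq_center s) - ray_log (sq_center (hd ws) - sq_center s)
       + 2 * pi * \<i> * of_int (crossings s ws))) (polyline (map sq_center ws))"
  using assms
proof (induction s ws rule: crossings.induct)
  case (1 s a b ws)
  let ?p = "polyline (map sq_center (b # ws))"
  have adj: "sq_adjacent a b" "a \<noteq> s" "b \<noteq> s" using "1.prems" by auto
  note IH = "1.IH"
  have prem: "b # ws \<noteq> []" "successively sq_adjacent (b # ws)" "s \<notin> set (b # ws)"
    using "1.prems" by auto
  note IH = "1.IH"[OF prem]
  note E = lattice_edge_integral[OF adj]
  have eq: "polyline (map sq_center (a # b # ws)) = linepath (sq_center a) (sq_center b) +++ ?p"
    by simp
  have start: "pathstart ?p = sq_center b" using IH by simp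
  have image: "sq_center s \<notin> path_image (linepath (sq_center a) (sq_center b) +++ ?p)"
    using E IH start by (subst path_image_join) auto
  have int: "((\<lambda>w. 1 / (w - sq_center s)) has_contour_integral
     ((ray_log (sq_center b - sq_center s) - ray_log (sq_center a - sq_center s)
       + 2 * pi * \<i> * of_int (ray_crossing s a b)) +
      (ray_log (sq_center (last (b # ws)) - sq_center s) - ray_log (sq_center (hd (b # ws)) - sq_center s)
       + 2 * pi * \<i> * of_int (crossings s (b # ws))))) (linepath (sq_center a) (sq_center b) +++ ?p)"
    using E IH start by (intro has_contour_integral_join) auto
  show ?case
    unfolding eq using IH image int start by (auto simp: algebra_simps)
next
  case ("2_2" s a)
  then have "sq_center s \<noteq> sq_center a" by (auto simp: sq_center_def prod_eq_iff)
  moreover have poly: "polyline (map sq_center [a]) = linepath (sq_center a) (sq_center a)"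
    by (simp only: list.map polyline.simps)
  moreover have "path_image (linepath (sq_center a) (sq_center a)) = {sq_center a}" by simp
  ultimately show ?case
    unfolding poly by (simp only: list.sel last.simps crossings.simps valid_path_linepath
        pathstart_linepath pathfinish_linepath singleton_iff if_True diff_self of_int_0
        mult_zero_right add_0_right has_contour_integral_trivial simp_thms)
qed auto

lemma winding_number_eq_crossings:
  assumes "sq_cycle R ws" "s \<notin> R"
  shows "winding_number (polyline (map sq_center ws)) (sq_center s) = of_int (crossings s ws)"
proof -
  have ws: "ws \<noteq> []" "successively sq_adjacent ws" "s \<notin> set ws" "hd ws = last ws"
    using assms by (auto simp: sq_cycle_def)
  note P = polyline_integral[OF ws(1-3)]
  have "contour_integral (polyline (map sq_center ws)) (\<lambda>w. 1 / (w - sq_center s))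
      = 2 * pi * \<i> * of_int (crossings s ws)"
    using P ws(4) by (intro contour_integral_unique) auto
  with P show ?thesis by (subst winding_number_valid_path) auto
qed

section \<open>Complements of simply connected regions\<close>

lemma region_walk:
  assumes "region R" "a \<in> R" "b \<in> R"
  obtains ws where "ws \<noteq> []" "hd ws = a" "last ws = b" "set ws \<subseteq> R" "successively sq_adjacent ws"
proof -
  have "(a, b) \<in> {(u, v). u \<in> R \<and> v \<in> R \<and> sq_adjacent u v}\<^sup>*"
    using assms by (simp add: region_def sq_connected_def)
  then have "\<exists>ws. ws \<noteq> [] \<and> hd ws = a \<and> last ws = b \<and> set ws \<subseteq> R \<and> successively sq_adjacent ws"
  proof (induction rule: rtrancl_induct)
    case base
    show ?case using assms by (intro exI[of _ "[a]"]) auto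
  next
    case (step b c)
    then obtain ws where ws: "ws \<noteq> []" "hd ws = a" "last ws = b" "set ws \<subseteq> R" "successively sq_adjacent ws"
      by auto
    then show ?case using step(2)
      by (intro exI[of _ "ws @ [c]"]) (auto simp: successively_append_iff)
  qed
  with that show ?thesis by blast
qed

text \<open>A discrete primitive: \<open>f b\<close> counts the crossings along a chosen walk from a
  base square to \<open>b\<close>. The chosen walks to \<open>a\<close> and \<open>b\<close> and the
  step between them form a cycle, whose winding number around \<open>s\<close> is zero.\<close>

lemma ray_crossing_potential:
  assumes "simply_connected_region R" "s \<notin> R"
  obtains f :: "square \<Rightarrow> int"
  where "\<And>a b. a \<in> R \<Longrightarrow> b \<in> R \<Longrightarrow> sq_adjacent a b \<Longrightarrow> ray_crossing s a b = f b - f a"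
proof (cases "R = {}")
  case False
  then obtain r where r: "r \<in> R" by auto
  have reg: "region R" using assms(1) by (simp add: simply_connected_region_def)
  have "\<forall>b\<in>R. \<exists>ws. ws \<noteq> [] \<and> hd ws = r \<and> last ws = b \<and> set ws \<subseteq> R \<and> successively sq_adjacent ws"
    using region_walk[OF reg r] by metis
  then obtain W where W: "\<And>b. b \<in> R \<Longrightarrow> W b \<noteq> [] \<and> hd (W b) = r \<and> last (W b) = b
      \<and> set (W b) \<subseteq> R \<and> successively sq_adjacent (W b)"
    by metis
  have "ray_crossing s a b = crossings s (W b) - crossings s (W a)"
    if ab: "a \<in> R" "b \<in> R" "sq_adjacent a b" for a b
  proof -
    let ?ws = "W a @ rev (W b)"
    have revadj: "successively sq_adjacent (rev (W b))"
      using W[OF ab(2)] by (simp add: sq_adjacent_def abs_minus_commute)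
    have "sq_cycle R ?ws"
      using W[OF ab(1)] W[OF ab(2)] ab(3) revadj
      by (auto simp: sq_cycle_def successively_append_iff hd_rev last_rev)
    then have "winding_number (polyline (map sq_center ?ws)) (sq_center s) = 0"
      using assms unfolding simply_connected_region_def by blast
    then have "crossings s ?ws = 0"
      using winding_number_eq_crossings[OF \<open>sq_cycle R ?ws\<close> assms(2)] by simp
    moreover have "crossings s ?ws = crossings s (W a) + ray_crossing s a b - crossings s (W b)"
      using W[OF ab(1)] W[OF ab(2)] by (subst crossings_append) (auto simp: hd_rev crossings_rev)
    ultimately show ?thesis by simp
  qed
  then show ?thesis by (rule that)
qed (rule that[of "\<lambda>_. 0"], simp)

text \<open>The cancellation behind a discrete Stokes formula. With \<open>h\<close> a translation
  of cells, an edge between two cells of \<open>U\<close> is counted from both sides, and the edges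
  on the rim of \<open>U\<close> carry weight 0.\<close>

lemma sum_image_neutral:
  fixes g :: "'a \<Rightarrow> int"
  assumes "finite U" "inj_on h U" "\<And>q. q \<in> h ` U - U \<Longrightarrow> g q = 0" "\<And>q. q \<in> U - h ` U \<Longrightarrow> g q = 0"
  shows "(\<Sum>q\<in>U. g (h q)) = (\<Sum>q\<in>U. g q)"
proof -
  have "(\<Sum>q\<in>U. g (h q)) = sum g (h ` U)" using assms(2) by (simp add: sum.reindex)
  also have "\<dots> = sum g (h ` U \<inter> U)"
    using assms by (intro sum.mono_neutral_right) auto
  also have "\<dots> = sum g U"
    using assms by (intro sum.mono_neutral_left) auto
  finally show ?thesis .
qed

text \<open>Corner contact is included because \<open>R\<close> is connected through edges only: no
  walk in \<open>R\<close> passes between two squares outside \<open>R\<close> that touch at a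
  corner.\<close>

definition king_adjacent :: "square \<Rightarrow> square \<Rightarrow> bool" where
  "king_adjacent s s' \<longleftrightarrow> s \<noteq> s' \<and> \<bar>fst s - fst s'\<bar> \<le> 1 \<and> \<bar>snd s - snd s'\<bar> \<le> 1"

text \<open>The complement of a simply connected region has no bounded part: otherwise let \<open>U\<close> be the
  set of dual cells with a corner in such a part \<open>C\<close>. The boundary of \<open>U\<close> runs inside \<open>R\<close> and has
  winding number 1 around every square of \<open>C\<close>, although crossing numbers have a potential on \<open>R\<close>.\<close>

lemma no_bounded_complement_part:
  assumes sc: "simply_connected_region R" and fin: "finite C" and disj: "C \<inter> R = {}"
    and closed: "\<And>s s'. s \<in> C \<Longrightarrow> king_adjacent s s' \<Longrightarrow> s' \<in> C \<union> R"
  shows "C = {}"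
proof (rule ccontr)
  assume "C \<noteq> {}"
  then obtain sx sy where s: "(sx, sy) \<in> C" by auto
  let ?s = "(sx, sy)"
  obtain f where f: "\<And>a b. a \<in> R \<Longrightarrow> b \<in> R \<Longrightarrow> sq_adjacent a b \<Longrightarrow> ray_crossing ?s a b = f b - f a"
    using ray_crossing_potential[OF sc, of ?s] s disj by (metis disjoint_iff)
  \<comment> \<open>A cell is named by its lower left corner; its corners are the centers of four
    squares.\<close>
  define U where "U = {q. \<exists>i\<in>{0, 1}. \<exists>j\<in>{0, 1}. (fst q + i, snd q + j) \<in> C}"
  have "U \<subseteq> (\<Union>i\<in>{0, 1}. \<Union>j\<in>{0, 1}. (\<lambda>q. (fst q - i, snd q - j)) ` C)"
    by (force simp: U_def image_iff)
  then have finU: "finite U" by (rule finite_subset) (use fin in auto)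
  have inU: "(x, y) \<in> U \<longleftrightarrow> (x, y) \<in> C \<or> (x + 1, y) \<in> C \<or> (x, y + 1) \<in> C \<or> (x + 1, y + 1) \<in> C" for x y
    by (auto simp: U_def)
  have near: "(x', y') \<in> C \<union> R" if xy: "(x, y) \<in> U" and "x' \<in> {x, x + 1}" "y' \<in> {y, y + 1}" for x y x' y'
  proof -
    obtain i j where ij: "i \<in> {0, 1}" "j \<in> {0, 1}" "(x + i, y + j) \<in> C"
      using xy unfolding U_def mem_Collect_eq fst_conv snd_conv by blast
    show ?thesis
    proof (cases "(x + i, y + j) = (x', y')")
      case False
      then have "king_adjacent (x + i, y + j) (x', y')"
        using that(2,3) ij(1,2) by (auto simp: king_adjacent_def)
      then show ?thesis using closed ij(3) by blast
    qed (use ij in auto)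
  qed
  \<comment> \<open>Both weights measure how far \<open>f\<close> fails to account for the crossings
    along an edge, upwards from \<open>(x, y)\<close> for \<open>gv\<close> and to the right for
    \<open>gh\<close>; horizontal edges have no crossings.\<close>
  define gv where "gv = (\<lambda>(x, y). ray_crossing ?s (x, y) (x, y + 1) - (f (x, y + 1) - f (x, y)))"
  define gh where "gh = (\<lambda>(x, y). - (f (x + 1, y) - f (x, y)))"
  \<comment> \<open>An edge with exactly one of its two cells in \<open>U\<close> has no end in
    \<open>C\<close>, so both ends lie in \<open>R\<close>, where \<open>f\<close> is a
    potential.\<close>
  have gv0: "gv (x, y) = 0" if "((x, y) \<in> U) \<noteq> ((x - 1, y) \<in> U)" for x y
  proof -
    have "(x, y) \<notin> C" "(x, y + 1) \<notin> C" using that inU[of x y] inU[of "x - 1" y] by auto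
    moreover have "(x, y) \<in> C \<union> R" "(x, y + 1) \<in> C \<union> R"
      using that near[of x y] near[of "x - 1" y] by auto
    ultimately show ?thesis using f[of "(x, y)" "(x, y + 1)"] by (simp add: gv_def sq_adjacent_def)
  qed
  have gh0: "gh (x, y) = 0" if "((x, y) \<in> U) \<noteq> ((x, y - 1) \<in> U)" for x y
  proof -
    have "(x, y) \<notin> C" "(x + 1, y) \<notin> C" using that inU[of x y] inU[of x "y - 1"] by auto
    moreover have "(x, y) \<in> C \<union> R" "(x + 1, y) \<in> C \<union> R"
      using that near[of x y] near[of x "y - 1"] by auto
    ultimately show ?thesis using f[of "(x, y)" "(x + 1, y)"]
      by (simp add: gh_def sq_adjacent_def ray_crossing_def)
  qed
  let ?r = "\<lambda>(x, y). (x + 1, y) :: square" and ?u = "\<lambda>(x, y). (x, y + 1) :: square"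
  have imr: "(x, y) \<in> ?r ` U \<longleftrightarrow> (x - 1, y) \<in> U" and imu: "(x, y) \<in> ?u ` U \<longleftrightarrow> (x, y - 1) \<in> U" for x y
    by (force simp: image_iff)+
  have "(\<Sum>q\<in>U. gv (?r q)) = (\<Sum>q\<in>U. gv q)"
  proof (rule sum_image_neutral[OF finU])
    show "inj_on ?r U" by (auto simp: inj_on_def)
    show "gv q = 0" if "q \<in> ?r ` U - U" for q using that by (cases q) (metis DiffE gv0 imr)
    show "gv q = 0" if "q \<in> U - ?r ` U" for q using that by (cases q) (metis DiffE gv0 imr)
  qed
  moreover have "(\<Sum>q\<in>U. gh (?u q)) = (\<Sum>q\<in>U. gh q)"
  proof (rule sum_image_neutral[OF finU])
    show "inj_on ?u U" by (auto simp: inj_on_def)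
    show "gh q = 0" if "q \<in> ?u ` U - U" for q using that by (cases q) (metis DiffE gh0 imu)
    show "gh q = 0" if "q \<in> U - ?u ` U" for q using that by (cases q) (metis DiffE gh0 imu)
  qed
  ultimately have "(\<Sum>q\<in>U. gv (?r q) - gv q + gh q - gh (?u q)) = 0"
    by (simp add: sum.distrib sum_subtractf)
  \<comment> \<open>This is the circulation around the cell \<open>q\<close>, in which
    \<open>f\<close> cancels. Of the cells in the row of the ray, only \<open>?s\<close> has just
    one vertical edge counted: its left edge starts at the center of \<open>?s\<close> itself, and
    \<open>ray_crossing\<close> demands a larger abscissa.\<close>
  moreover have "gv (?r q) - gv q + gh q - gh (?u q) = (if q = ?s then 1 else 0)" for q
    by (cases q) (auto simp: gv_def gh_def ray_crossing_def)
  moreover have "?s \<in> U" using s inU by blast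
  ultimately show False using finU by simp
qed

section \<open>Orientations of interval graphs\<close>

text \<open>An interval graph is chordal: the vertex whose interval ends first has pairwise adjacent
  neighbours, so it can be bypassed in every closed walk. Hence an orientation without directed
  triangles is acyclic.\<close>

lemma interval_orientation_acyclic:
  fixes lo hi :: "'a \<Rightarrow> int"
  assumes "finite V" "A \<subseteq> V \<times> V"
    and "\<And>a. (a, a) \<notin> A"
    and "\<And>a b. (a, b) \<in> A \<Longrightarrow> lo a \<le> hi b + 1 \<and> lo b \<le> hi a + 1"
    and "\<And>a b c. (a, b) \<in> A \<Longrightarrow> (b, c) \<in> A \<Longrightarrow> lo a \<le> hi c + 1 \<Longrightarrow> lo c \<le> hi a + 1 \<Longrightarrow> (a, c) \<in> A"
  shows "acyclic A"
  using assms
proof (induction "card V" arbitrary: V A)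
  case 0
  then have "A = {}" by auto
  then show ?case by (simp add: acyclic_def)
next
  case (Suc m)
  then have "V \<noteq> {}" by auto
  then obtain v where v: "v \<in> V" "\<And>w. w \<in> V \<Longrightarrow> hi v \<le> hi w"
    using Suc.prems(1) by (metis arg_min_if_finite(1) arg_min_least)
  define B where "B = A \<inter> (V - {v}) \<times> (V - {v})"
  have acB: "acyclic B"
  proof (rule Suc.hyps(1)[of "V - {v}"])
    show "m = card (V - {v})" using Suc.hyps(2) v(1) Suc.prems(1) by simp
    show "finite (V - {v})" using Suc.prems(1) by simp
    show "B \<subseteq> (V - {v}) \<times> (V - {v})" by (auto simp: B_def)
    show "(a, a) \<notin> B" for a using Suc.prems(3) by (auto simp: B_def)
    show "lo a \<le> hi b + 1 \<and> lo b \<le> hi a + 1" if "(a, b) \<in> B" for a b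
      using that Suc.prems(4) by (auto simp: B_def)
    show "(a, c) \<in> B" if "(a, b) \<in> B" "(b, c) \<in> B" "lo a \<le> hi c + 1" "lo c \<le> hi a + 1" for a b c
      using that Suc.prems(5)[of a b c] by (auto simp: B_def)
  qed
  \<comment> \<open>As \<open>v\<close> ends first, both neighbours begin at most one level above
    its end and end no earlier, so their intervals touch.\<close>
  have bypass: "(a, b) \<in> B" if "(a, v) \<in> A" "(v, b) \<in> A" for a b
  proof -
    have in_V: "a \<in> V" "b \<in> V" using that Suc.prems(2) by auto
    have "a \<noteq> v" "b \<noteq> v" using that Suc.prems(3) by auto
    moreover have "(a, b) \<in> A"
      using Suc.prems(4)[OF that(1)] Suc.prems(4)[OF that(2)] v(2)[OF in_V(1)] v(2)[OF in_V(2)]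
      by (intro Suc.prems(5)[OF that]) auto
    ultimately show ?thesis using in_V by (simp add: B_def)
  qed
  \<comment> \<open>A walk that passes \<open>v\<close> skips it by \<open>bypass\<close>; while it
    stands at \<open>v\<close>, its previous vertex is kept so that the next step can be joined to
    it.\<close>
  have lift: "(y \<noteq> v \<longrightarrow> (x, y) \<in> B\<^sup>+) \<and> (y = v \<longrightarrow> (\<exists>a. (x, a) \<in> B\<^sup>* \<and> (a, v) \<in> A))"
    if "(x, y) \<in> A\<^sup>+" "x \<noteq> v" for x y
    using that
  proof (induction rule: trancl_induct)
    case (base y)
    then have "y \<noteq> v \<Longrightarrow> (x, y) \<in> B" using Suc.prems(2) by (auto simp: B_def)
    with base show ?case by auto
  next
    case (step y z)
    show ?case
    proof (cases "y = v")
      case True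
      then obtain a where a: "(x, a) \<in> B\<^sup>*" "(a, v) \<in> A" using step by auto
      have "(a, z) \<in> B" using bypass[OF a(2)] step(2) True by simp
      then have "(x, z) \<in> B\<^sup>+" "z \<noteq> v" using a(1) by (auto simp: B_def intro: rtrancl_into_trancl1)
      then show ?thesis by simp
    next
      case False
      then have xy: "(x, y) \<in> B\<^sup>+" using step by simp
      show ?thesis
      proof (cases "z = v")
        case True
        then show ?thesis using xy step(2) by (blast intro: trancl_into_rtrancl)
      next
        case zv: False
        then have "(y, z) \<in> B" using step(2) False Suc.prems(2) by (auto simp: B_def)
        with xy zv show ?thesis by (auto intro: trancl.trancl_into_trancl)
      qed
    qed
  qed
  show ?case
  proof (rule acyclicI, rule allI, rule notI)
    fix x assume cyc: "(x, x) \<in> A\<^sup>+"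
    have "\<exists>y. y \<noteq> v \<and> (y, y) \<in> A\<^sup>+"
    proof (cases "x = v")
      case True
      obtain y where y: "(v, y) \<in> A" "(y, v) \<in> A\<^sup>*" using cyc True by (metis tranclD)
      then have "(y, y) \<in> A\<^sup>+" by (simp add: rtrancl_into_trancl1)
      moreover have "y \<noteq> v" using y(1) Suc.prems(3) by auto
      ultimately show ?thesis by blast
    qed (use cyc in auto)
    then obtain y where "y \<noteq> v" "(y, y) \<in> B\<^sup>+" using lift by blast
    then show False using acB by (simp add: acyclic_def)
  qed
qed

section \<open>Ribbon tilings\<close>

text \<open>Ranks serve twice: they number the tiles of a level, and they identify a square of a
  level by the number of squares on its left.\<close>

lemma bij_betw_rank:
  fixes f :: "'a \<Rightarrow> int"
  assumes "finite S" "inj_on f S"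
  shows "bij_betw (\<lambda>t. card {u \<in> S. f u < f t}) S {..<card S}"
proof -
  have lt: "card {u \<in> S. f u < f t} < card {u \<in> S. f u < f t'}" if "t \<in> S" "f t < f t'" for t t'
    using assms(1) that by (intro psubset_card_mono) auto
  have inj: "inj_on (\<lambda>t. card {u \<in> S. f u < f t}) S"
  proof (rule inj_onI)
    fix t t' assume t: "t \<in> S" "t' \<in> S" "card {u \<in> S. f u < f t} = card {u \<in> S. f u < f t'}"
    then have "f t = f t'" using lt[of t t'] lt[of t' t] by (cases "f t" "f t'" rule: linorder_cases) auto
    then show "t = t'" using t assms(2) by (auto simp: inj_on_def)
  qed
  have "card {u \<in> S. f u < f t} < card S" if "t \<in> S" for t
    using assms(1) that by (intro psubset_card_mono) auto
  then have "(\<lambda>t. card {u \<in> S. f u < f t}) ` S \<subseteq> {..<card S}" by auto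
  then have "(\<lambda>t. card {u \<in> S. f u < f t}) ` S = {..<card S}"
    by (intro card_subset_eq) (simp_all add: card_image[OF inj])
  with inj show ?thesis by (simp add: bij_betw_def)
qed

section \<open>Level intervals of the vertices\<close>

fun vertex_lo :: "vertex \<Rightarrow> int" where
  "vertex_lo (TileV c i) = c"
| "vertex_lo (SquareV s) = sq_level s"

fun vertex_hi :: "nat \<Rightarrow> vertex \<Rightarrow> int" where
  "vertex_hi n (TileV c i) = c + int n - 1"
| "vertex_hi n (SquareV s) = sq_level s"

text \<open>All four adjacency conditions say that two level intervals overlap or are consecutive.
  Lengthening every interval by one at its upper end turns this into plain intersection, so
  \<open>G_adj\<close> describes an interval graph.\<close>

lemma close_levels_iff:
  "close_levels n a b \<longleftrightarrow> vertex_lo a \<le> vertex_hi n b + 1 \<and> vertex_lo b \<le> vertex_hi n a + 1"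
  by (cases a; cases b) auto

definition tile_index :: "square set set \<Rightarrow> square set \<Rightarrow> nat" where
  "tile_index \<alpha> t = Suc (card {u \<in> \<alpha>. tile_level u = tile_level t \<and> u \<noteq> t \<and> set_left u t})"

definition tile_vertex :: "square set set \<Rightarrow> square set \<Rightarrow> vertex" where
  "tile_vertex \<alpha> t = TileV (tile_level t) (tile_index \<alpha> t)"

lemma is_nth_tile_iff:
  "is_nth_tile \<alpha> c i t \<longleftrightarrow> t \<in> \<alpha> \<and> tile_level t = c \<and> i = tile_index \<alpha> t"
  by (auto simp: is_nth_tile_def tile_index_def)

locale ribbon_region =
  fixes n :: nat and R :: "square set"
  assumes n_pos: "n > 0" and simply_connected: "simply_connected_region R"
begin

lemma finite_R: "finite R"
  using simply_connected by (simp add: simply_connected_region_def region_def)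

lemma tile_ribbon:
  assumes "ribbon_tiling n R \<alpha>" "t \<in> \<alpha>"
  shows "ribbon (tile_level t) (tile_level t + int n - 1) t"
proof -
  obtain c where "ribbon c (c + int n - 1) t"
    using assms ribbon_if_ribbon_tile[OF n_pos] by (auto simp: ribbon_tiling_def)
  with ribbon_tile_level show ?thesis by metis
qed

lemma tiles_disjoint:
  "ribbon_tiling n R \<alpha> \<Longrightarrow> t \<in> \<alpha> \<Longrightarrow> u \<in> \<alpha> \<Longrightarrow> t \<noteq> u \<Longrightarrow> t \<inter> u = {}"
  unfolding ribbon_tiling_def partition_on_def disjoint_def by blast

lemma tile_subset: "ribbon_tiling n R \<alpha> \<Longrightarrow> t \<in> \<alpha> \<Longrightarrow> t \<subseteq> R"
  by (auto simp: ribbon_tiling_def partition_on_def)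

lemma tiling_covers: "ribbon_tiling n R \<alpha> \<Longrightarrow> s \<in> R \<Longrightarrow> \<exists>t\<in>\<alpha>. s \<in> t"
  by (auto simp: ribbon_tiling_def partition_on_def)

lemma tiling_finite: "ribbon_tiling n R \<alpha> \<Longrightarrow> finite \<alpha>"
  using tile_subset finite_R by (meson PowI finite_Pow_iff finite_subset subsetI)

lemma tile_at:
  assumes "ribbon_tiling n R \<alpha>" "t \<in> \<alpha>" "tile_level t \<le> k" "k < tile_level t + int n"
  shows "sq_at t k \<in> t" "sq_at t k \<in> R" "sq_level (sq_at t k) = k"
  using sq_at[OF tile_ribbon[OF assms(1,2)], of k] assms tile_subset[OF assms(1,2)] by auto

text \<open>A tile meeting level \<open>k\<close> starts on one of the \<open>n\<close> levels up to
  \<open>k\<close> and has one square there, and each square lies in one tile. The predicate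
  \<open>P\<close> later restricts the count to squares on the left of a position.\<close>

lemma card_level_squares:
  assumes "ribbon_tiling n R \<alpha>"
  shows "card {q \<in> R. sq_level q = k \<and> P q}
    = (\<Sum>c\<in>{k - int n + 1..k}. card {t \<in> \<alpha>. tile_level t = c \<and> P (sq_at t k)})"
proof -
  let ?T = "\<lambda>c. {t \<in> \<alpha>. tile_level t = c \<and> P (sq_at t k)}"
  have "bij_betw (\<lambda>t. sq_at t k) (\<Union>c\<in>{k - int n + 1..k}. ?T c) {q \<in> R. sq_level q = k \<and> P q}"
    unfolding bij_betw_def
  proof
    show "inj_on (\<lambda>t. sq_at t k) (\<Union>c\<in>{k - int n + 1..k}. ?T c)"
    proof (rule inj_onI)
      fix t u
      assume tu: "t \<in> (\<Union>c\<in>{k - int n + 1..k}. ?T c)" "u \<in> (\<Union>c\<in>{k - int n + 1..k}. ?T c)"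
        "sq_at t k = sq_at u k"
      from tu(1,2) have "sq_at t k \<in> t" "sq_at u k \<in> u"
        using tile_at(1)[OF assms, of t k] tile_at(1)[OF assms, of u k] by auto
      with tu show "t = u" using tiles_disjoint[OF assms, of t u] by auto
    qed
    show "(\<lambda>t. sq_at t k) ` (\<Union>c\<in>{k - int n + 1..k}. ?T c) = {q \<in> R. sq_level q = k \<and> P q}"
    proof
      show "(\<lambda>t. sq_at t k) ` (\<Union>c\<in>{k - int n + 1..k}. ?T c) \<subseteq> {q \<in> R. sq_level q = k \<and> P q}"
        using tile_at[OF assms] by auto
      show "{q \<in> R. sq_level q = k \<and> P q} \<subseteq> (\<lambda>t. sq_at t k) ` (\<Union>c\<in>{k - int n + 1..k}. ?T c)"
      proof
        fix q assume q: "q \<in> {q \<in> R. sq_level q = k \<and> P q}"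
        then obtain t where t: "t \<in> \<alpha>" "q \<in> t" using tiling_covers[OF assms, of q] by blast
        have "sq_at t k = q" using sq_at_eqI[OF tile_ribbon[OF assms t(1)] t(2)] q by auto
        moreover have "tile_level t \<in> {k - int n + 1..k}"
          using ribbon_level[OF tile_ribbon[OF assms t(1)] t(2)] q by auto
        ultimately show "q \<in> (\<lambda>t. sq_at t k) ` (\<Union>c\<in>{k - int n + 1..k}. ?T c)"
          using q t by (intro image_eqI[of _ _ t]) auto
      qed
    qed
  qed
  then have "card {q \<in> R. sq_level q = k \<and> P q} = card (\<Union>c\<in>{k - int n + 1..k}. ?T c)"
    by (rule bij_betw_same_card[symmetric])
  also have "\<dots> = (\<Sum>c\<in>{k - int n + 1..k}. card (?T c))"
    using tiling_finite[OF assms] by (intro card_UN_disjoint) auto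
  finally show ?thesis .
qed

lemma window_split:
  "{k - int n + 1..k} = insert k {k - int n + 1..k - 1}"
  "{k - int n..k - 1} = insert (k - int n) {k - int n + 1..k - 1}"
  using n_pos by auto

text \<open>The induction starts below \<open>R\<close>, where no tile begins. The number of squares
  of level \<open>k\<close> is the sum of the tile counts over the window ending at
  \<open>k\<close>; all of these but the last are known to agree, and the sum does not depend on the
  tiling.\<close>

lemma card_tiles_of_level:
  assumes "ribbon_tiling n R \<alpha>" "ribbon_tiling n R \<beta>"
  shows "card {t \<in> \<alpha>. tile_level t = c} = card {t \<in> \<beta>. tile_level t = c}"
proof -
  obtain m where m: "\<And>q. q \<in> R \<Longrightarrow> m < sq_level q"
  proof
    fix q assume "q \<in> R"
    then have "Min (sq_level ` R) \<le> sq_level q" using finite_R by simp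
    then show "Min (sq_level ` R) - 1 < sq_level q" by linarith
  qed
  have empty: "{t \<in> \<gamma>. tile_level t = d} = {}" if "ribbon_tiling n R \<gamma>" "d \<le> m" for \<gamma> d
  proof (rule equals0I)
    fix t assume t: "t \<in> {t \<in> \<gamma>. tile_level t = d}"
    then have "sq_at t d \<in> R" "sq_level (sq_at t d) = d"
      using tile_at[OF that(1), of t d] n_pos by auto
    then show False using m that(2) by fastforce
  qed
  have "\<forall>d \<le> m + int j. card {t \<in> \<alpha>. tile_level t = d} = card {t \<in> \<beta>. tile_level t = d}" for j
  proof (induction j)
    case 0
    show ?case
    proof (intro allI impI)
      fix d assume "d \<le> m + int 0"
      then have "d \<le> m" by simp
      then show "card {t \<in> \<alpha>. tile_level t = d} = card {t \<in> \<beta>. tile_level t = d}"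
        by (simp only: empty[OF assms(1)] empty[OF assms(2)])
    qed
  next
    case (Suc j)
    define k where "k = m + int (Suc j)"
    have "(\<Sum>d\<in>{k - int n + 1..k}. card {t \<in> \<alpha>. tile_level t = d})
        = (\<Sum>d\<in>{k - int n + 1..k}. card {t \<in> \<beta>. tile_level t = d})"
      using card_level_squares[OF assms(1), of k "\<lambda>_. True"] card_level_squares[OF assms(2), of k "\<lambda>_. True"]
      by simp
    moreover have "(\<Sum>d\<in>{k - int n + 1..k - 1}. card {t \<in> \<alpha>. tile_level t = d})
        = (\<Sum>d\<in>{k - int n + 1..k - 1}. card {t \<in> \<beta>. tile_level t = d})"
      using Suc by (intro sum.cong) (auto simp: k_def)
    ultimately have "card {t \<in> \<alpha>. tile_level t = k} = card {t \<in> \<beta>. tile_level t = k}"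
      unfolding window_split by simp
    moreover have "d \<le> m + int j \<or> d = k" if "d \<le> m + int (Suc j)" for d
      using that by (auto simp: k_def)
    ultimately show ?case using Suc by blast
  qed
  from this[of "nat (c - m)"] show ?thesis by (auto simp: nat_le_iff)
qed

lemma set_left_same_level:
  assumes "ribbon_tiling n R \<alpha>" "t \<in> \<alpha>" "u \<in> \<alpha>" "t \<noteq> u" "tile_level u = tile_level t"
  shows "set_left u t \<longleftrightarrow> sq_pos (sq_at u (tile_level t)) < sq_pos (sq_at t (tile_level t))"
  using assms n_pos tile_at[OF assms(1)] tiles_disjoint[OF assms(1), of u t]
  by (intro set_left_iff[OF tile_ribbon[OF assms(1,3)] tile_ribbon[OF assms(1,2)]]) auto

text \<open>Tiles of one level are compared by their lowest squares, whose positions are distinct,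
  so the index is a rank increased by one.\<close>

lemma tile_index_bij:
  assumes "ribbon_tiling n R \<alpha>"
  shows "bij_betw (tile_index \<alpha>) {t \<in> \<alpha>. tile_level t = c} {1..card {t \<in> \<alpha>. tile_level t = c}}"
proof -
  let ?S = "{t \<in> \<alpha>. tile_level t = c}"
  let ?f = "\<lambda>t. sq_pos (sq_at t c)"
  have inj: "inj_on ?f ?S"
  proof (rule inj_onI)
    fix t u assume tu: "t \<in> ?S" "u \<in> ?S" "?f t = ?f u"
    then have "sq_at t c \<in> t" "sq_at u c \<in> u" "sq_level (sq_at t c) = sq_level (sq_at u c)"
      using tile_at[OF assms] n_pos by auto
    then have "sq_at t c \<in> t \<inter> u" using sq_pos_level_eqI tu(3) by (metis IntI)
    then show "t = u" using tu tiles_disjoint[OF assms, of t u] by auto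
  qed
  have idx: "tile_index \<alpha> t = Suc (card {u \<in> ?S. ?f u < ?f t})" if "t \<in> ?S" for t
  proof -
    have "{u \<in> \<alpha>. tile_level u = tile_level t \<and> u \<noteq> t \<and> set_left u t} = {u \<in> ?S. ?f u < ?f t}"
      using that set_left_same_level[OF assms, of t] by auto
    then show ?thesis by (simp add: tile_index_def)
  qed
  have "bij_betw (\<lambda>t. card {u \<in> ?S. ?f u < ?f t}) ?S {..<card ?S}"
    using tiling_finite[OF assms] inj by (intro bij_betw_rank) auto
  moreover have "bij_betw Suc {..<card ?S} {1..card ?S}"
    by (simp add: bij_betw_def image_Suc_lessThan)
  ultimately have "bij_betw (Suc \<circ> (\<lambda>t. card {u \<in> ?S. ?f u < ?f t})) ?S {1..card ?S}"
    by (rule bij_betw_trans)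
  then show ?thesis using idx by (subst bij_betw_cong[where g = "Suc \<circ> (\<lambda>t. card {u \<in> ?S. ?f u < ?f t})"]) auto
qed

lemma tile_index_inj:
  assumes "ribbon_tiling n R \<alpha>" "t \<in> \<alpha>" "u \<in> \<alpha>" "tile_level t = tile_level u"
    "tile_index \<alpha> t = tile_index \<alpha> u"
  shows "t = u"
  using tile_index_bij[OF assms(1), of "tile_level u"] assms(2-)
  by (auto simp: bij_betw_def inj_on_def)

section \<open>Vertices of the graph and their tiles\<close>

lemma tile_vertex_inj: "ribbon_tiling n R \<alpha> \<Longrightarrow> inj_on (tile_vertex \<alpha>) \<alpha>"
  by (auto simp: inj_on_def tile_vertex_def tile_index_inj)

lemma nth_tile_index:
  assumes "ribbon_tiling n R \<alpha>" "t \<in> \<alpha>"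
  shows "nth_tile \<alpha> (tile_level t) (tile_index \<alpha> t) = t"
  unfolding nth_tile_def is_nth_tile_iff
  using assms tile_index_inj by (intro the_equality) auto

lemma vertex_squares_tile_vertex:
  "ribbon_tiling n R \<alpha> \<Longrightarrow> t \<in> \<alpha> \<Longrightarrow> vertex_squares \<alpha> (tile_vertex \<alpha> t) = t"
  by (simp add: tile_vertex_def nth_tile_index)

lemma tile_vertex_image:
  assumes "ribbon_tiling n R \<alpha>"
  shows "tile_vertex \<alpha> ` \<alpha> = {TileV c i | c i. 1 \<le> i \<and> i \<le> card {t \<in> \<alpha>. tile_level t = c}}"
proof
  show "tile_vertex \<alpha> ` \<alpha> \<subseteq> {TileV c i | c i. 1 \<le> i \<and> i \<le> card {t \<in> \<alpha>. tile_level t = c}}"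
  proof
    fix v assume "v \<in> tile_vertex \<alpha> ` \<alpha>"
    then obtain t where t: "t \<in> \<alpha>" "v = tile_vertex \<alpha> t" by auto
    have "tile_index \<alpha> t \<in> {1..card {u \<in> \<alpha>. tile_level u = tile_level t}}"
      using tile_index_bij[OF assms, of "tile_level t"] t(1) by (auto simp: bij_betw_def)
    then show "v \<in> {TileV c i | c i. 1 \<le> i \<and> i \<le> card {t \<in> \<alpha>. tile_level t = c}}"
      using t(2) by (auto simp: tile_vertex_def)
  qed
  show "{TileV c i | c i. 1 \<le> i \<and> i \<le> card {t \<in> \<alpha>. tile_level t = c}} \<subseteq> tile_vertex \<alpha> ` \<alpha>"
  proof
    fix v assume "v \<in> {TileV c i | c i. 1 \<le> i \<and> i \<le> card {t \<in> \<alpha>. tile_level t = c}}"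
    then obtain c i where v: "v = TileV c i" "i \<in> {1..card {t \<in> \<alpha>. tile_level t = c}}" by auto
    then obtain t where "t \<in> \<alpha>" "tile_level t = c" "i = tile_index \<alpha> t"
      using tile_index_bij[OF assms, of c] unfolding bij_betw_def by blast
    with v(1) show "v \<in> tile_vertex \<alpha> ` \<alpha>" by (auto simp: tile_vertex_def)
  qed
qed

text \<open>As the counts per level agree, all tilings produce the same tile vertices, so the union
  over all tilings in \<open>G_verts\<close> collapses to any single one.\<close>

lemma G_verts_eq:
  assumes "ribbon_tiling n R \<alpha>"
  shows "G_verts n R = SquareV ` boundary_squares R \<union> tile_vertex \<alpha> ` \<alpha>"
proof -
  have "{TileV c i | c i. \<exists>\<gamma>. ribbon_tiling n R \<gamma> \<and> (\<exists>t. is_nth_tile \<gamma> c i t)}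
      = (\<Union>\<gamma>\<in>{\<gamma>. ribbon_tiling n R \<gamma>}. tile_vertex \<gamma> ` \<gamma>)"
    by (auto simp: is_nth_tile_iff tile_vertex_def)
  moreover have "tile_vertex \<gamma> ` \<gamma> = tile_vertex \<alpha> ` \<alpha>" if "ribbon_tiling n R \<gamma>" for \<gamma>
    using card_tiles_of_level[OF that assms] by (simp only: tile_vertex_image[OF that] tile_vertex_image[OF assms])
  then have "(\<Union>\<gamma>\<in>{\<gamma>. ribbon_tiling n R \<gamma>}. tile_vertex \<gamma> ` \<gamma>) = tile_vertex \<alpha> ` \<alpha>"
    using assms by blast
  ultimately have "{TileV c i | c i. \<exists>\<gamma>. ribbon_tiling n R \<gamma> \<and> (\<exists>t. is_nth_tile \<gamma> c i t)} = tile_vertex \<alpha> ` \<alpha>"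
    by (rule trans)
  then show ?thesis unfolding G_verts_def by simp
qed

lemma finite_boundary: "finite (boundary_squares R)"
proof (rule finite_subset)
  show "boundary_squares R \<subseteq> (\<Union>s\<in>R. {fst s - 1..fst s + 1} \<times> {snd s - 1..snd s + 1})"
    by (force simp: boundary_squares_def sq_adjacent_def)
qed (use finite_R in auto)

lemma finite_G_verts: "ribbon_tiling n R \<alpha> \<Longrightarrow> finite (G_verts n R)"
  by (simp add: G_verts_eq finite_boundary tiling_finite)

lemma G_verts_cases:
  assumes "ribbon_tiling n R \<alpha>" "v \<in> G_verts n R"
  obtains (Tile) t where "t \<in> \<alpha>" "v = tile_vertex \<alpha> t" "vertex_squares \<alpha> v = t"
    "vertex_lo v = tile_level t" "vertex_hi n v = tile_level t + int n - 1"
  | (Square) s where "s \<in> boundary_squares R" "v = SquareV s" "vertex_squares \<alpha> v = {s}"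
    "vertex_lo v = sq_level s" "vertex_hi n v = sq_level s"
proof -
  from assms(2) consider t where "t \<in> \<alpha>" "v = tile_vertex \<alpha> t"
    | s where "s \<in> boundary_squares R" "v = SquareV s"
    unfolding G_verts_eq[OF assms(1)] by blast
  then show thesis
  proof cases
    case (1 t)
    then show ?thesis
      using vertex_squares_tile_vertex[OF assms(1) 1(1)] by (intro Tile[of t]) (simp_all add: tile_vertex_def)
  next
    case (2 s)
    then show ?thesis by (intro Square[of s]) simp_all
  qed
qed

lemma vertex_ribbon:
  assumes "ribbon_tiling n R \<alpha>" "v \<in> G_verts n R"
  shows "ribbon (vertex_lo v) (vertex_hi n v) (vertex_squares \<alpha> v)"
  using assms by (cases rule: G_verts_cases) (simp_all add: tile_ribbon[OF assms(1)] ribbon_singleton)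

lemma vertex_disjoint:
  assumes "ribbon_tiling n R \<alpha>" "v \<in> G_verts n R" "w \<in> G_verts n R" "v \<noteq> w"
  shows "vertex_squares \<alpha> v \<inter> vertex_squares \<alpha> w = {}"
  using assms(1,2)
proof (cases rule: G_verts_cases)
  case v: (Tile t)
  from assms(1,3) show ?thesis
  proof (cases rule: G_verts_cases)
    case w: (Tile u)
    then show ?thesis using v tiles_disjoint[OF assms(1), of t u] assms(4) by auto
  next
    case w: (Square s)
    then show ?thesis using v tile_subset[OF assms(1), of t] by (auto simp: boundary_squares_def)
  qed
next
  case v: (Square s)
  from assms(1,3) show ?thesis
  proof (cases rule: G_verts_cases)
    case w: (Tile u)
    then show ?thesis using v tile_subset[OF assms(1), of u] by (auto simp: boundary_squares_def)
  next
    case w: (Square s)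
    then show ?thesis using v assms(4) by auto
  qed
qed

section \<open>The orientation given by a tiling\<close>

lemma G_orient_iff:
  assumes "ribbon_tiling n R \<alpha>"
  shows "(a, b) \<in> G_orient n R \<alpha> \<longleftrightarrow> a \<in> G_verts n R \<and> b \<in> G_verts n R \<and> a \<noteq> b \<and>
    set_left (vertex_squares \<alpha> a) (vertex_squares \<alpha> b)"
  using set_left_touching[OF vertex_ribbon[OF assms, of a] vertex_ribbon[OF assms, of b]]
  by (auto simp: G_orient_def G_adj_def close_levels_iff)

lemma G_orient_total:
  assumes "ribbon_tiling n R \<alpha>" "G_adj n R a b"
  shows "(a, b) \<in> G_orient n R \<alpha> \<longleftrightarrow> (b, a) \<notin> G_orient n R \<alpha>"
proof -
  have ab: "a \<in> G_verts n R" "b \<in> G_verts n R" "a \<noteq> b" "close_levels n a b"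
    using assms(2) by (auto simp: G_adj_def)
  have "set_left (vertex_squares \<alpha> a) (vertex_squares \<alpha> b) \<longleftrightarrow>
      \<not> set_left (vertex_squares \<alpha> b) (vertex_squares \<alpha> a)"
    using ab(4) vertex_disjoint[OF assms(1) ab(1-3)] unfolding close_levels_iff
    by (intro set_left_total[OF vertex_ribbon[OF assms(1) ab(1)] vertex_ribbon[OF assms(1) ab(2)]]) auto
  then show ?thesis using ab by (auto simp: G_orient_iff[OF assms(1)])
qed

lemma G_orient_is_orientation:
  assumes "ribbon_tiling n R \<alpha>"
  shows "is_orientation n R (G_orient n R \<alpha>)"
  unfolding is_orientation_def
proof (intro conjI allI impI)
  show "\<forall>(a, b)\<in>G_orient n R \<alpha>. G_adj n R a b" by (auto simp: G_orient_def)
  show "((a, b) \<in> G_orient n R \<alpha>) = ((b, a) \<notin> G_orient n R \<alpha>)" if "G_adj n R a b" for a b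
    using G_orient_total[OF assms that] .
qed

lemma G_orient_trans:
  assumes "ribbon_tiling n R \<alpha>" "(a, b) \<in> G_orient n R \<alpha>" "(b, c) \<in> G_orient n R \<alpha>" "close_levels n a c"
  shows "(a, c) \<in> G_orient n R \<alpha>"
proof -
  have ab: "a \<in> G_verts n R" "b \<in> G_verts n R" "c \<in> G_verts n R" "a \<noteq> b" "b \<noteq> c"
    "set_left (vertex_squares \<alpha> a) (vertex_squares \<alpha> b)" "set_left (vertex_squares \<alpha> b) (vertex_squares \<alpha> c)"
    using assms(2,3) by (simp_all add: G_orient_iff[OF assms(1)])
  have "a \<noteq> c"
    using G_orient_total[OF assms(1), of a b] assms(2,3) by (auto simp: G_orient_def)
  then have "set_left (vertex_squares \<alpha> a) (vertex_squares \<alpha> c)"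
    using ab assms(4) unfolding close_levels_iff
    by (intro set_left_trans[OF vertex_ribbon[OF assms(1) ab(1)] vertex_ribbon[OF assms(1) ab(2)]
          vertex_ribbon[OF assms(1) ab(3)]] vertex_disjoint[OF assms(1)]) auto
  then show ?thesis using ab \<open>a \<noteq> c\<close> by (simp add: G_orient_iff[OF assms(1)])
qed

lemma G_orient_acyclic:
  assumes "ribbon_tiling n R \<alpha>"
  shows "acyclic (G_orient n R \<alpha>)"
proof (rule interval_orientation_acyclic[OF finite_G_verts[OF assms], where lo = vertex_lo and hi = "vertex_hi n"])
  show "(a, c) \<in> G_orient n R \<alpha>"
    if "(a, b) \<in> G_orient n R \<alpha>" "(b, c) \<in> G_orient n R \<alpha>" "vertex_lo a \<le> vertex_hi n c + 1"
      "vertex_lo c \<le> vertex_hi n a + 1" for a b c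
    using that(3,4) by (intro G_orient_trans[OF assms that(1,2)]) (simp add: close_levels_iff)
qed (auto simp: G_orient_def G_adj_def close_levels_iff)

section \<open>Forced edges\<close>


definition left_count :: "square set set \<Rightarrow> int \<Rightarrow> square \<Rightarrow> nat" where
  "left_count \<alpha> c s = card {t \<in> \<alpha>. tile_level t = c \<and> set_left t {s}}"

lemma set_left_square_iff:
  assumes "ribbon_tiling n R \<alpha>" "t \<in> \<alpha>" "s \<notin> R" "tile_level t \<le> k" "k < tile_level t + int n"
    "\<bar>k - sq_level s\<bar> \<le> 1"
  shows "set_left t {s} \<longleftrightarrow> sq_pos (sq_at t k) < sq_pos s"
  using assms tile_at[OF assms(1,2,4,5)] tile_subset[OF assms(1,2)]
  by (intro set_left_iff[OF tile_ribbon[OF assms(1,2)] ribbon_singleton]) auto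

lemma left_count_eq:
  assumes "ribbon_tiling n R \<alpha>" "s \<notin> R" "c \<le> k" "k < c + int n" "\<bar>k - sq_level s\<bar> \<le> 1"
  shows "left_count \<alpha> c s = card {t \<in> \<alpha>. tile_level t = c \<and> sq_pos (sq_at t k) < sq_pos s}"
proof -
  have "{t \<in> \<alpha>. tile_level t = c \<and> set_left t {s}}
      = {t \<in> \<alpha>. tile_level t = c \<and> sq_pos (sq_at t k) < sq_pos s}"
    using set_left_square_iff[OF assms(1) _ assms(2) _ _ assms(5)] assms(3,4) by blast
  then show ?thesis by (simp add: left_count_def)
qed

text \<open>A tile is left of \<open>s\<close> exactly when its square of level \<open>k\<close> is,
  so the counts add up to a number of squares of \<open>R\<close>, in which the tiling no longer
  appears.\<close>

lemma left_count_window: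
  assumes "ribbon_tiling n R \<alpha>" "s \<notin> R" "\<bar>k - sq_level s\<bar> \<le> 1"
  shows "(\<Sum>c\<in>{k - int n + 1..k}. left_count \<alpha> c s) = card {q \<in> R. sq_level q = k \<and> sq_pos q < sq_pos s}"
  unfolding card_level_squares[OF assms(1)]
  using left_count_eq[OF assms(1,2) _ _ assms(3)] by (intro sum.cong) auto

text \<open>The range consists of exactly the levels whose tiles are comparable with
  \<open>s\<close>; for a boundary square these are the levels of its tile neighbours in the
  graph.\<close>

definition same_counts :: "square set set \<Rightarrow> square set set \<Rightarrow> square \<Rightarrow> bool" where
  "same_counts \<alpha> \<beta> s \<longleftrightarrow>
     (\<forall>c\<in>{sq_level s - int n..sq_level s + 1}. left_count \<alpha> c s = left_count \<beta> c s)"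

text \<open>The counts of \<open>n\<close> consecutive levels determine the remaining ones, because window sums
  count squares of \<open>R\<close>.\<close>

lemma same_counts_if_window:
  assumes "ribbon_tiling n R \<alpha>" "ribbon_tiling n R \<beta>" "s \<notin> R" "\<bar>k - sq_level s\<bar> \<le> 1"
    and "\<forall>c\<in>{k - int n + 1..k}. left_count \<alpha> c s = left_count \<beta> c s"
  shows "same_counts \<alpha> \<beta> s"
proof -
  define W where "W k \<longleftrightarrow> (\<forall>c\<in>{k - int n + 1..k}. left_count \<alpha> c s = left_count \<beta> c s)" for k
  let ?l = "sq_level s"
  have sums: "(\<Sum>c\<in>{k - int n + 1..k}. left_count \<alpha> c s) = (\<Sum>c\<in>{k - int n + 1..k}. left_count \<beta> c s)"
    if "\<bar>k - ?l\<bar> \<le> 1" for k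
    using left_count_window[OF assms(1,3) that] left_count_window[OF assms(2,3) that] by simp
  \<comment> \<open>The windows ending at \<open>k\<close> and \<open>k + 1\<close> share all but
    one level each; equal sums and equal shared counts leave equal counts on the new level.\<close>
  have up: "W (k + 1)" if "W k" "\<bar>k + 1 - ?l\<bar> \<le> 1" for k
  proof -
    have mid: "(\<Sum>c\<in>{k + 1 - int n + 1..k}. left_count \<alpha> c s) = (\<Sum>c\<in>{k + 1 - int n + 1..k}. left_count \<beta> c s)"
      using that(1) by (intro sum.cong) (auto simp: W_def)
    have "left_count \<alpha> (k + 1) s = left_count \<beta> (k + 1) s"
      using sums[OF that(2)] mid unfolding window_split(1)[of "k + 1"] by simp
    then show ?thesis using that(1) unfolding W_def window_split(1)[of "k + 1"] by auto
  qed
  have down: "W (k - 1)" if "W k" "\<bar>k - 1 - ?l\<bar> \<le> 1" for k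
  proof -
    have mid: "(\<Sum>c\<in>{k - int n + 1..k - 1}. left_count \<alpha> c s) = (\<Sum>c\<in>{k - int n + 1..k - 1}. left_count \<beta> c s)"
      using that(1) by (intro sum.cong) (auto simp: W_def)
    have eq: "{k - 1 - int n + 1..k - 1} = insert (k - int n) {k - int n + 1..k - 1}"
      using n_pos by auto
    have "left_count \<alpha> (k - int n) s = left_count \<beta> (k - int n) s"
      using sums[OF that(2)] mid unfolding eq by simp
    then show ?thesis using that(1) unfolding W_def eq by auto
  qed
  have "W k" using assms(5) by (simp add: W_def)
  moreover have "k = ?l - 1 \<or> k = ?l \<or> k = ?l + 1" using assms(4) by linarith
  ultimately have mid: "W ?l" using up[of k] down[of k] by auto
  have "W (?l - 1)" "W (?l + 1)" using up[OF mid] down[OF mid] by simp_all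
  \<comment> \<open>The windows ending one below, at and one above the level of \<open>s\<close>
    together cover the whole range of \<open>same_counts\<close>.\<close>
  then have W3: "left_count \<alpha> c s = left_count \<beta> c s"
    if "c \<in> {?l - int n..?l - 1} \<union> {?l - int n + 1..?l} \<union> {?l - int n + 2..?l + 1}" for c
    using mid that by (auto simp: W_def)
  show ?thesis unfolding same_counts_def
  proof
    fix c assume "c \<in> {?l - int n..?l + 1}"
    then have "c \<in> {?l - int n..?l - 1} \<union> {?l - int n + 1..?l} \<union> {?l - int n + 2..?l + 1}"
      using n_pos by auto
    then show "left_count \<alpha> c s = left_count \<beta> c s" by (rule W3)
  qed
qed

text \<open>Some level within 1 of both squares has no square of \<open>R\<close> between them.\<close>

lemma same_counts_king:
  assumes "ribbon_tiling n R \<alpha>" "ribbon_tiling n R \<beta>" "s \<notin> R" "s' \<notin> R" "king_adjacent s s'"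
    "same_counts \<alpha> \<beta> s"
  shows "same_counts \<alpha> \<beta> s'"
proof -
  have "\<exists>k. \<bar>k - sq_level s\<bar> \<le> 1 \<and> \<bar>k - sq_level s'\<bar> \<le> 1 \<and>
     (\<forall>q\<in>R. sq_level q = k \<longrightarrow> (sq_pos q < sq_pos s \<longleftrightarrow> sq_pos q < sq_pos s'))"
  proof (cases "\<bar>sq_level s - sq_level s'\<bar> \<le> 1")
    case True
    have near: "\<bar>sq_pos s - sq_pos s'\<bar> \<le> 2"
      using assms(5) by (auto simp: king_adjacent_def sq_pos_def)
    \<comment> \<open>Positions on the level of \<open>s\<close> move in steps of two, so a square
      of \<open>R\<close> there that separates the two positions would share the position of
      \<open>s'\<close>; this is impossible since \<open>s'\<close> is outside \<open>R\<close> and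
      on a close level.\<close>
    have "sq_pos q < sq_pos s \<longleftrightarrow> sq_pos q < sq_pos s'" if q: "q \<in> R" "sq_level q = sq_level s" for q
    proof -
      have "sq_pos q \<noteq> sq_pos s" "sq_pos q \<noteq> sq_pos s'"
        using sq_pos_neq[of q s] sq_pos_neq[of q s'] q True assms(3,4) by auto
      moreover have "even (sq_pos q - sq_pos s)"
        using sq_pos_parity[of q] sq_pos_parity[of s] q(2) by presburger
      ultimately show ?thesis using near by presburger
    qed
    then show ?thesis using True by (intro exI[of _ "sq_level s"]) auto
  next
    case False
    \<comment> \<open>The squares meet at an upper right and a lower left corner. They have the same
      position, and the level between theirs is within one of both.\<close>
    then have "sq_pos s = sq_pos s'" "\<bar>sq_level s - sq_level s'\<bar> = 2"
      using assms(5) by (auto simp: king_adjacent_def sq_pos_def sq_level_def)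
    then show ?thesis
      by (intro exI[of _ "(sq_level s + sq_level s') div 2"]) (auto simp: abs_if split: if_splits)
  qed
  then obtain k where k: "\<bar>k - sq_level s\<bar> \<le> 1" "\<bar>k - sq_level s'\<bar> \<le> 1"
    "\<And>q. q \<in> R \<Longrightarrow> sq_level q = k \<Longrightarrow> sq_pos q < sq_pos s \<longleftrightarrow> sq_pos q < sq_pos s'" by blast
  have same: "left_count \<gamma> c s = left_count \<gamma> c s'"
    if "ribbon_tiling n R \<gamma>" "c \<in> {k - int n + 1..k}" for \<gamma> c
  proof -
    have "{t \<in> \<gamma>. tile_level t = c \<and> sq_pos (sq_at t k) < sq_pos s}
        = {t \<in> \<gamma>. tile_level t = c \<and> sq_pos (sq_at t k) < sq_pos s'}"
    proof (intro Collect_cong conj_cong refl)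
      fix t assume "t \<in> \<gamma>" "tile_level t = c"
      then have "sq_at t k \<in> R" "sq_level (sq_at t k) = k"
        using tile_at[OF that(1), of t k] that(2) by auto
      then show "sq_pos (sq_at t k) < sq_pos s \<longleftrightarrow> sq_pos (sq_at t k) < sq_pos s'" by (rule k(3))
    qed
    then show ?thesis
      using that(2) left_count_eq[OF that(1) assms(3) _ _ k(1), of c]
        left_count_eq[OF that(1) assms(4) _ _ k(2), of c] by auto
  qed
  have "\<forall>c\<in>{k - int n + 1..k}. left_count \<alpha> c s' = left_count \<beta> c s'"
  proof
    fix c assume c: "c \<in> {k - int n + 1..k}"
    then have "left_count \<alpha> c s = left_count \<beta> c s"
    proof -
      have "c \<in> {sq_level s - int n..sq_level s + 1}" using c k(1) by auto
      then show ?thesis using assms(6) by (auto simp: same_counts_def)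
    qed
    then show "left_count \<alpha> c s' = left_count \<beta> c s'"
      using same[OF assms(1) c] same[OF assms(2) c] by simp
  qed
  then show ?thesis using same_counts_if_window[OF assms(1,2,4) k(2)] by blast
qed

text \<open>Beyond a box around \<open>R\<close>, all squares of \<open>R\<close> on levels close to
  that of \<open>s\<close> lie on the same side of \<open>s\<close>. The count is then zero or the
  number of all tiles of the level, which is the same for both tilings.\<close>

lemma same_counts_far:
  assumes "ribbon_tiling n R \<alpha>" "ribbon_tiling n R \<beta>"
    and M: "\<And>q. q \<in> R \<Longrightarrow> \<bar>fst q\<bar> \<le> M \<and> \<bar>snd q\<bar> \<le> M" and far: "\<bar>fst s\<bar> > M \<or> \<bar>snd s\<bar> > M"
  shows "same_counts \<alpha> \<beta> s"
proof -
  have sR: "s \<notin> R" using M[of s] far by linarith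
  define right where "right \<longleftrightarrow> fst s > M \<or> snd s < - M"
  have all: "set_left t {s} \<longleftrightarrow> right"
    if \<gamma>: "ribbon_tiling n R \<gamma>" "t \<in> \<gamma>" "tile_level t \<in> {sq_level s - int n..sq_level s + 1}" for \<gamma> t
  proof -
    obtain q s' where q: "q \<in> t" "s' \<in> {s}" "\<bar>sq_level q - sq_level s'\<bar> \<le> 1"
      by (rule touching_witness[OF tile_ribbon[OF \<gamma>(1,2)] ribbon_singleton[of s]]) (use \<gamma>(3) in auto)
    then have qs: "\<bar>sq_level q - sq_level s\<bar> \<le> 1" by simp
    have qR: "q \<in> R" using q(1) tile_subset[OF that(1,2)] by auto
    have "set_left t {s} \<longleftrightarrow> sq_pos q < sq_pos s"
      using q(1) qs sR tile_subset[OF that(1,2)]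
      by (intro set_left_iff[OF tile_ribbon[OF that(1,2)] ribbon_singleton]) auto
    also have "\<dots> \<longleftrightarrow> right"
    proof (cases "fst s > M \<or> snd s < - M")
      case True
      then have "sq_pos q < sq_pos s"
        using M[OF qR] qs unfolding sq_pos_def sq_level_def by linarith
      then show ?thesis using True by (simp add: right_def)
    next
      case False
      then have "fst s < - M \<or> snd s > M" using far by linarith
      then have "\<not> sq_pos q < sq_pos s"
        using M[OF qR] qs unfolding sq_pos_def sq_level_def by linarith
      then show ?thesis using False by (simp add: right_def)
    qed
    finally show ?thesis .
  qed
  have "left_count \<gamma> c s = (if right then card {t \<in> \<gamma>. tile_level t = c} else 0)"
    if "ribbon_tiling n R \<gamma>" "c \<in> {sq_level s - int n..sq_level s + 1}" for \<gamma> c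
  proof -
    have "{t \<in> \<gamma>. tile_level t = c \<and> set_left t {s}} = (if right then {t \<in> \<gamma>. tile_level t = c} else {})"
      using all[OF that(1)] that(2) by auto
    then show ?thesis by (simp add: left_count_def)
  qed
  then show ?thesis
    unfolding same_counts_def using assms(1,2) card_tiles_of_level[OF assms(1,2)] by simp
qed

lemma same_counts:
  assumes "ribbon_tiling n R \<alpha>" "ribbon_tiling n R \<beta>" "s \<notin> R"
  shows "same_counts \<alpha> \<beta> s"
proof -
  define C where "C = {s. s \<notin> R \<and> \<not> same_counts \<alpha> \<beta> s}"
  define M where "M = Max (insert 0 ((\<lambda>q. max \<bar>fst q\<bar> \<bar>snd q\<bar>) ` R))"
  have M: "\<bar>fst q\<bar> \<le> M \<and> \<bar>snd q\<bar> \<le> M" if "q \<in> R" for q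
  proof -
    have "max \<bar>fst q\<bar> \<bar>snd q\<bar> \<le> M" unfolding M_def using finite_R that by (intro Max_ge) auto
    then show ?thesis by simp
  qed
  have "\<bar>fst s\<bar> \<le> M \<and> \<bar>snd s\<bar> \<le> M" if "s \<in> C" for s
  proof (rule ccontr)
    assume "\<not> (\<bar>fst s\<bar> \<le> M \<and> \<bar>snd s\<bar> \<le> M)"
    then have "same_counts \<alpha> \<beta> s"
      by (intro same_counts_far[OF assms(1,2) M]) auto
    then show False using that by (simp add: C_def)
  qed
  then have "C \<subseteq> {- M..M} \<times> {- M..M}" by fastforce
  then have finC: "finite C" by (rule finite_subset) simp
  have closed: "s' \<in> C \<union> R" if "s \<in> C" "king_adjacent s s'" for s s'
  proof (rule ccontr)
    assume "s' \<notin> C \<union> R"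
    moreover have "king_adjacent s' s" using that(2) by (auto simp: king_adjacent_def abs_minus_commute)
    ultimately have "same_counts \<alpha> \<beta> s"
      using same_counts_king[OF assms(1,2), of s' s] that(1) by (auto simp: C_def)
    then show False using that(1) by (simp add: C_def)
  qed
  have "C \<inter> R = {}" by (auto simp: C_def)
  from no_bounded_complement_part[OF simply_connected finC this closed] have "C = {}" .
  then show ?thesis using assms(3) unfolding C_def by blast
qed

text \<open>Tiles of one level are linearly ordered and, by \<open>set_left_trans\<close>, those
  left of \<open>w\<close> form an initial segment, whose length decides which indices are included.
  All tiles of the level have the same interval, hence all of them touch \<open>w\<close>.\<close>

lemma set_left_iff_index:
  assumes t: "ribbon_tiling n R \<alpha>" "t \<in> \<alpha>"
    and w: "ribbon lo hi w" "\<And>u. u \<in> \<alpha> \<Longrightarrow> tile_level u = tile_level t \<Longrightarrow> u \<inter> w = {}"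
    and touch: "tile_level t \<le> hi + 1" "lo \<le> tile_level t + int n"
  shows "set_left t w \<longleftrightarrow> tile_index \<alpha> t \<le> card {u \<in> \<alpha>. tile_level u = tile_level t \<and> set_left u w}"
proof -
  let ?P = "{u \<in> \<alpha>. tile_level u = tile_level t \<and> u \<noteq> t \<and> set_left u t}"
  let ?U = "{u \<in> \<alpha>. tile_level u = tile_level t \<and> set_left u w}"
  note fin = tiling_finite[OF t(1)]
  note rt = tile_ribbon[OF t]
  have touch_self: "tile_level t \<le> tile_level t + int n - 1 + 1" by simp
  show ?thesis
  proof (cases "set_left t w")
    case True
    have "insert t ?P \<subseteq> ?U"
    proof
      fix u assume u: "u \<in> insert t ?P"
      show "u \<in> ?U"
      proof (cases "u = t")
        case False
        then have u: "u \<in> \<alpha>" "tile_level u = tile_level t" "set_left u t" using u by auto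
        have ru: "ribbon (tile_level t) (tile_level t + int n - 1) u" using tile_ribbon[OF t(1) u(1)] u(2) by simp
        have "set_left u w"
          using set_left_trans[OF ru rt w(1) tiles_disjoint[OF t(1) u(1) t(2) False]
              w(2)[OF t(2) refl] w(2)[OF u(1,2)] u(3) True] touch by simp
        with u show ?thesis by simp
      qed (use t True in auto)
    qed
    then have "card (insert t ?P) \<le> card ?U" using fin by (intro card_mono) auto
    then show ?thesis using True fin by (simp add: tile_index_def)
  next
    case False
    then have wt: "set_left w t"
      using set_left_total[OF rt w(1)] w(2)[OF t(2) refl] touch by simp
    have "?U \<subseteq> ?P"
    proof
      fix u assume "u \<in> ?U"
      then have u: "u \<in> \<alpha>" "tile_level u = tile_level t" "set_left u w" by auto
      have ne: "u \<noteq> t" using u(3) False by auto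
      have ru: "ribbon (tile_level t) (tile_level t + int n - 1) u" using tile_ribbon[OF t(1) u(1)] u(2) by simp
      have "set_left u t"
        using set_left_trans[OF ru w(1) rt w(2)[OF u(1,2)] _ tiles_disjoint[OF t(1) u(1) t(2) ne]
            u(3) wt] w(2)[OF t(2) refl] by (simp add: Int_commute)
      with u ne show "u \<in> ?P" by simp
    qed
    then have "card ?U \<le> card ?P" using fin by (intro card_mono) auto
    then show ?thesis using False by (simp add: tile_index_def)
  qed
qed

lemma set_left_square_iff_index:
  assumes "ribbon_tiling n R \<alpha>" "t \<in> \<alpha>" "s \<notin> R"
    and "tile_level t - 1 \<le> sq_level s" "sq_level s \<le> tile_level t + int n"
  shows "set_left t {s} \<longleftrightarrow> tile_index \<alpha> t \<le> left_count \<alpha> (tile_level t) s"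
  unfolding left_count_def
  using assms tile_subset[OF assms(1)] by (intro set_left_iff_index[OF assms(1,2) ribbon_singleton]) auto

lemma set_left_square_invariant:
  assumes "ribbon_tiling n R \<alpha>" "t \<in> \<alpha>" "ribbon_tiling n R \<beta>" "u \<in> \<beta>" "s \<notin> R"
    and "tile_vertex \<alpha> t = tile_vertex \<beta> u"
    and "tile_level t - 1 \<le> sq_level s" "sq_level s \<le> tile_level t + int n"
  shows "set_left t {s} \<longleftrightarrow> set_left u {s}"
  using set_left_square_iff_index[OF assms(1,2,5,7,8)] set_left_square_iff_index[OF assms(3,4,5)]
    same_counts[OF assms(1,3,5)] assms(6-8)
  by (auto simp: tile_vertex_def same_counts_def)

lemma set_left_same_level_iff_index:
  assumes "ribbon_tiling n R \<alpha>" "t \<in> \<alpha>" "u \<in> \<alpha>" "t \<noteq> u" "tile_level u = tile_level t"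
  shows "set_left u t \<longleftrightarrow> tile_index \<alpha> u < tile_index \<alpha> t"
proof -
  have less: "tile_index \<alpha> u < tile_index \<alpha> t"
    if "t \<in> \<alpha>" "u \<in> \<alpha>" "t \<noteq> u" "tile_level u = tile_level t" "set_left u t" for t u
  proof -
    have "{w \<in> \<alpha>. tile_level w = tile_level u \<and> w \<noteq> u \<and> set_left w u}
        \<subset> {w \<in> \<alpha>. tile_level w = tile_level t \<and> w \<noteq> t \<and> set_left w t}"
    proof
      have less_pos: "sq_pos (sq_at u (tile_level t)) < sq_pos (sq_at t (tile_level t))"
        using set_left_same_level[OF assms(1) that(1-4)] that(5) by simp
      show "{w \<in> \<alpha>. tile_level w = tile_level u \<and> w \<noteq> u \<and> set_left w u}
        \<subseteq> {w \<in> \<alpha>. tile_level w = tile_level t \<and> w \<noteq> t \<and> set_left w t}"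
      proof
        fix w assume "w \<in> {w \<in> \<alpha>. tile_level w = tile_level u \<and> w \<noteq> u \<and> set_left w u}"
        then have w: "w \<in> \<alpha>" "tile_level w = tile_level u" "w \<noteq> u" "set_left w u" by auto
        then have "sq_pos (sq_at w (tile_level t)) < sq_pos (sq_at u (tile_level t))"
          using set_left_same_level[OF assms(1) that(2) w(1)] that(4) by auto
        with less_pos have lt: "sq_pos (sq_at w (tile_level t)) < sq_pos (sq_at t (tile_level t))" by simp
        then have "w \<noteq> t" by auto
        then have "set_left w t" using set_left_same_level[OF assms(1) that(1) w(1)] w(2) that(4) lt by auto
        with w \<open>w \<noteq> t\<close> that(4) show "w \<in> {w \<in> \<alpha>. tile_level w = tile_level t \<and> w \<noteq> t \<and> set_left w t}"
          by auto
      qed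
      show "{w \<in> \<alpha>. tile_level w = tile_level u \<and> w \<noteq> u \<and> set_left w u}
        \<noteq> {w \<in> \<alpha>. tile_level w = tile_level t \<and> w \<noteq> t \<and> set_left w t}"
        using that by auto
    qed
    then show ?thesis using tiling_finite[OF assms(1)] by (simp add: tile_index_def psubset_card_mono)
  qed
  have "set_left u t \<longleftrightarrow> \<not> set_left t u"
    using tiles_disjoint[OF assms(1-4)] assms(5)
    by (intro set_left_total[OF tile_ribbon[OF assms(1,3)] tile_ribbon[OF assms(1,2)]]) auto
  then show ?thesis using less[of t u] less[of u t] assms by (metis less_asym)
qed

text \<open>Compares the squares left of the lowest square of \<open>t\<close> on levels
  \<open>d - 1\<close> and \<open>d\<close>. Tiles starting strictly between
  \<open>d - int n\<close> and \<open>d\<close> have squares on both levels, on the same side of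
  \<open>t\<close>, and cancel. What remains is the tiles of level \<open>d - int n\<close>, which
  end on level \<open>d - 1\<close>, and the tiles of level \<open>d\<close> preceding
  \<open>t\<close>.\<close>

lemma count_left_tiles_of_level_below:
  assumes "ribbon_tiling n R \<alpha>" "t \<in> \<alpha>" and d: "d = tile_level t"
  shows "card {u \<in> \<alpha>. tile_level u = d - int n \<and> set_left u t}
      + card {q \<in> R. sq_level q = d \<and> sq_pos q < sq_pos (sq_at t d)}
    = card {q \<in> R. sq_level q = d - 1 \<and> sq_pos q < sq_pos (sq_at t d)} + (tile_index \<alpha> t - 1)"
proof -
  let ?p = "sq_pos (sq_at t d)"
  define S where "S k c = {u \<in> \<alpha>. tile_level u = c \<and> sq_pos (sq_at u k) < ?p}" for k c
  have tat: "sq_at t d \<in> t" "sq_level (sq_at t d) = d" using tile_at[OF assms(1,2), of d] n_pos d by auto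
  have cmp: "set_left u t \<longleftrightarrow> sq_pos (sq_at u k) < ?p"
    if "u \<in> \<alpha>" "u \<noteq> t" "tile_level u \<le> k" "k < tile_level u + int n" "\<bar>k - d\<bar> \<le> 1" for u k
    using that tat tile_at[OF assms(1) that(1,3,4)] tiles_disjoint[OF assms(1) that(1) assms(2) that(2)]
    by (intro set_left_iff[OF tile_ribbon[OF assms(1) that(1)] tile_ribbon[OF assms(1,2)]]) auto
  have low: "S (d - 1) (d - int n) = {u \<in> \<alpha>. tile_level u = d - int n \<and> set_left u t}"
  proof -
    have "set_left u t \<longleftrightarrow> sq_pos (sq_at u (d - 1)) < ?p"
      if "u \<in> \<alpha>" "tile_level u = d - int n" for u
    proof -
      have "u \<noteq> t" using that d n_pos by auto
      then show ?thesis using cmp[of u "d - 1"] that n_pos by simp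
    qed
    then show ?thesis by (auto simp: S_def)
  qed
  have mid: "S (d - 1) c = S d c" if c: "c \<in> {d - int n + 1..d - 1}" for c
  proof -
    have "sq_pos (sq_at u (d - 1)) < ?p \<longleftrightarrow> sq_pos (sq_at u d) < ?p"
      if u: "u \<in> \<alpha>" "tile_level u = c" for u
    proof -
      have "tile_level u \<noteq> tile_level t" using u(2) d c by simp
      then have "u \<noteq> t" by auto
      then show ?thesis using cmp[of u "d - 1"] cmp[of u d] u c by simp
    qed
    then show ?thesis by (auto simp: S_def)
  qed
  have top: "S d d = {u \<in> \<alpha>. tile_level u = tile_level t \<and> u \<noteq> t \<and> set_left u t}"
  proof -
    have "u \<noteq> t \<and> set_left u t \<longleftrightarrow> sq_pos (sq_at u d) < ?p"
      if "u \<in> \<alpha>" "tile_level u = d" for u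
      using cmp[of u d] that n_pos by (cases "u = t") simp_all
    then show ?thesis using d by (auto simp: S_def)
  qed
  have "card {q \<in> R. sq_level q = d \<and> sq_pos q < ?p}
      = card (S d d) + (\<Sum>c\<in>{d - int n + 1..d - 1}. card (S d c))"
    unfolding card_level_squares[OF assms(1)] window_split S_def by simp
  moreover have "card {q \<in> R. sq_level q = d - 1 \<and> sq_pos q < ?p}
      = card (S (d - 1) (d - int n)) + (\<Sum>c\<in>{d - int n + 1..d - 1}. card (S (d - 1) c))"
  proof -
    have "{d - 1 - int n + 1..d - 1} = insert (d - int n) {d - int n + 1..d - 1}" using n_pos by auto
    then show ?thesis unfolding card_level_squares[OF assms(1)] S_def by simp
  qed
  moreover have "(\<Sum>c\<in>{d - int n + 1..d - 1}. card (S (d - 1) c)) = (\<Sum>c\<in>{d - int n + 1..d - 1}. card (S d c))"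
    using mid by (intro sum.cong) auto
  ultimately show ?thesis unfolding low top by (simp add: tile_index_def)
qed

text \<open>Between two positions of the same tile in different tilings, the staircase formed by the
  squares of levels \<open>d - 1\<close> and \<open>d\<close> stays inside \<open>R\<close>, so that it contains equally many squares of both levels.\<close>

lemma staircase_counts:
  assumes "ribbon_tiling n R \<alpha>" "t \<in> \<alpha>" "ribbon_tiling n R \<beta>" "u \<in> \<beta>"
    and same: "tile_vertex \<alpha> t = tile_vertex \<beta> u" and d: "d = tile_level t"
    and le: "sq_pos (sq_at t d) \<le> sq_pos (sq_at u d)"
  shows "card {q \<in> R. sq_level q = d - 1 \<and> sq_pos q < sq_pos (sq_at t d)}
      + card {q \<in> R. sq_level q = d \<and> sq_pos q < sq_pos (sq_at u d)}
    = card {q \<in> R. sq_level q = d - 1 \<and> sq_pos q < sq_pos (sq_at u d)}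
      + card {q \<in> R. sq_level q = d \<and> sq_pos q < sq_pos (sq_at t d)}"
proof -
  have du: "d = tile_level u" using same d by (simp add: tile_vertex_def)
  define s where "s = sq_at t d"
  define s' where "s' = sq_at u d"
  have s: "s \<in> R" "sq_level s = d" and s': "s' \<in> R" "sq_level s' = d"
    using tile_at[OF assms(1,2), of d] tile_at[OF assms(3,4), of d] d du n_pos by (auto simp: s_def s'_def)
  \<comment> \<open>A square outside \<open>R\<close> strictly between the two lowest squares would
    have \<open>t\<close> on its left but not \<open>u\<close>, against
    \<open>set_left_square_invariant\<close>.\<close>
  have inR: "v \<in> R" if v: "sq_level v = d \<or> sq_level v = d - 1" "sq_pos s < sq_pos v" "sq_pos v < sq_pos s'" for v
  proof (rule ccontr)
    assume vR: "v \<notin> R"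
    have "\<bar>d - sq_level v\<bar> \<le> 1" using v(1) by auto
    then have "set_left t {v}" "\<not> set_left u {v}"
      using set_left_square_iff[OF assms(1,2) vR, of d] set_left_square_iff[OF assms(3,4) vR, of d]
        d du n_pos v(2,3) by (auto simp: s_def s'_def)
    then show False
      using set_left_square_invariant[OF assms(1-4) vR same] v(1) d n_pos by auto
  qed
  define B where "B k = {q \<in> R. sq_level q = k \<and> sq_pos s \<le> sq_pos q \<and> sq_pos q < sq_pos s'}" for k
  have split: "card {q \<in> R. sq_level q = k \<and> sq_pos q < sq_pos s'}
      = card {q \<in> R. sq_level q = k \<and> sq_pos q < sq_pos s} + card (B k)" for k
  proof -
    have "{q \<in> R. sq_level q = k \<and> sq_pos q < sq_pos s'} = {q \<in> R. sq_level q = k \<and> sq_pos q < sq_pos s} \<union> B k"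
      using le by (auto simp: B_def s_def s'_def)
    moreover have "{q \<in> R. sq_level q = k \<and> sq_pos q < sq_pos s} \<inter> B k = {}" by (auto simp: B_def)
    ultimately show ?thesis using finite_R by (simp add: card_Un_disjoint B_def)
  qed
  \<comment> \<open>One unit down raises the position by one. By parity the image stays before
    \<open>s'\<close>, and no square of level \<open>d - 1\<close> has the position of
    \<open>s\<close>, so the half-open ranges on the two levels correspond.\<close>
  have "bij_betw (\<lambda>q. (fst q, snd q - 1)) (B d) (B (d - 1))"
  proof (rule bij_betw_byWitness[where f' = "\<lambda>q. (fst q, snd q + 1)"])
    show "(\<lambda>q. (fst q, snd q - 1)) ` B d \<subseteq> B (d - 1)"
    proof (rule image_subsetI)
      fix q assume q: "q \<in> B d"
      define q' where "q' = (fst q, snd q - 1)"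
      have q': "sq_level q' = d - 1" "sq_pos q' = sq_pos q + 1"
        using q by (auto simp: B_def q'_def sq_level_def sq_pos_def)
      have "sq_pos q' < sq_pos s'"
      proof -
        have "sq_level q = sq_level s'" "sq_pos q < sq_pos s'" using q s'(2) by (auto simp: B_def)
        moreover from this(1) have "sq_pos q + 1 \<noteq> sq_pos s'"
          using sq_pos_parity[of q] sq_pos_parity[of s'] by presburger
        ultimately show ?thesis using q'(2) by linarith
      qed
      then show "(fst q, snd q - 1) \<in> B (d - 1)"
        using q q' inR[of q'] unfolding q'_def[symmetric] by (auto simp: B_def)
    qed
    show "(\<lambda>q. (fst q, snd q + 1)) ` B (d - 1) \<subseteq> B d"
    proof (rule image_subsetI)
      fix q assume q: "q \<in> B (d - 1)"
      define q' where "q' = (fst q, snd q + 1)"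
      have q': "sq_level q' = d" "sq_pos q' = sq_pos q - 1"
        using q by (auto simp: B_def q'_def sq_level_def sq_pos_def)
      have ge: "sq_pos s \<le> sq_pos q'"
      proof -
        have "sq_level s = sq_level q + 1" "sq_pos s \<le> sq_pos q" using q s(2) by (auto simp: B_def)
        moreover from this(1) have "sq_pos q \<noteq> sq_pos s"
          using sq_pos_parity[of q] sq_pos_parity[of s] by presburger
        ultimately show ?thesis using q'(2) by linarith
      qed
      have "q' \<in> R"
      proof (cases "sq_pos q' = sq_pos s")
        case True
        then have "q' = s" using q'(1) s(2) by (simp add: sq_pos_level_eqI)
        with s show ?thesis by simp
      next
        case False
        then show ?thesis using inR[of q'] ge q q' by (auto simp: B_def)
      qed
      then show "(fst q, snd q + 1) \<in> B d"
        using q q' ge unfolding q'_def[symmetric] by (auto simp: B_def)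
    qed
  qed auto
  then have "card (B d) = card (B (d - 1))" by (rule bij_betw_same_card)
  then show ?thesis using split[of d] split[of "d - 1"] by (simp add: s_def s'_def)
qed

text \<open>Up to the fixed index, the value is a difference of two counts of squares of
  \<open>R\<close> that depends only on where the tile starts; moving the start along the staircase
  changes both counts by the same amount.\<close>

lemma count_left_tiles_invariant:
  assumes "ribbon_tiling n R \<alpha>" "t \<in> \<alpha>" "ribbon_tiling n R \<beta>" "u \<in> \<beta>"
    and same: "tile_vertex \<alpha> t = tile_vertex \<beta> u"
  shows "card {w \<in> \<alpha>. tile_level w = tile_level t - int n \<and> set_left w t}
    = card {w \<in> \<beta>. tile_level w = tile_level t - int n \<and> set_left w u}"
proof -
  have lev: "tile_level u = tile_level t" and idx: "tile_index \<beta> u = tile_index \<alpha> t"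
    using same by (simp_all add: tile_vertex_def)
  note cnt = count_left_tiles_of_level_below[OF assms(1,2) refl]
    count_left_tiles_of_level_below[OF assms(3,4) lev[symmetric]]
  let ?pt = "sq_pos (sq_at t (tile_level t))" and ?pu = "sq_pos (sq_at u (tile_level t))"
  have "card {q \<in> R. sq_level q = tile_level t - 1 \<and> sq_pos q < ?pt}
      + card {q \<in> R. sq_level q = tile_level t \<and> sq_pos q < ?pu}
    = card {q \<in> R. sq_level q = tile_level t - 1 \<and> sq_pos q < ?pu}
      + card {q \<in> R. sq_level q = tile_level t \<and> sq_pos q < ?pt}"
  proof (cases "?pt \<le> ?pu")
    case True
    then show ?thesis by (rule staircase_counts[OF assms(1-4) same refl])
  next
    case False
    then show ?thesis
      using staircase_counts[OF assms(3,4,1,2) same[symmetric] lev[symmetric]] by simp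
  qed
  then show ?thesis using cnt idx by linarith
qed

section \<open>Directions of forced edges\<close>

lemma tile_vertices_eq:
  assumes "ribbon_tiling n R \<alpha>" "ribbon_tiling n R \<beta>"
  shows "tile_vertex \<alpha> ` \<alpha> = tile_vertex \<beta> ` \<beta>"
  using card_tiles_of_level[OF assms]
  by (simp only: tile_vertex_image[OF assms(1)] tile_vertex_image[OF assms(2)])

lemma tile_vertex_correspondence:
  assumes "ribbon_tiling n R \<alpha>" "ribbon_tiling n R \<beta>" "t \<in> \<alpha>"
  obtains u where "u \<in> \<beta>" "tile_vertex \<alpha> t = tile_vertex \<beta> u"
  using tile_vertices_eq[OF assms(1,2)] assms(3) by blast

text \<open>Congruent levels at distance at most \<open>n\<close> are equal or exactly
  \<open>n\<close> apart. Equal levels are decided by indices, levels \<open>n\<close> apart by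
  \<open>count_left_tiles_invariant\<close>, a tile and a square by the left counts, and two squares
  without reference to a tiling.\<close>

lemma forced_edge_invariant:
  assumes "ribbon_tiling n R \<alpha>" "ribbon_tiling n R \<beta>" "forced_edge n R a b"
  shows "(a, b) \<in> G_orient n R \<alpha> \<longleftrightarrow> (a, b) \<in> G_orient n R \<beta>"
proof -
  have adj: "G_adj n R a b" and nfree: "\<not> free_pair n a b" using assms(3) by (auto simp: forced_edge_def)
  have V: "a \<in> G_verts n R" "b \<in> G_verts n R" "a \<noteq> b" and close: "close_levels n a b"
    using adj by (auto simp: G_adj_def)
  have adj': "G_adj n R b a" using adj by (auto simp: G_adj_def close_levels_iff)
  note swap = G_orient_total[OF assms(1) adj] G_orient_total[OF assms(2) adj]
  note iff = G_orient_iff[OF assms(1)] G_orient_iff[OF assms(2)]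
  have tile_square: "(v, SquareV s) \<in> G_orient n R \<alpha> \<longleftrightarrow> (v, SquareV s) \<in> G_orient n R \<beta>"
    if v: "v = tile_vertex \<alpha> t" "t \<in> \<alpha>" "s \<in> boundary_squares R" "close_levels n v (SquareV s)" for v t s
  proof -
    obtain u where u: "u \<in> \<beta>" "tile_vertex \<alpha> t = tile_vertex \<beta> u"
      using tile_vertex_correspondence[OF assms(1,2) v(2)] by blast
    have "s \<notin> R" using that(3) by (simp add: boundary_squares_def)
    then have "set_left t {s} \<longleftrightarrow> set_left u {s}"
      using that by (intro set_left_square_invariant[OF assms(1) that(2) assms(2) u(1) _ u(2)])
        (auto simp: tile_vertex_def)
    moreover have "vertex_squares \<alpha> v = t"
      unfolding v(1) by (simp only: vertex_squares_tile_vertex[OF assms(1)] v(2))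
    moreover have "vertex_squares \<beta> v = u"
      unfolding v(1) u(2) by (simp only: vertex_squares_tile_vertex[OF assms(2)] u(1))
    ultimately show ?thesis by (simp add: iff)
  qed
  have tile_tile: "(v, w) \<in> G_orient n R \<alpha> \<longleftrightarrow> (v, w) \<in> G_orient n R \<beta>"
    if v: "v = tile_vertex \<alpha> t" "t \<in> \<alpha>" and w: "w = tile_vertex \<alpha> t'" "t' \<in> \<alpha>" "v \<noteq> w"
      and lev: "tile_level t' = tile_level t \<or> tile_level t' = tile_level t + int n" for v w t t'
  proof -
    obtain u where u: "u \<in> \<beta>" "tile_vertex \<alpha> t = tile_vertex \<beta> u"
      using tile_vertex_correspondence[OF assms(1,2) v(2)] by blast
    obtain u' where u': "u' \<in> \<beta>" "tile_vertex \<alpha> t' = tile_vertex \<beta> u'"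
      using tile_vertex_correspondence[OF assms(1,2) w(2)] by blast
    have ne: "t' \<noteq> t" "u' \<noteq> u" using v w u u' by auto
    have levu: "tile_level u = tile_level t" "tile_level u' = tile_level t'"
      "tile_index \<beta> u = tile_index \<alpha> t" "tile_index \<beta> u' = tile_index \<alpha> t'"
      using u(2) u'(2) by (auto simp: tile_vertex_def)
    have "set_left t t' \<longleftrightarrow> set_left u u'"
    proof (cases "tile_level t' = tile_level t")
      case True
      then show ?thesis
        using set_left_same_level_iff_index[OF assms(1) w(2) v(2) ne(1)]
          set_left_same_level_iff_index[OF assms(2) u'(1) u(1) ne(2)] levu by simp
    next
      case False
      then have l: "tile_level t' = tile_level t + int n" using lev by simp
      have "set_left t t' \<longleftrightarrow> tile_index \<alpha> t \<le> card {x \<in> \<alpha>. tile_level x = tile_level t \<and> set_left x t'}"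
      proof (rule set_left_iff_index[OF assms(1) v(2) tile_ribbon[OF assms(1) w(2)]])
        fix x assume x: "x \<in> \<alpha>" "tile_level x = tile_level t"
        then have "x \<noteq> t'" using l n_pos by auto
        then show "x \<inter> t' = {}" by (rule tiles_disjoint[OF assms(1) x(1) w(2)])
      qed (use l n_pos in auto)
      moreover have "set_left u u' \<longleftrightarrow> tile_index \<beta> u \<le> card {x \<in> \<beta>. tile_level x = tile_level u \<and> set_left x u'}"
      proof (rule set_left_iff_index[OF assms(2) u(1) tile_ribbon[OF assms(2) u'(1)]])
        fix x assume x: "x \<in> \<beta>" "tile_level x = tile_level u"
        then have "x \<noteq> u'" using l levu n_pos by auto
        then show "x \<inter> u' = {}" by (rule tiles_disjoint[OF assms(2) x(1) u'(1)])
      qed (use l levu n_pos in auto)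
      ultimately show ?thesis
        using count_left_tiles_invariant[OF assms(1) w(2) assms(2) u'(1) u'(2)] l levu by simp
    qed
    moreover have "vertex_squares \<alpha> v = t" "vertex_squares \<alpha> w = t'"
      unfolding v(1) w(1) by (simp_all only: vertex_squares_tile_vertex[OF assms(1)] v(2) w(2))
    moreover have "vertex_squares \<beta> v = u" "vertex_squares \<beta> w = u'"
      unfolding v(1) w(1) u(2) u'(2) by (simp_all only: vertex_squares_tile_vertex[OF assms(2)] u(1) u'(1))
    ultimately show ?thesis by (simp add: iff)
  qed
  from assms(1) V(1) show ?thesis
  proof (cases rule: G_verts_cases)
    case a: (Tile t)
    from assms(1) V(2) show ?thesis
    proof (cases rule: G_verts_cases)
      case b: (Tile t')
      have "tile_level t mod int n = tile_level t' mod int n"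
        using nfree a(2) b(2) by (simp add: tile_vertex_def)
      then have "int n dvd tile_level t - tile_level t'" by (simp add: mod_eq_dvd_iff)
      moreover have "\<bar>tile_level t - tile_level t'\<bar> \<le> int n" using close a(2) b(2) by (simp add: tile_vertex_def)
      ultimately have "tile_level t' = tile_level t \<or> tile_level t' = tile_level t + int n \<or> tile_level t = tile_level t' + int n"
        using dvd_imp_le_int[of "tile_level t - tile_level t'" "int n"] by linarith
      then show ?thesis
        using tile_tile[OF a(2,1) b(2,1) V(3)] tile_tile[OF b(2,1) a(2,1)] V(3) swap by metis
    next
      case b: (Square s)
      then show ?thesis using tile_square[OF a(2,1)] close by simp
    qed
  next
    case a: (Square s)
    from assms(1) V(2) show ?thesis
    proof (cases rule: G_verts_cases)
      case b: (Tile t')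
      then show ?thesis using tile_square[OF b(2,1) a(1)] close a(2) swap by (simp add: close_levels_iff)
    next
      case b: (Square s')
      then show ?thesis using a by (simp add: iff)
    qed
  qed
qed

lemma G_orient_extends_partial:
  assumes "ribbon_tiling n R \<alpha>"
  shows "extends_partial n R (G_orient n R \<alpha>)"
  unfolding extends_partial_def partial_orientation_def
  using forced_edge_invariant[OF assms] assms by blast

section \<open>Reconstructing a tiling from its orientation\<close>

text \<open>Each tile crossing level \<open>k\<close> on the left of \<open>t\<close> contributes
  one square of that level. So the rank of the square of \<open>t\<close> is read off from the
  orientation alone, as the in-degree restricted to vertices crossing level
  \<open>k\<close>.\<close>

lemma square_rank:
  assumes "ribbon_tiling n R \<alpha>" "t \<in> \<alpha>" "tile_level t \<le> k" "k < tile_level t + int n"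
  shows "card {q \<in> R. sq_level q = k \<and> sq_pos q < sq_pos (sq_at t k)}
    = card {w \<in> tile_vertex \<alpha> ` \<alpha>. vertex_lo w \<le> k \<and> k < vertex_lo w + int n \<and> (w, tile_vertex \<alpha> t) \<in> G_orient n R \<alpha>}"
proof -
  let ?S = "{u \<in> \<alpha>. tile_level u \<le> k \<and> k < tile_level u + int n \<and> u \<noteq> t \<and> set_left u t}"
  have left: "set_left u t \<longleftrightarrow> sq_pos (sq_at u k) < sq_pos (sq_at t k)"
    if "u \<in> \<alpha>" "tile_level u \<le> k" "k < tile_level u + int n" "u \<noteq> t" for u
    using tile_at[OF assms] tile_at[OF assms(1) that(1-3)] tiles_disjoint[OF assms(1) that(1) assms(2) that(4)]
    by (intro set_left_iff[OF tile_ribbon[OF assms(1) that(1)] tile_ribbon[OF assms(1,2)]]) auto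
  have "{q \<in> R. sq_level q = k \<and> sq_pos q < sq_pos (sq_at t k)} = (\<lambda>u. sq_at u k) ` ?S"
  proof
    show "(\<lambda>u. sq_at u k) ` ?S \<subseteq> {q \<in> R. sq_level q = k \<and> sq_pos q < sq_pos (sq_at t k)}"
    proof (rule image_subsetI)
      fix u assume "u \<in> ?S"
      then show "sq_at u k \<in> {q \<in> R. sq_level q = k \<and> sq_pos q < sq_pos (sq_at t k)}"
        using left[of u] tile_at[OF assms(1), of u k] by simp
    qed
    show "{q \<in> R. sq_level q = k \<and> sq_pos q < sq_pos (sq_at t k)} \<subseteq> (\<lambda>u. sq_at u k) ` ?S"
    proof
      fix q assume "q \<in> {q \<in> R. sq_level q = k \<and> sq_pos q < sq_pos (sq_at t k)}"
      then have q: "q \<in> R" "sq_level q = k" "sq_pos q < sq_pos (sq_at t k)" by auto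
      then obtain u where u: "u \<in> \<alpha>" "q \<in> u" using tiling_covers[OF assms(1)] by blast
      have at: "sq_at u k = q" using sq_at_eqI[OF tile_ribbon[OF assms(1) u(1)] u(2) q(2)] .
      have lev: "tile_level u \<le> k" "k < tile_level u + int n"
        using ribbon_level[OF tile_ribbon[OF assms(1) u(1)] u(2)] q(2) by auto
      have "u \<noteq> t" using at q(3) by auto
      then show "q \<in> (\<lambda>u. sq_at u k) ` ?S" using u lev at q(3) left by (intro image_eqI[of _ _ u]) auto
    qed
  qed
  moreover have "inj_on (\<lambda>u. sq_at u k) ?S"
  proof (rule inj_onI)
    fix u w assume uw: "u \<in> ?S" "w \<in> ?S" "sq_at u k = sq_at w k"
    then have "sq_at u k \<in> u" "sq_at w k \<in> w" using tile_at[OF assms(1)] by blast+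
    then show "u = w" using uw tiles_disjoint[OF assms(1), of u w] by auto
  qed
  ultimately have "card {q \<in> R. sq_level q = k \<and> sq_pos q < sq_pos (sq_at t k)} = card ?S"
    by (simp add: card_image)
  moreover have "{w \<in> tile_vertex \<alpha> ` \<alpha>. vertex_lo w \<le> k \<and> k < vertex_lo w + int n \<and> (w, tile_vertex \<alpha> t) \<in> G_orient n R \<alpha>}
      = tile_vertex \<alpha> ` ?S"
  proof -
    have "(tile_vertex \<alpha> u, tile_vertex \<alpha> t) \<in> G_orient n R \<alpha> \<longleftrightarrow> u \<noteq> t \<and> set_left u t" if "u \<in> \<alpha>" for u
      using that assms(2) tile_vertex_inj[OF assms(1)]
      by (auto simp: G_orient_iff[OF assms(1)] G_verts_eq[OF assms(1)] vertex_squares_tile_vertex[OF assms(1)] inj_on_def)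
    moreover have "vertex_lo (tile_vertex \<alpha> u) = tile_level u" for u by (simp add: tile_vertex_def)
    ultimately show ?thesis by auto
  qed
  moreover have "card (tile_vertex \<alpha> ` ?S) = card ?S"
    using tile_vertex_inj[OF assms(1)] by (intro card_image) (auto simp: inj_on_def)
  ultimately show ?thesis by simp
qed

text \<open>On each level the orientation gives the rank of a tile's square among the squares of
  \<open>R\<close>; ranks determine squares, so tiles with the same vertex coincide.\<close>

lemma G_orient_inj:
  assumes "ribbon_tiling n R \<alpha>" "ribbon_tiling n R \<beta>" "G_orient n R \<alpha> = G_orient n R \<beta>"
  shows "\<alpha> = \<beta>"
proof -
  have "\<alpha> \<subseteq> \<beta>" if ab: "ribbon_tiling n R \<alpha>" "ribbon_tiling n R \<beta>" "G_orient n R \<alpha> = G_orient n R \<beta>" for \<alpha> \<beta>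
  proof
    fix t assume t: "t \<in> \<alpha>"
    obtain u where u: "u \<in> \<beta>" "tile_vertex \<alpha> t = tile_vertex \<beta> u"
      using tile_vertex_correspondence[OF ab(1,2) t] by blast
    have lev: "tile_level u = tile_level t" using u(2) by (simp add: tile_vertex_def)
    have "sq_at t k = sq_at u k" if k: "tile_level t \<le> k" "k < tile_level t + int n" for k
    proof -
      let ?L = "{q \<in> R. sq_level q = k}"
      have "inj_on sq_pos ?L" by (rule inj_onI, rule sq_pos_level_eqI) simp_all
      then have bij: "bij_betw (\<lambda>s. card {q \<in> ?L. sq_pos q < sq_pos s}) ?L {..<card ?L}"
        using finite_R by (intro bij_betw_rank) auto
      have "card {q \<in> ?L. sq_pos q < sq_pos (sq_at t k)} = card {q \<in> ?L. sq_pos q < sq_pos (sq_at u k)}"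
        using square_rank[OF ab(1) t k] square_rank[OF ab(2) u(1), of k] k lev u(2) ab(3)
          tile_vertices_eq[OF ab(1,2)] by (simp add: conj_assoc)
      moreover have "sq_at t k \<in> ?L" "sq_at u k \<in> ?L"
        using tile_at[OF ab(1) t k] tile_at[OF ab(2) u(1), of k] k lev by auto
      ultimately show ?thesis by (rule inj_onD[OF bij_betw_imp_inj_on[OF bij]])
    qed
    then have "sq_at t ` {tile_level t..tile_level t + int n - 1} = sq_at u ` {tile_level t..tile_level t + int n - 1}"
      by (intro image_cong) auto
    then have "t = u"
      using ribbon_eq_image[OF tile_ribbon[OF ab(1) t]] ribbon_eq_image[OF tile_ribbon[OF ab(2) u(1)]] lev by simp
    with u show "t \<in> \<beta>" by simp
  qed
  from this[OF assms] this[OF assms(2,1) assms(3)[symmetric]] show ?thesis by blast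
qed

end

section \<open>Local replacement moves\<close>

lemma ribbon_eqI:
  assumes "ribbon lo hi t" "ribbon lo hi u" "\<And>k. lo \<le> k \<Longrightarrow> k \<le> hi \<Longrightarrow> sq_at t k = sq_at u k"
  shows "t = u"
proof -
  have "sq_at t ` {lo..hi} = sq_at u ` {lo..hi}" using assms(3) by (intro image_cong) auto
  then show ?thesis using ribbon_eq_image[OF assms(1)] ribbon_eq_image[OF assms(2)] by simp
qed

lemma set_left_at_iff:
  assumes "ribbon lo hi t" "ribbon lo' hi' t'" "t \<inter> t' = {}"
    and "lo \<le> k" "k \<le> hi" "lo' \<le> m" "m \<le> hi'" "\<bar>k - m\<bar> \<le> 1"
  shows "set_left t t' \<longleftrightarrow> sq_pos (sq_at t k) < sq_pos (sq_at t' m)"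
  using sq_at[OF assms(1,4,5)] sq_at[OF assms(2,6,7)] assms(8)
  by (intro set_left_iff[OF assms(1-3)]) auto

lemma square_exists:
  assumes "even (p - k)"
  obtains s where "sq_level s = k" "sq_pos s = p"
proof
  show "sq_level ((k + p) div 2, (k - p) div 2) = k" "sq_pos ((k + p) div 2, (k - p) div 2) = p"
    using assms by (auto simp: sq_level_def sq_pos_def) presburger+
qed

text \<open>Each orientation contains exactly one direction of every edge, so once the edges of
  \<open>A\<close> other than \<open>(a, b)\<close> survive, the converse inclusion follows.\<close>

lemma orientation_flip:
  assumes A: "is_orientation n R A" and B: "is_orientation n R B" and ab: "(a, b) \<in> A" "(b, a) \<in> B"
    and keep: "\<And>x y. (x, y) \<in> A \<Longrightarrow> (x, y) \<noteq> (a, b) \<Longrightarrow> (x, y) \<in> B"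
  shows "B = insert (b, a) (A - {(a, b)})"
proof
  have adjA: "G_adj n R x y" if "(x, y) \<in> A" for x y using A that by (auto simp: is_orientation_def)
  have adjB: "G_adj n R x y" if "(x, y) \<in> B" for x y using B that by (auto simp: is_orientation_def)
  have antiA: "(x, y) \<in> A \<longleftrightarrow> (y, x) \<notin> A" if "G_adj n R x y" for x y
    using A that by (auto simp: is_orientation_def)
  have antiB: "(x, y) \<in> B \<longleftrightarrow> (y, x) \<notin> B" if "G_adj n R x y" for x y
    using B that by (auto simp: is_orientation_def)
  show "insert (b, a) (A - {(a, b)}) \<subseteq> B" using keep ab by auto
  show "B \<subseteq> insert (b, a) (A - {(a, b)})"
  proof
    fix e assume e: "e \<in> B"
    obtain x y where xy: "e = (x, y)" by (cases e)
    have "(x, y) \<noteq> (a, b)" using antiB[OF adjB, of x y] e xy ab(2) by auto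
    moreover have "(x, y) \<in> A" if "(x, y) \<noteq> (b, a)"
    proof (rule ccontr)
      assume "(x, y) \<notin> A"
      then have "(y, x) \<in> A" using antiA[OF adjB] e xy by blast
      then have "(y, x) \<in> B" using keep that by auto
      then show False using antiB[OF adjB] e xy by blast
    qed
    ultimately show "e \<in> insert (b, a) (A - {(a, b)})" using xy by blast
  qed
qed

text \<open>The tiles \<open>u1\<close> and \<open>u2\<close> arise from \<open>t1\<close> and \<open>t2\<close> by exchanging the squares on the levels that
  both tiles occupy.\<close>

definition tail_swap :: "nat \<Rightarrow> square set \<Rightarrow> square set \<Rightarrow> square set \<Rightarrow> square set \<Rightarrow> bool" where
  "tail_swap n t1 t2 u1 u2 \<longleftrightarrow> (let c = tile_level t1; d = tile_level t2 in
     tile_level u1 = c \<and> tile_level u2 = d \<and> c < d \<and> d < c + int n \<and>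
     (\<forall>k. c \<le> k \<and> k < d \<longrightarrow> sq_at u1 k = sq_at t1 k) \<and>
     (\<forall>k. d \<le> k \<and> k < c + int n \<longrightarrow> sq_at u1 k = sq_at t2 k \<and> sq_at u2 k = sq_at t1 k) \<and>
     (\<forall>k. c + int n \<le> k \<and> k < d + int n \<longrightarrow> sq_at u2 k = sq_at t2 k))"

text \<open>A tile \<open>v\<close> near the exchanged levels is compared with \<open>t1\<close> and \<open>u1\<close> through the common squares
  of \<open>t2\<close> and \<open>u2\<close>, all of the exchanged squares lying on the same side of \<open>v\<close>.\<close>

lemma tail_swap_compare:
  assumes sw: "tail_swap n t1 t2 u1 u2"
    and r: "ribbon c (c + int n - 1) t1" "ribbon d (d + int n - 1) t2"
      "ribbon c (c + int n - 1) u1" "ribbon d (d + int n - 1) u2" "ribbon e (e + int n - 1) v"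
    and disj: "v \<inter> t1 = {}" "v \<inter> t2 = {}" "v \<inter> u1 = {}" "v \<inter> u2 = {}"
  shows "\<bar>e - c\<bar> \<le> int n \<Longrightarrow> set_left v t1 \<longleftrightarrow> set_left v u1"
    and "\<bar>e - d\<bar> \<le> int n \<Longrightarrow> set_left v t2 \<longleftrightarrow> set_left v u2"
proof -
  have lev: "tile_level t1 = c" "tile_level t2 = d" using r(1,2) by (simp_all add: ribbon_tile_level)
  have cd: "c < d" "d < c + int n" using sw lev by (auto simp: tail_swap_def Let_def)
  have eq1: "sq_at u1 k = sq_at t1 k" if "c \<le> k" "k < d" for k
    using sw lev that by (auto simp: tail_swap_def Let_def)
  have eq2: "sq_at u1 k = sq_at t2 k" "sq_at u2 k = sq_at t1 k" if "d \<le> k" "k < c + int n" for k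
    using sw lev that by (auto simp: tail_swap_def Let_def)
  have eq3: "sq_at u2 k = sq_at t2 k" if "c + int n \<le> k" "k < d + int n" for k
    using sw lev that by (auto simp: tail_swap_def Let_def)
  note cmp = set_left_at_iff[OF r(5) r(1) disj(1)] set_left_at_iff[OF r(5) r(2) disj(2)]
    set_left_at_iff[OF r(5) r(3) disj(3)] set_left_at_iff[OF r(5) r(4) disj(4)]
  show "set_left v t1 \<longleftrightarrow> set_left v u1" if e: "\<bar>e - c\<bar> \<le> int n"
  proof (cases "e \<le> d")
    case True
    \<comment> \<open>\<open>v\<close> has a square of level \<open>k\<close> within one of the
      segment of levels \<open>c\<close> to \<open>d - 1\<close>, on which \<open>t1\<close> and
      \<open>u1\<close> coincide.\<close>
    define k where "k = max e (c - 1)"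
    define m where "m = max c (min k (d - 1))"
    have k: "e \<le> k" "k \<le> e + int n - 1" "k \<le> d" "c - 1 \<le> k" using e True cd by (auto simp: k_def)
    then have m: "c \<le> m" "m < d" "m \<le> c + int n - 1" "\<bar>k - m\<bar> \<le> 1" using cd by (auto simp: m_def)
    show ?thesis
      using cmp(1)[OF k(1,2) m(1,3,4)] cmp(3)[OF k(1,2) m(1,3,4)] eq1[OF m(1,2)] by simp
  next
    case False
    \<comment> \<open>The comparison passes through the upper end of the overlap: \<open>t1\<close>
      and \<open>u2\<close> agree on level \<open>c + int n - 1\<close>, \<open>u2\<close> and
      \<open>t2\<close> on level \<open>c + int n\<close>, and \<open>t2\<close> and
      \<open>u1\<close> on level \<open>c + int n - 1\<close>.\<close>
    have k: "e \<le> c + int n" "c + int n \<le> e + int n - 1" using e False cd by auto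
    show ?thesis
      using cmp(1)[OF k, of "c + int n - 1"] cmp(4)[OF k, of "c + int n - 1"]
        cmp(4)[OF k, of "c + int n"] cmp(2)[OF k, of "c + int n"] cmp(2)[OF k, of "c + int n - 1"]
        cmp(3)[OF k, of "c + int n - 1"] eq2[of "c + int n - 1"] eq3[of "c + int n"] cd by simp
  qed
  show "set_left v t2 \<longleftrightarrow> set_left v u2" if e: "\<bar>e - d\<bar> \<le> int n"
  proof (cases "c \<le> e")
    case True
    define k where "k = max e (c + int n - 1)"
    define m where "m = max (c + int n) (min k (d + int n - 1))"
    have k: "e \<le> k" "k \<le> e + int n - 1" "k \<le> d + int n" "c + int n - 1 \<le> k"
      using e True cd by (auto simp: k_def)
    then have m: "d \<le> m" "m \<le> d + int n - 1" "\<bar>k - m\<bar> \<le> 1" "c + int n \<le> m" "m < d + int n"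
      using cd by (auto simp: m_def)
    show ?thesis
      using cmp(2)[OF k(1,2) m(1,2,3)] cmp(4)[OF k(1,2) m(1,2,3)] eq3[OF m(4,5)] by simp
  next
    case False
    \<comment> \<open>The same chain at the lower end: \<open>t2\<close> and \<open>u1\<close> agree
      on level \<open>d\<close>, \<open>u1\<close> and \<open>t1\<close> on level
      \<open>d - 1\<close>, and \<open>t1\<close> and \<open>u2\<close> on level
      \<open>d\<close>.\<close>
    have k: "e \<le> d - 1" "d - 1 \<le> e + int n - 1" using e False cd by auto
    show ?thesis
      using cmp(2)[OF k, of d] cmp(3)[OF k, of d] cmp(3)[OF k, of "d - 1"] cmp(1)[OF k, of "d - 1"]
        cmp(1)[OF k, of d] cmp(4)[OF k, of d] eq1[of "d - 1"] eq2[of d] cd by simp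
  qed
qed

context ribbon_region
begin

lemma set_left_tiles_total:
  assumes "ribbon_tiling n R \<alpha>" "t \<in> \<alpha>" "u \<in> \<alpha>" "t \<noteq> u" "\<bar>tile_level t - tile_level u\<bar> \<le> int n"
  shows "set_left t u \<longleftrightarrow> \<not> set_left u t"
  using tiles_disjoint[OF assms(1-4)] assms(5)
  by (intro set_left_total[OF tile_ribbon[OF assms(1,2)] tile_ribbon[OF assms(1,3)]]) auto

lemma free_pair_tiles:
  assumes "ribbon_tiling n R \<alpha>" "x \<in> G_verts n R" "y \<in> G_verts n R" "free_pair n x y"
  shows "\<exists>p\<in>\<alpha>. \<exists>q\<in>\<alpha>. x = tile_vertex \<alpha> p \<and> y = tile_vertex \<alpha> q"
  using assms(4) G_verts_eq[OF assms(1)] assms(2,3) by (cases x; cases y) auto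

text \<open>The map \<open>\<phi>\<close> matches the tiles of \<alpha> and \<beta>. It preserves
  all comparisons of tiles with touching levels except that of \<open>t1\<close> with
  \<open>t2\<close>, whose squares on level \<open>d\<close> are exchanged. As these two have
  different levels, no index is affected, so \<open>\<phi>\<close> preserves vertices and a single
  edge turns.\<close>

lemma G_orient_tail_swap:
  assumes \<alpha>: "ribbon_tiling n R \<alpha>" and \<beta>: "ribbon_tiling n R \<beta>"
    and t: "t1 \<in> \<alpha>" "t2 \<in> \<alpha>" "t1 \<noteq> t2" and u: "u1 \<in> \<beta>" "u2 \<in> \<beta>" "u1 \<noteq> u2"
    and rest: "\<alpha> - {t1, t2} = \<beta> - {u1, u2}" and sw: "tail_swap n t1 t2 u1 u2"
    and ab: "{a, b} = {tile_vertex \<alpha> t1, tile_vertex \<alpha> t2}" "(a, b) \<in> G_orient n R \<alpha>"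
  shows "G_orient n R \<beta> = insert (b, a) (G_orient n R \<alpha> - {(a, b)})"
proof -
  define c where "c = tile_level t1"
  define d where "d = tile_level t2"
  have lev: "tile_level t1 = c" "tile_level t2 = d" "tile_level u1 = c" "tile_level u2 = d"
    and cd: "c < d" "d < c + int n"
    and swap_d: "sq_at u1 d = sq_at t2 d" "sq_at u2 d = sq_at t1 d"
    using sw by (auto simp: tail_swap_def Let_def c_def d_def)
  define \<phi> where "\<phi> x = (if x = t1 then u1 else if x = t2 then u2 else x)" for x
  have \<phi>_simps: "\<phi> t1 = u1" "\<phi> t2 = u2" using t(3) by (auto simp: \<phi>_def)
  have \<phi>_other: "\<phi> x = x" "x \<in> \<beta>" "x \<noteq> u1" "x \<noteq> u2" if "x \<in> \<alpha>" "x \<noteq> t1" "x \<noteq> t2" for x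
  proof -
    have "x \<in> \<beta> - {u1, u2}" unfolding rest[symmetric] using that by simp
    then show "\<phi> x = x" "x \<in> \<beta>" "x \<noteq> u1" "x \<noteq> u2" using that by (simp_all add: \<phi>_def)
  qed
  have \<phi>_in: "\<phi> x \<in> \<beta>" if "x \<in> \<alpha>" for x
    using that u \<phi>_other[of x] by (auto simp: \<phi>_def)
  have \<phi>_inj: "inj_on \<phi> \<alpha>"
  proof (rule inj_onI)
    fix x y assume xy: "x \<in> \<alpha>" "y \<in> \<alpha>" "\<phi> x = \<phi> y"
    show "x = y"
      using xy u(3) \<phi>_other \<phi>_simps by metis
  qed
  have \<phi>_img: "\<phi> ` \<alpha> = \<beta>"
  proof
    show "\<beta> \<subseteq> \<phi> ` \<alpha>"
    proof
      fix y assume y: "y \<in> \<beta>"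
      consider "y = u1" | "y = u2" | "y \<in> \<alpha> - {t1, t2}" using rest y by blast
      then show "y \<in> \<phi> ` \<alpha>"
      proof cases
        case 1 then show ?thesis using t(1) \<phi>_simps(1) by blast
      next
        case 2 then show ?thesis using t(2) \<phi>_simps(2) by blast
      next
        case 3 then show ?thesis using \<phi>_other(1)[of y] by (metis Diff_iff image_eqI insertCI)
      qed
    qed
  qed (use \<phi>_in in auto)
  have \<phi>_lev: "tile_level (\<phi> x) = tile_level x" for x using lev by (simp add: \<phi>_def)
  have with_other: "(set_left v x \<longleftrightarrow> set_left v (\<phi> x)) \<and> (set_left x v \<longleftrightarrow> set_left (\<phi> x) v)"
    if v: "v \<in> \<alpha>" "v \<noteq> t1" "v \<noteq> t2" and x: "x = t1 \<or> x = t2"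
      and close: "\<bar>tile_level v - tile_level x\<bar> \<le> int n" for v x
  proof -
    note v' = \<phi>_other[OF v]
    have rv: "ribbon (tile_level v) (tile_level v + int n - 1) v" using tile_ribbon[OF \<alpha> v(1)] .
    note ribs = tile_ribbon[OF \<alpha> t(1)] tile_ribbon[OF \<alpha> t(2)] tile_ribbon[OF \<beta> u(1)] tile_ribbon[OF \<beta> u(2)]
    have first: "set_left v x \<longleftrightarrow> set_left v (\<phi> x)"
      using tail_swap_compare[OF sw ribs[unfolded lev] rv
          tiles_disjoint[OF \<alpha> v(1) t(1) v(2)] tiles_disjoint[OF \<alpha> v(1) t(2) v(3)]
          tiles_disjoint[OF \<beta> v'(2) u(1) v'(3)] tiles_disjoint[OF \<beta> v'(2) u(2) v'(4)]]
        x close lev \<phi>_simps by auto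
    have xa: "x \<in> \<alpha>" "x \<noteq> v" using x t v by auto
    have "\<phi> x \<noteq> v" using x \<phi>_simps v' by auto
    then have "set_left x v \<longleftrightarrow> set_left (\<phi> x) v"
      using set_left_tiles_total[OF \<alpha> xa(1) v(1) xa(2)] set_left_tiles_total[OF \<beta> \<phi>_in[OF xa(1)] v'(2)]
        first close \<phi>_lev[of x] by (auto simp: abs_minus_commute)
    with first show ?thesis by simp
  qed
  have pres: "set_left x y \<longleftrightarrow> set_left (\<phi> x) (\<phi> y)"
    if xy: "x \<in> \<alpha>" "y \<in> \<alpha>" "x \<noteq> y" "{x, y} \<noteq> {t1, t2}" "\<bar>tile_level x - tile_level y\<bar> \<le> int n" for x y
  proof (cases "x = t1 \<or> x = t2")
    case True
    then have y: "y \<noteq> t1" "y \<noteq> t2" using xy by auto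
    then show ?thesis using with_other[OF xy(2) y True] xy(5) \<phi>_other(1)[OF xy(2) y] by (simp add: abs_minus_commute)
  next
    case False
    then have x: "x \<noteq> t1" "x \<noteq> t2" by auto
    show ?thesis
    proof (cases "y = t1 \<or> y = t2")
      case True
      then show ?thesis using with_other[OF xy(1) x True] xy(5) \<phi>_other(1)[OF xy(1) x] by simp
    next
      case False
      then show ?thesis using \<phi>_other(1)[OF xy(1) x] \<phi>_other(1)[OF xy(2)] by simp
    qed
  qed
  have vertex: "tile_vertex \<beta> (\<phi> x) = tile_vertex \<alpha> x" if x: "x \<in> \<alpha>" for x
  proof -
    have iff: "tile_level (\<phi> w) = tile_level (\<phi> x) \<and> \<phi> w \<noteq> \<phi> x \<and> set_left (\<phi> w) (\<phi> x) \<longleftrightarrow>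
        tile_level w = tile_level x \<and> w \<noteq> x \<and> set_left w x" if w: "w \<in> \<alpha>" for w
    proof (cases "tile_level w = tile_level x \<and> w \<noteq> x")
      case True
      then have "{w, x} \<noteq> {t1, t2}" using lev cd by (auto simp: doubleton_eq_iff)
      then show ?thesis
        using pres[OF w x] True \<phi>_lev \<phi>_inj w x by (auto simp: inj_on_def)
    qed (use \<phi>_lev in auto)
    have "{w \<in> \<beta>. tile_level w = tile_level (\<phi> x) \<and> w \<noteq> \<phi> x \<and> set_left w (\<phi> x)}
        = \<phi> ` {w \<in> \<alpha>. tile_level w = tile_level x \<and> w \<noteq> x \<and> set_left w x}"
      unfolding \<phi>_img[symmetric] using iff by blast
    moreover have "inj_on \<phi> {w \<in> \<alpha>. tile_level w = tile_level x \<and> w \<noteq> x \<and> set_left w x}"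
      using \<phi>_inj by (rule inj_on_subset) auto
    ultimately show ?thesis by (simp add: tile_vertex_def tile_index_def card_image \<phi>_lev)
  qed
  have G\<alpha>: "(tile_vertex \<alpha> x, tile_vertex \<alpha> y) \<in> G_orient n R \<alpha> \<longleftrightarrow> x \<noteq> y \<and> set_left x y"
    and G\<beta>: "(tile_vertex \<alpha> x, tile_vertex \<alpha> y) \<in> G_orient n R \<beta> \<longleftrightarrow> x \<noteq> y \<and> set_left (\<phi> x) (\<phi> y)"
    if xy: "x \<in> \<alpha>" "y \<in> \<alpha>" for x y
  proof -
    have V: "tile_vertex \<alpha> x \<in> G_verts n R" "tile_vertex \<alpha> y \<in> G_verts n R"
      using xy by (auto simp: G_verts_eq[OF \<alpha>])
    have ne: "tile_vertex \<alpha> x \<noteq> tile_vertex \<alpha> y \<longleftrightarrow> x \<noteq> y"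
      using tile_vertex_inj[OF \<alpha>] xy by (auto simp: inj_on_def)
    have sq: "vertex_squares \<beta> (tile_vertex \<alpha> z) = \<phi> z" if "z \<in> \<alpha>" for z
      using vertex_squares_tile_vertex[OF \<beta> \<phi>_in[OF that]] vertex[OF that] by simp
    show "(tile_vertex \<alpha> x, tile_vertex \<alpha> y) \<in> G_orient n R \<alpha> \<longleftrightarrow> x \<noteq> y \<and> set_left x y"
      using V ne xy by (simp add: G_orient_iff[OF \<alpha>] vertex_squares_tile_vertex[OF \<alpha>])
    show "(tile_vertex \<alpha> x, tile_vertex \<alpha> y) \<in> G_orient n R \<beta> \<longleftrightarrow> x \<noteq> y \<and> set_left (\<phi> x) (\<phi> y)"
      using V ne xy by (simp add: G_orient_iff[OF \<beta>] sq)
  qed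
  have shared: "set_left x y \<longleftrightarrow> sq_pos (sq_at x d) < sq_pos (sq_at y d)"
    if "ribbon_tiling n R \<gamma>" "x \<in> \<gamma>" "y \<in> \<gamma>" "x \<noteq> y" "tile_level x \<le> d" "d < tile_level x + int n"
      "tile_level y \<le> d" "d < tile_level y + int n" for \<gamma> x y
    using that(5-8) by (intro set_left_at_iff[OF tile_ribbon[OF that(1,2)] tile_ribbon[OF that(1,3)]
          tiles_disjoint[OF that(1-4)]]) auto
  have rev: "(b, a) \<in> G_orient n R \<beta>"
  proof -
    have dn: "d < d + int n" using n_pos by simp
    have s1: "set_left t1 t2 \<longleftrightarrow> set_left u2 u1" and s2: "set_left t2 t1 \<longleftrightarrow> set_left u1 u2"
      using shared[OF \<alpha> t] shared[OF \<alpha> t(2,1) t(3)[symmetric]] shared[OF \<beta> u]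
        shared[OF \<beta> u(2,1) u(3)[symmetric]] lev cd dn swap_d by auto
    consider "a = tile_vertex \<alpha> t1" "b = tile_vertex \<alpha> t2" | "a = tile_vertex \<alpha> t2" "b = tile_vertex \<alpha> t1"
      using ab(1) by (auto simp: doubleton_eq_iff)
    then show ?thesis
    proof cases
      case 1
      then show ?thesis using ab(2) G\<alpha>[OF t(1,2)] G\<beta>[OF t(2,1)] s1 \<phi>_simps by auto
    next
      case 2
      then show ?thesis using ab(2) G\<alpha>[OF t(2,1)] G\<beta>[OF t(1,2)] s2 \<phi>_simps by auto
    qed
  qed
  show ?thesis
  proof (rule orientation_flip[OF G_orient_is_orientation[OF \<alpha>] G_orient_is_orientation[OF \<beta>] ab(2) rev])
    fix x y assume xy: "(x, y) \<in> G_orient n R \<alpha>" "(x, y) \<noteq> (a, b)"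
    have adj: "G_adj n R x y" using xy(1) by (auto simp: G_orient_def)
    show "(x, y) \<in> G_orient n R \<beta>"
    proof (cases "forced_edge n R x y")
      case True
      then show ?thesis using forced_edge_invariant[OF \<alpha> \<beta>] xy(1) by blast
    next
      case False
      then have free: "free_pair n x y" using adj by (simp add: forced_edge_def)
      have V: "x \<in> G_verts n R" "y \<in> G_verts n R" and close: "close_levels n x y"
        using adj by (auto simp: G_adj_def)
      obtain p q where p: "p \<in> \<alpha>" "x = tile_vertex \<alpha> p" and q: "q \<in> \<alpha>" "y = tile_vertex \<alpha> q"
        using free_pair_tiles[OF \<alpha> V free] by blast
      have lpq: "\<bar>tile_level p - tile_level q\<bar> \<le> int n" using close p(2) q(2) by (simp add: tile_vertex_def)
      have pq: "p \<noteq> q" "set_left p q" using G\<alpha>[OF p(1) q(1)] xy(1) p(2) q(2) by auto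
      have "{p, q} \<noteq> {t1, t2}"
      proof
        assume "{p, q} = {t1, t2}"
        then have "{x, y} = {a, b}" unfolding ab(1) p(2) q(2) by (auto simp: doubleton_eq_iff)
        then have "x = b" "y = a" using xy(2) by (auto simp: doubleton_eq_iff)
        then show False using G_orient_total[OF \<alpha> adj] xy(1) ab(2) by simp
      qed
      then have "set_left (\<phi> p) (\<phi> q)" using pres[OF p(1) q(1) pq(1) _ lpq] pq(2) by simp
      then show ?thesis using G\<beta>[OF p(1) q(1)] pq(1) p(2) q(2) by simp
    qed
  qed
qed

text \<open>Both pairs cover the same squares, and the extreme levels of this union determine
  \<open>c\<close> and \<open>d\<close>. Outside the common levels a square has only one possible
  owner. On the common levels \<open>set_left\<close> decides ownership for all levels at once, so
  the pairs agree everywhere or are exchanged on the whole overlap. Agreement contradicts that the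
  pairs differ, and so does an exchange with \<open>c = d\<close>, which only renames the two
  tiles.\<close>

lemma local_replacement_tail_swap:
  assumes \<alpha>: "ribbon_tiling n R \<alpha>" and \<beta>: "ribbon_tiling n R \<beta>" and lr: "local_replacement n \<alpha> \<beta>"
  obtains t1 t2 u1 u2 where "t1 \<in> \<alpha>" "t2 \<in> \<alpha>" "t1 \<noteq> t2" "u1 \<in> \<beta>" "u2 \<in> \<beta>" "u1 \<noteq> u2"
    "\<alpha> - {t1, t2} = \<beta> - {u1, u2}" "tail_swap n t1 t2 u1 u2"
proof -
  have "\<exists>t1 t2 u1 u2. t1 \<in> \<alpha> \<and> t2 \<in> \<alpha> \<and> t1 \<noteq> t2 \<and> u1 \<noteq> u2 \<and> {u1, u2} \<noteq> {t1, t2}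
      \<and> \<beta> = (\<alpha> - {t1, t2}) \<union> {u1, u2} \<and> tile_level t1 \<le> tile_level t2 \<and> tile_level u1 \<le> tile_level u2"
  proof -
    obtain t1 t2 u1 u2 where *: "t1 \<in> \<alpha>" "t2 \<in> \<alpha>" "t1 \<noteq> t2" "u1 \<noteq> u2" "{u1, u2} \<noteq> {t1, t2}"
      "\<beta> = (\<alpha> - {t1, t2}) \<union> {u1, u2}"
      using lr unfolding local_replacement_def by (elim exE conjE) (rule that; assumption)
    obtain t1' t2' where t': "{t1', t2'} = {t1, t2}" "tile_level t1' \<le> tile_level t2'"
      by (metis insert_commute linear)
    obtain u1' u2' where u': "{u1', u2'} = {u1, u2}" "tile_level u1' \<le> tile_level u2'"
      by (metis insert_commute linear)
    have "t1' \<in> \<alpha>" "t2' \<in> \<alpha>" "t1' \<noteq> t2'"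
      using *(1-3) t'(1) by (auto simp: doubleton_eq_iff)
    moreover have "u1' \<noteq> u2'" using *(4) u'(1) by (auto simp: doubleton_eq_iff)
    moreover have "{u1', u2'} \<noteq> {t1', t2'}" unfolding t'(1) u'(1) by (rule *(5))
    moreover have "\<beta> = (\<alpha> - {t1', t2'}) \<union> {u1', u2'}" unfolding t'(1) u'(1) by (rule *(6))
    ultimately show ?thesis using t'(2) u'(2) by (intro exI conjI)
  qed
  then obtain t1 t2 u1 u2 where t: "t1 \<in> \<alpha>" "t2 \<in> \<alpha>" "t1 \<noteq> t2" and u_ne: "u1 \<noteq> u2"
    and ne: "{u1, u2} \<noteq> {t1, t2}" and \<beta>_eq: "\<beta> = (\<alpha> - {t1, t2}) \<union> {u1, u2}"
    and le: "tile_level t1 \<le> tile_level t2" "tile_level u1 \<le> tile_level u2"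
    by (elim exE conjE) (rule that; assumption)
  have u: "u1 \<in> \<beta>" "u2 \<in> \<beta>" using \<beta>_eq by auto
  define c where "c = tile_level t1"
  define d where "d = tile_level t2"
  have rt: "ribbon c (c + int n - 1) t1" "ribbon d (d + int n - 1) t2"
    using tile_ribbon[OF \<alpha> t(1)] tile_ribbon[OF \<alpha> t(2)] by (simp_all add: c_def d_def)
  note ru' = tile_ribbon[OF \<beta> u(1)] tile_ribbon[OF \<beta> u(2)]
  note dt = tiles_disjoint[OF \<alpha> t]
  note du = tiles_disjoint[OF \<beta> u u_ne]
  \<comment> \<open>No other tile of \<beta> can cover the squares of \<open>t1\<close> and
    \<open>t2\<close>; equality follows because both sides have \<open>2 * n\<close>
    squares.\<close>
  have union: "t1 \<union> t2 = u1 \<union> u2"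
  proof (rule card_subset_eq)
    show "finite (u1 \<union> u2)" using ru' by (simp add: ribbon_finite)
    show "t1 \<union> t2 \<subseteq> u1 \<union> u2"
    proof
      fix s assume s: "s \<in> t1 \<union> t2"
      then have "s \<in> R" using tile_subset[OF \<alpha>] t by blast
      then obtain w where w: "w \<in> \<beta>" "s \<in> w" using tiling_covers[OF \<beta>] by blast
      have "w \<notin> \<alpha> - {t1, t2}" using w(2) s tiles_disjoint[OF \<alpha>] t by blast
      then show "s \<in> u1 \<union> u2" using w \<beta>_eq by auto
    qed
    have "card (t1 \<union> t2) = card t1 + card t2" "card (u1 \<union> u2) = card u1 + card u2"
      using dt du rt ru' by (simp_all add: card_Un_disjoint ribbon_finite)
    then show "card (t1 \<union> t2) = card (u1 \<union> u2)"
      using rt[THEN ribbon_card] ru'[THEN ribbon_card] by simp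
  qed
  have rest: "\<alpha> - {t1, t2} = \<beta> - {u1, u2}"
  proof -
    have "u \<notin> \<alpha> - {t1, t2}" if "u = u1 \<or> u = u2" for u
    proof
      assume u': "u \<in> \<alpha> - {t1, t2}"
      have "u \<noteq> {}" using ribbon_nonempty[OF ru'(1)] ribbon_nonempty[OF ru'(2)] that by auto
      then obtain s where "s \<in> u" by blast
      then have "s \<in> t1 \<union> t2" using union that by blast
      then show False using \<open>s \<in> u\<close> u' t tiles_disjoint[OF \<alpha>, of u t1] tiles_disjoint[OF \<alpha>, of u t2] by blast
    qed
    then show ?thesis unfolding \<beta>_eq by blast
  qed
  have cd: "c \<le> d" using le by (simp add: c_def d_def)
  have lev_u: "tile_level u1 = c" "tile_level u2 = d"
  proof -
    have in_t: "c \<le> sq_level s \<and> sq_level s \<le> d + int n - 1" if "s \<in> u1 \<union> u2" for s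
      using that ribbon_level[OF rt(1), of s] ribbon_level[OF rt(2), of s] cd unfolding union[symmetric] by auto
    have in_u: "tile_level u1 \<le> sq_level s \<and> sq_level s \<le> tile_level u2 + int n - 1" if "s \<in> t1 \<union> t2" for s
      using that ribbon_level[OF ru'(1), of s] ribbon_level[OF ru'(2), of s] le unfolding union by auto
    have at: "sq_at u1 (tile_level u1) \<in> u1 \<union> u2" "sq_level (sq_at u1 (tile_level u1)) = tile_level u1"
        "sq_at u2 (tile_level u2 + int n - 1) \<in> u1 \<union> u2"
        "sq_level (sq_at u2 (tile_level u2 + int n - 1)) = tile_level u2 + int n - 1"
        "sq_at t1 c \<in> t1 \<union> t2" "sq_level (sq_at t1 c) = c"
        "sq_at t2 (d + int n - 1) \<in> t1 \<union> t2" "sq_level (sq_at t2 (d + int n - 1)) = d + int n - 1"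
      using sq_at[OF ru'(1), of "tile_level u1"] sq_at[OF ru'(2), of "tile_level u2 + int n - 1"]
        sq_at[OF rt(1), of c] sq_at[OF rt(2), of "d + int n - 1"] n_pos by auto
    show "tile_level u1 = c" "tile_level u2 = d"
      using in_t[OF at(1)] in_t[OF at(3)] in_u[OF at(5)] in_u[OF at(7)] at(2,4,6,8) by linarith+
  qed
  have ru: "ribbon c (c + int n - 1) u1" "ribbon d (d + int n - 1) u2" using ru' lev_u by simp_all
  have low: "sq_at u1 k = sq_at t1 k" if k: "c \<le> k" "k < d" "k < c + int n" for k
  proof -
    have at: "sq_at u1 k \<in> u1" "sq_level (sq_at u1 k) = k" using sq_at[OF ru(1), of k] k by auto
    then have "sq_at u1 k \<in> t1 \<union> t2" using union by blast
    then have "sq_at u1 k \<in> t1" using ribbon_level[OF rt(2)] at(2) k(2) by fastforce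
    then show ?thesis using sq_at_eqI[OF rt(1)] at(2) by metis
  qed
  have high: "sq_at u2 k = sq_at t2 k" if k: "d \<le> k" "c + int n \<le> k" "k < d + int n" for k
  proof -
    have at: "sq_at u2 k \<in> u2" "sq_level (sq_at u2 k) = k" using sq_at[OF ru(2), of k] k by auto
    then have "sq_at u2 k \<in> t1 \<union> t2" using union by blast
    then have "sq_at u2 k \<in> t2" using ribbon_level[OF rt(1)] at(2) k(2) by fastforce
    then show ?thesis using sq_at_eqI[OF rt(2)] at(2) by metis
  qed
  have mid: "if set_left t1 t2 \<longleftrightarrow> set_left u1 u2 then sq_at u1 k = sq_at t1 k \<and> sq_at u2 k = sq_at t2 k
      else sq_at u1 k = sq_at t2 k \<and> sq_at u2 k = sq_at t1 k" if k: "d \<le> k" "k < c + int n" for k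
  proof -
    have kk: "c \<le> k" "k \<le> c + int n - 1" "d \<le> k" "k \<le> d + int n - 1" using k cd by auto
    have at: "sq_at u1 k \<in> u1" "sq_level (sq_at u1 k) = k" "sq_at u2 k \<in> u2" "sq_level (sq_at u2 k) = k"
      using sq_at[OF ru(1) kk(1,2)] sq_at[OF ru(2) kk(3,4)] by auto
    have two: "s = sq_at t1 k \<or> s = sq_at t2 k" if s: "s \<in> u1 \<union> u2" "sq_level s = k" for s
    proof -
      have "s \<in> t1 \<or> s \<in> t2" using s(1) union by blast
      then show ?thesis using sq_at_eqI[OF rt(1) _ s(2)] sq_at_eqI[OF rt(2) _ s(2)] by blast
    qed
    have neq: "sq_at u1 k \<noteq> sq_at u2 k" using at du by auto
    have cmp_t: "set_left t1 t2 \<longleftrightarrow> sq_pos (sq_at t1 k) < sq_pos (sq_at t2 k)"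
      by (rule set_left_at_iff[OF rt dt kk]) simp
    have cmp_u: "set_left u1 u2 \<longleftrightarrow> sq_pos (sq_at u1 k) < sq_pos (sq_at u2 k)"
      by (rule set_left_at_iff[OF ru du kk]) simp
    have "sq_pos (sq_at u1 k) \<noteq> sq_pos (sq_at u2 k)" using neq at by (intro sq_pos_neq) auto
    moreover have "(sq_at u1 k = sq_at t1 k \<and> sq_at u2 k = sq_at t2 k) \<or>
        (sq_at u1 k = sq_at t2 k \<and> sq_at u2 k = sq_at t1 k)"
      using two[of "sq_at u1 k"] two[of "sq_at u2 k"] at neq by auto
    ultimately show ?thesis using cmp_t cmp_u by auto
  qed
  have overlap: "d < c + int n"
  proof (rule ccontr)
    assume "\<not> d < c + int n"
    then have "u1 = t1" "u2 = t2"
      using low high by (auto intro!: ribbon_eqI[OF ru(1) rt(1)] ribbon_eqI[OF ru(2) rt(2)])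
    then show False using ne by simp
  qed
  have opp: "\<not> (set_left t1 t2 \<longleftrightarrow> set_left u1 u2)"
  proof
    assume same: "set_left t1 t2 \<longleftrightarrow> set_left u1 u2"
    have "sq_at u1 k = sq_at t1 k" if "c \<le> k" "k \<le> c + int n - 1" for k
      using low[of k] mid[of k] same that by (cases "k < d") auto
    then have "u1 = t1" by (rule ribbon_eqI[OF ru(1) rt(1)])
    moreover have "sq_at u2 k = sq_at t2 k" if "d \<le> k" "k \<le> d + int n - 1" for k
      using high[of k] mid[of k] same that by (cases "k < c + int n") auto
    then have "u2 = t2" by (rule ribbon_eqI[OF ru(2) rt(2)])
    ultimately show False using ne by simp
  qed
  have mid': "sq_at u1 k = sq_at t2 k" "sq_at u2 k = sq_at t1 k" if "d \<le> k" "k < c + int n" for k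
    using mid[OF that] opp by auto
  have "c \<noteq> d"
  proof
    assume "c = d"
    then have "u1 = t2" using mid'(1) by (intro ribbon_eqI[OF ru(1)]) (use rt in auto)
    moreover have "u2 = t1" using mid'(2) \<open>c = d\<close> by (intro ribbon_eqI[OF ru(2)]) (use rt in auto)
    ultimately show False using ne by auto
  qed
  then have "tail_swap n t1 t2 u1 u2"
    unfolding tail_swap_def Let_def c_def[symmetric] d_def[symmetric]
    using cd overlap low high mid' lev_u by auto
  with that t u u_ne rest show thesis by blast
qed

section \<open>Realising edge reversals\<close>


text \<open>If no other vertex lies between the two tiles, then on common levels they occupy neighbouring
  squares, and the square of either tile next to a common level is adjacent to both.\<close>

lemma tail_swap_exists:
  assumes \<alpha>: "ribbon_tiling n R \<alpha>" and t: "t1 \<in> \<alpha>" "t2 \<in> \<alpha>"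
    and lev: "tile_level t1 < tile_level t2" "tile_level t2 < tile_level t1 + int n"
    and gap: "\<And>v. v \<in> G_verts n R \<Longrightarrow> v \<noteq> tile_vertex \<alpha> t1 \<Longrightarrow> v \<noteq> tile_vertex \<alpha> t2 \<Longrightarrow>
      \<not> (set_left t1 (vertex_squares \<alpha> v) \<and> set_left (vertex_squares \<alpha> v) t2) \<and>
      \<not> (set_left t2 (vertex_squares \<alpha> v) \<and> set_left (vertex_squares \<alpha> v) t1)"
  obtains \<beta> u1 u2 where "ribbon_tiling n R \<beta>" "u1 \<in> \<beta>" "u2 \<in> \<beta>" "u1 \<noteq> u2"
    "\<alpha> - {t1, t2} = \<beta> - {u1, u2}" "tail_swap n t1 t2 u1 u2" "local_replacement n \<alpha> \<beta>"
proof -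
  define c where "c = tile_level t1"
  define d where "d = tile_level t2"
  have cd: "c < d" "d < c + int n" using lev by (simp_all add: c_def d_def)
  have r1: "ribbon c (c + int n - 1) t1" and r2: "ribbon d (d + int n - 1) t2"
    using tile_ribbon[OF \<alpha> t(1)] tile_ribbon[OF \<alpha> t(2)] by (simp_all add: c_def d_def)
  have t12: "t1 \<noteq> t2" using lev by auto
  note disj = tiles_disjoint[OF \<alpha> t t12]
  have at1: "sq_at t1 k \<in> t1" "sq_level (sq_at t1 k) = k" if "c \<le> k" "k < c + int n" for k
    using sq_at[OF r1, of k] that by auto
  have at2: "sq_at t2 k \<in> t2" "sq_level (sq_at t2 k) = k" if "d \<le> k" "k < d + int n" for k
    using sq_at[OF r2, of k] that by auto
  \<comment> \<open>Each square of \<open>R\<close> or its boundary belongs to some vertex, so a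
    square lying between the two tiles would put that vertex between them.\<close>
  have no_gap: "\<not> (sq_pos x < sq_pos s \<and> sq_pos s < sq_pos y) \<and> \<not> (sq_pos y < sq_pos s \<and> sq_pos s < sq_pos x)"
    if s: "s \<in> R \<union> boundary_squares R" "s \<notin> t1" "s \<notin> t2" and xy: "x \<in> t1" "y \<in> t2"
      and near: "\<bar>sq_level s - sq_level x\<bar> \<le> 1" "\<bar>sq_level s - sq_level y\<bar> \<le> 1" for s x y
  proof -
    have "\<exists>v\<in>G_verts n R. v \<noteq> tile_vertex \<alpha> t1 \<and> v \<noteq> tile_vertex \<alpha> t2 \<and> s \<in> vertex_squares \<alpha> v"
    proof (cases "s \<in> R")
      case True
      then obtain w where w: "w \<in> \<alpha>" "s \<in> w" using tiling_covers[OF \<alpha>] by blast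
      then have "w \<noteq> t1" "w \<noteq> t2" using s by auto
      then have "tile_vertex \<alpha> w \<noteq> tile_vertex \<alpha> t1" "tile_vertex \<alpha> w \<noteq> tile_vertex \<alpha> t2"
        using inj_onD[OF tile_vertex_inj[OF \<alpha>]] w(1) t by blast+
      then show ?thesis using w by (intro bexI[of _ "tile_vertex \<alpha> w"])
          (auto simp: G_verts_eq[OF \<alpha>] vertex_squares_tile_vertex[OF \<alpha>])
    next
      case False
      then have "SquareV s \<in> G_verts n R" using s(1) by (auto simp: G_verts_def)
      then show ?thesis by (intro bexI[of _ "SquareV s"]) (auto simp: tile_vertex_def)
    qed
    then obtain v where v: "v \<in> G_verts n R" "v \<noteq> tile_vertex \<alpha> t1" "v \<noteq> tile_vertex \<alpha> t2" "s \<in> vertex_squares \<alpha> v"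
      by blast
    have left: "sq_left x s \<longleftrightarrow> sq_pos x < sq_pos s" "sq_left s y \<longleftrightarrow> sq_pos s < sq_pos y"
      "sq_left y s \<longleftrightarrow> sq_pos y < sq_pos s" "sq_left s x \<longleftrightarrow> sq_pos s < sq_pos x"
      using near by (auto simp: sq_left_iff)
    have "set_left t1 (vertex_squares \<alpha> v)" if "sq_pos x < sq_pos s"
      using that v(4) xy(1) left(1) unfolding set_left_def by blast
    moreover have "set_left (vertex_squares \<alpha> v) t2" if "sq_pos s < sq_pos y"
      using that v(4) xy(2) left(2) unfolding set_left_def by blast
    moreover have "set_left t2 (vertex_squares \<alpha> v)" if "sq_pos y < sq_pos s"
      using that v(4) xy(2) left(3) unfolding set_left_def by blast
    moreover have "set_left (vertex_squares \<alpha> v) t1" if "sq_pos s < sq_pos x"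
      using that v(4) xy(1) left(4) unfolding set_left_def by blast
    ultimately show ?thesis using gap[OF v(1-3)] by blast
  qed
  have boundary: "s \<in> R \<union> boundary_squares R"
    if "q \<in> R" "\<bar>sq_level s - sq_level q\<bar> = 1" "\<bar>sq_pos s - sq_pos q\<bar> = 1" for s q
    using that by (auto simp: boundary_squares_def sq_adjacent_iff)
  have inR: "t1 \<subseteq> R" "t2 \<subseteq> R" using tile_subset[OF \<alpha>] t by auto
  have dist2: "\<bar>sq_pos (sq_at t1 k) - sq_pos (sq_at t2 k)\<bar> = 2" if k: "d \<le> k" "k < c + int n" for k
  proof (rule ccontr)
    let ?x = "sq_at t1 k" and ?y = "sq_at t2 k"
    assume not2: "\<bar>sq_pos ?x - sq_pos ?y\<bar> \<noteq> 2"
    have x: "?x \<in> t1" "sq_level ?x = k" and y: "?y \<in> t2" "sq_level ?y = k"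
      using at1[of k] at2[of k] k cd by auto
    have par: "even (sq_pos ?x - k)" "even (sq_pos ?y - k)"
      using sq_pos_parity[of ?x] sq_pos_parity[of ?y] x y by auto
    have "?x \<noteq> ?y" using x y disj by auto
    then have "sq_pos ?x \<noteq> sq_pos ?y" using x y sq_pos_neq[of ?x ?y] by auto
    \<comment> \<open>The sign points from \<open>?x\<close> to \<open>?y\<close>. At distance 4 or
      more, the next square \<open>s\<close> of level \<open>k\<close> after \<open>?x\<close> would
      lie in the gap, hence is outside \<open>R\<close> and its boundary. Then \<open>z\<close>,
      which is adjacent to both \<open>?x\<close> and \<open>s\<close>, is outside \<open>R\<close>
      but on its boundary, and lies in the gap itself.\<close>
    define \<sigma> :: int where "\<sigma> = (if sq_pos ?x < sq_pos ?y then 1 else - 1)"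
    have far: "(\<sigma> = 1 \<and> sq_pos ?x + 4 \<le> sq_pos ?y) \<or> (\<sigma> = - 1 \<and> sq_pos ?y + 4 \<le> sq_pos ?x)"
      using \<open>sq_pos ?x \<noteq> sq_pos ?y\<close> not2 par unfolding \<sigma>_def by presburger
    have "even (sq_pos ?x + 2 * \<sigma> - k)" "even (sq_pos ?x + \<sigma> - (k + 1))"
      using par(1) far by (auto simp: algebra_simps)
    then obtain s z where s: "sq_level s = k" "sq_pos s = sq_pos ?x + 2 * \<sigma>"
      and z: "sq_level z = k + 1" "sq_pos z = sq_pos ?x + \<sigma>"
      using square_exists by metis
    have s_not: "s \<notin> t1" "s \<notin> t2"
      using ribbon_unique[OF r1 _ x(1), of s] ribbon_unique[OF r2 _ y(1), of s] s x y far by auto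
    have s_out: "s \<notin> R \<union> boundary_squares R"
      using no_gap[OF _ s_not x(1) y(1)] s x(2) y(2) far by auto
    have z_not_R: "z \<notin> R"
      using boundary[of z s] s_out s z far by auto
    have "z \<in> R \<union> boundary_squares R"
      using boundary[of ?x z] inR(1) x z far by auto
    moreover have "z \<notin> t1" "z \<notin> t2" using z_not_R inR by auto
    ultimately show False
      using no_gap[OF _ _ _ x(1) y(1), of z] x(2) y(2) z far by auto
  qed
  \<comment> \<open>On the level of \<open>z\<close>, one square is adjacent to both
    \<open>x\<close> and \<open>y\<close> and lies between them. As \<open>tb\<close> misses that
    level, this square is \<open>z\<close> or belongs to neither tile; the latter contradicts
    \<open>no_gap\<close>.\<close>
  have adj: "\<bar>sq_pos z - sq_pos y\<bar> = 1"
    if xy: "x \<in> ta" "y \<in> tb" "\<bar>sq_pos x - sq_pos y\<bar> = 2" "sq_level x = sq_level y"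
      and ta: "ta = t1 \<and> tb = t2 \<or> ta = t2 \<and> tb = t1"
      and z: "z \<in> ta" "\<bar>sq_level z - sq_level x\<bar> = 1" "\<bar>sq_pos z - sq_pos x\<bar> = 1"
      and out: "\<And>s. s \<in> tb \<Longrightarrow> sq_level s \<noteq> sq_level z" for ta tb x y z
  proof (rule ccontr)
    assume not1: "\<bar>sq_pos z - sq_pos y\<bar> \<noteq> 1"
    define \<sigma> :: int where "\<sigma> = (if sq_pos x < sq_pos y then 1 else - 1)"
    have \<sigma>: "(\<sigma> = 1 \<or> \<sigma> = - 1) \<and> sq_pos y = sq_pos x + 2 * \<sigma>" using xy(3) by (auto simp: \<sigma>_def)
    have "even (sq_pos x + \<sigma> - sq_level z)"
      using sq_pos_parity[of x] z(2) \<sigma> by presburger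
    then obtain s where s: "sq_level s = sq_level z" "sq_pos s = sq_pos x + \<sigma>"
      using square_exists by metis
    have "sq_pos s \<noteq> sq_pos z" using not1 s(2) \<sigma> by auto
    have rib: "\<exists>lo hi. ribbon lo hi ta" using ta r1 r2 by auto
    have "s \<notin> ta" using rib ribbon_unique[of _ _ ta s z] z(1) s(1) \<open>sq_pos s \<noteq> sq_pos z\<close> by auto
    moreover have "s \<notin> tb" using out[of s] s(1) by blast
    ultimately have s_not: "s \<notin> t1" "s \<notin> t2" using ta by auto
    have xR: "x \<in> R" using xy(1) ta inR by auto
    have s_in: "s \<in> R \<union> boundary_squares R"
      using boundary[OF xR, of s] s z(2) \<sigma> by auto
    show False
      using ta no_gap[OF s_in s_not, of x y] no_gap[OF s_in s_not, of y x] xy s z(2) \<sigma> by auto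
  qed
  define f1 where "f1 k = (if k < d then sq_at t1 k else sq_at t2 k)" for k
  define f2 where "f2 k = (if k < c + int n then sq_at t1 k else sq_at t2 k)" for k
  define u1 where "u1 = f1 ` {c..c + int n - 1}"
  define u2 where "u2 = f2 ` {d..d + int n - 1}"
  have lev1: "sq_level (f1 k) = k" if "c \<le> k" "k \<le> c + int n - 1" for k
    using at1[of k] at2[of k] that cd by (auto simp: f1_def)
  have lev2: "sq_level (f2 k) = k" if "d \<le> k" "k \<le> d + int n - 1" for k
    using at1[of k] at2[of k] that cd by (auto simp: f2_def)
  have ru1: "ribbon c (c + int n - 1) u1"
  proof (rule ribbonI[OF _ u1_def lev1])
    fix k assume k: "c \<le> k" "k + 1 \<le> c + int n - 1"
    consider "k + 1 < d" | "k + 1 = d" | "d \<le> k" by linarith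
    then show "\<bar>sq_pos (f1 k) - sq_pos (f1 (k + 1))\<bar> = 1"
    proof cases
      case 1
      then show ?thesis using ribbon_step[OF r1 k] by (simp add: f1_def)
    next
      case 2
      \<comment> \<open>The joint of \<open>u1\<close>, where a square of \<open>t1\<close> is
        followed by one of \<open>t2\<close>; \<open>adj\<close> applies because \<open>t2\<close>
        has no square on level \<open>d - 1\<close>.\<close>
      have "\<bar>sq_pos (sq_at t1 k) - sq_pos (sq_at t2 d)\<bar> = 1"
      proof (rule adj[of "sq_at t1 d" t1 "sq_at t2 d" t2])
        show "sq_level s \<noteq> sq_level (sq_at t1 k)" if "s \<in> t2" for s
          using ribbon_level[OF r2 that] at1(2)[of k] k 2 by auto
        show "\<bar>sq_pos (sq_at t1 k) - sq_pos (sq_at t1 d)\<bar> = 1" using ribbon_step[OF r1 k] 2 by simp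
      qed (use k 2 cd dist2[of d] at1 at2 in auto)
      then show ?thesis using 2 by (simp add: f1_def)
    next
      case 3
      then show ?thesis using ribbon_step[OF r2, of k] k cd by (simp add: f1_def)
    qed
  qed (use n_pos in simp)
  have ru2: "ribbon d (d + int n - 1) u2"
  proof (rule ribbonI[OF _ u2_def lev2])
    fix k assume k: "d \<le> k" "k + 1 \<le> d + int n - 1"
    consider "k + 1 < c + int n" | "k + 1 = c + int n" | "c + int n \<le> k" by linarith
    then show "\<bar>sq_pos (f2 k) - sq_pos (f2 (k + 1))\<bar> = 1"
    proof cases
      case 1
      then show ?thesis using ribbon_step[OF r1, of k] k cd by (simp add: f2_def)
    next
      case 2
      have "\<bar>sq_pos (sq_at t2 (k + 1)) - sq_pos (sq_at t1 k)\<bar> = 1"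
      proof (rule adj[of "sq_at t2 k" t2 "sq_at t1 k" t1])
        show "sq_level s \<noteq> sq_level (sq_at t2 (k + 1))" if "s \<in> t1" for s
          using ribbon_level[OF r1 that] at2(2)[of "k + 1"] k 2 by auto
        show "\<bar>sq_pos (sq_at t2 (k + 1)) - sq_pos (sq_at t2 k)\<bar> = 1"
          using ribbon_step[OF r2 k] by (simp add: abs_minus_commute)
      qed (use k 2 cd dist2[of k] at1 at2 in \<open>auto simp: abs_minus_commute\<close>)
      then show ?thesis using 2 by (simp add: f2_def abs_minus_commute)
    next
      case 3
      then show ?thesis using ribbon_step[OF r2, of k] k by (simp add: f2_def)
    qed
  qed (use n_pos in simp)
  have at_u1: "sq_at u1 k = f1 k" if "c \<le> k" "k < c + int n" for k
    by (rule sq_at_eqI[OF ru1]) (use that lev1 in \<open>auto simp: u1_def\<close>)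
  have at_u2: "sq_at u2 k = f2 k" if "d \<le> k" "k < d + int n" for k
    by (rule sq_at_eqI[OF ru2]) (use that lev2 in \<open>auto simp: u2_def\<close>)
  have lev_u: "tile_level u1 = c" "tile_level u2 = d" using ru1 ru2 by (simp_all add: ribbon_tile_level)
  have sw: "tail_swap n t1 t2 u1 u2"
    unfolding tail_swap_def Let_def c_def[symmetric] d_def[symmetric]
    using lev_u cd at_u1 at_u2 by (auto simp: f1_def f2_def)
  have u_disj: "u1 \<inter> u2 = {}"
  proof (rule equals0I)
    fix s assume "s \<in> u1 \<inter> u2"
    then obtain k m where k: "c \<le> k" "k \<le> c + int n - 1" "s = f1 k" and m: "d \<le> m" "m \<le> d + int n - 1" "s = f2 m"
      by (auto simp: u1_def u2_def)
    have "k = m" using lev1[OF k(1,2)] lev2[OF m(1,2)] k(3) m(3) by simp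
    then have "sq_at t1 k = sq_at t2 k" using k m by (auto simp: f1_def f2_def)
    then show False using at1(1)[of k] at2(1)[of k] k m \<open>k = m\<close> cd disj by auto
  qed
  have u_union: "u1 \<union> u2 = t1 \<union> t2"
  proof
    show "u1 \<union> u2 \<subseteq> t1 \<union> t2"
      using at1(1) at2(1) cd by (auto simp: u1_def u2_def f1_def f2_def)
    show "t1 \<union> t2 \<subseteq> u1 \<union> u2"
    proof
      fix s assume "s \<in> t1 \<union> t2"
      then consider "s \<in> t1" | "s \<in> t2" by blast
      then show "s \<in> u1 \<union> u2"
      proof cases
        case 1
        define k where "k = sq_level s"
        have k: "c \<le> k" "k \<le> c + int n - 1" "s = sq_at t1 k"
          using ribbon_level[OF r1 1] sq_at_level[OF r1 1] by (simp_all add: k_def)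
        have "s = f1 k \<or> (s = f2 k \<and> d \<le> k)" using k by (auto simp: f1_def f2_def)
        then show ?thesis using k cd by (auto simp: u1_def u2_def)
      next
        case 2
        define k where "k = sq_level s"
        have k: "d \<le> k" "k \<le> d + int n - 1" "s = sq_at t2 k"
          using ribbon_level[OF r2 2] sq_at_level[OF r2 2] by (simp_all add: k_def)
        have "s = f2 k \<or> (s = f1 k \<and> k \<le> c + int n - 1)" using k by (auto simp: f1_def f2_def)
        then show ?thesis using k cd by (auto simp: u1_def u2_def)
      qed
    qed
  qed
  have u_ne: "u1 \<noteq> u2" using u_disj ribbon_nonempty[OF ru1] by auto
  have u_new: "u \<notin> \<alpha> - {t1, t2}" if u: "u = u1 \<or> u = u2" for u
  proof
    assume u': "u \<in> \<alpha> - {t1, t2}"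
    have "u \<noteq> {}" using u ribbon_nonempty[OF ru1] ribbon_nonempty[OF ru2] by auto
    moreover have "u \<subseteq> t1 \<union> t2" using u u_union by auto
    moreover have "u \<inter> t1 = {}" "u \<inter> t2 = {}"
      using u' t tiles_disjoint[OF \<alpha>, of u t1] tiles_disjoint[OF \<alpha>, of u t2] by auto
    ultimately show False by blast
  qed
  define \<beta> where "\<beta> = (\<alpha> - {t1, t2}) \<union> {u1, u2}"
  have rest: "\<alpha> - {t1, t2} = \<beta> - {u1, u2}"
    using u_new[of u1] u_new[of u2] unfolding \<beta>_def by blast
  have rest_disj: "w \<inter> (t1 \<union> t2) = {}" if "w \<in> \<alpha> - {t1, t2}" for w
    using that t tiles_disjoint[OF \<alpha>, of w t1] tiles_disjoint[OF \<alpha>, of w t2] by blast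
  have rtile: "ribbon_tile n u1" "ribbon_tile n u2"
    using ru1 ru2 by (auto intro: ribbon_tile_if_ribbon[OF n_pos])
  have tiling: "ribbon_tiling n R \<beta>"
    unfolding ribbon_tiling_def
  proof
    show "partition_on R \<beta>"
    proof (rule partition_onI)
      have "\<Union>\<alpha> = R" using \<alpha> by (simp add: ribbon_tiling_def partition_on_def)
      moreover have "\<Union>\<alpha> = \<Union>(\<alpha> - {t1, t2}) \<union> (t1 \<union> t2)" using t by blast
      moreover have "\<Union>\<beta> = \<Union>(\<alpha> - {t1, t2}) \<union> (u1 \<union> u2)" unfolding \<beta>_def by blast
      ultimately show "\<Union>\<beta> = R" using u_union by simp
      show "disjnt p q" if pq: "p \<in> \<beta>" "q \<in> \<beta>" "p \<noteq> q" for p q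
      proof -
        have mixed: "w \<inter> u = {}" if "w \<in> \<alpha> - {t1, t2}" "u = u1 \<or> u = u2" for w u
          using rest_disj[OF that(1)] that(2) u_union by blast
        consider "p \<in> \<alpha> - {t1, t2}" "q \<in> \<alpha> - {t1, t2}" | "p \<in> \<alpha> - {t1, t2}" "q = u1 \<or> q = u2"
          | "p = u1 \<or> p = u2" "q \<in> \<alpha> - {t1, t2}" | "p = u1 \<and> q = u2 \<or> p = u2 \<and> q = u1"
        proof -
          have "p \<in> \<alpha> - {t1, t2} \<or> p = u1 \<or> p = u2" "q \<in> \<alpha> - {t1, t2} \<or> q = u1 \<or> q = u2"
            using pq(1,2) unfolding \<beta>_def Un_iff insert_iff by simp_all
          then show thesis using that pq(3) by metis
        qed
        then have "p \<inter> q = {}"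
        proof cases
          case 1 then show ?thesis using tiles_disjoint[OF \<alpha>, of p q] pq(3) by blast
        next
          case 2 then show ?thesis using mixed by blast
        next
          case 3 then show ?thesis using mixed[of q p] by blast
        next
          case 4 then show ?thesis using u_disj by blast
        qed
        then show ?thesis by (simp add: disjnt_def)
      qed
      have "{} \<notin> \<alpha>" using \<alpha> by (simp add: ribbon_tiling_def partition_on_def)
      then show "{} \<notin> \<beta>"
        using ribbon_nonempty[OF ru1] ribbon_nonempty[OF ru2] by (auto simp: \<beta>_def)
    qed
    show "\<forall>t\<in>\<beta>. ribbon_tile n t"
      using \<alpha> rtile by (auto simp: \<beta>_def ribbon_tiling_def)
  qed
  have "u1 \<noteq> t1"
  proof
    assume "u1 = t1"
    then have "sq_at t1 d = sq_at t2 d" using at_u1[of d] cd by (simp add: f1_def)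
    then show False using at1(1)[of d] at2(1)[of d] cd disj by auto
  qed
  moreover have "u1 \<noteq> t2" using lev_u cd by (auto simp: d_def)
  ultimately have "{u1, u2} \<noteq> {t1, t2}" by auto
  then have "local_replacement n \<alpha> \<beta>"
    unfolding local_replacement_def using t t12 rtile u_ne \<beta>_def
    by (intro exI[of _ t1] exI[of _ t2] exI[of _ u1] exI[of _ u2]) simp
  moreover have "u1 \<in> \<beta>" "u2 \<in> \<beta>" by (simp_all add: \<beta>_def)
  ultimately show thesis using that tiling u_ne rest sw by blast
qed

text \<open>Freeness rules out level differences \<open>0\<close> and \<open>n\<close>, so the two
  tiles share levels and \<open>tail_swap_exists\<close> applies with the lower one first. A vertex
  between them in the direction from \<open>b\<close> to \<open>a\<close> would close a directed
  cycle with \<open>(a, b)\<close>.\<close>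

lemma edge_flip_realisable:
  assumes \<alpha>: "ribbon_tiling n R \<alpha>" and ab: "(a, b) \<in> G_orient n R \<alpha>" "free_pair n a b"
    and direct: "\<And>v. \<not> ((a, v) \<in> G_orient n R \<alpha> \<and> (v, b) \<in> G_orient n R \<alpha>)"
  obtains \<beta> where "ribbon_tiling n R \<beta>" "local_replacement n \<alpha> \<beta>"
    "G_orient n R \<beta> = insert (b, a) (G_orient n R \<alpha> - {(a, b)})"
proof -
  have V: "a \<in> G_verts n R" "b \<in> G_verts n R" and close: "close_levels n a b"
    using ab(1) by (auto simp: G_orient_def G_adj_def)
  obtain p q where p: "p \<in> \<alpha>" "a = tile_vertex \<alpha> p" and q: "q \<in> \<alpha>" "b = tile_vertex \<alpha> q"
    using free_pair_tiles[OF \<alpha> V ab(2)] by blast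
  have sq: "vertex_squares \<alpha> a = p" "vertex_squares \<alpha> b = q"
    using p q by (simp_all add: vertex_squares_tile_vertex[OF \<alpha>])
  have mod: "tile_level p mod int n \<noteq> tile_level q mod int n"
    using ab(2) p(2) q(2) by (simp add: tile_vertex_def)
  have "\<bar>tile_level p - tile_level q\<bar> \<le> int n" using close p(2) q(2) by (simp add: tile_vertex_def)
  moreover have "tile_level p \<noteq> tile_level q" "tile_level p \<noteq> tile_level q + int n" "tile_level q \<noteq> tile_level p + int n"
    using mod by auto
  ultimately have lev: "tile_level p < tile_level q \<and> tile_level q < tile_level p + int n \<or>
      tile_level q < tile_level p \<and> tile_level p < tile_level q + int n" by linarith
  have gap: "\<not> (set_left p (vertex_squares \<alpha> v) \<and> set_left (vertex_squares \<alpha> v) q)"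
    "\<not> (set_left q (vertex_squares \<alpha> v) \<and> set_left (vertex_squares \<alpha> v) p)"
    if "v \<in> G_verts n R" "v \<noteq> a" "v \<noteq> b" for v
  proof -
    show "\<not> (set_left p (vertex_squares \<alpha> v) \<and> set_left (vertex_squares \<alpha> v) q)"
      using direct[of v] V that sq by (auto simp: G_orient_iff[OF \<alpha>])
    show "\<not> (set_left q (vertex_squares \<alpha> v) \<and> set_left (vertex_squares \<alpha> v) p)"
    proof
      assume "set_left q (vertex_squares \<alpha> v) \<and> set_left (vertex_squares \<alpha> v) p"
      then have "(b, v) \<in> G_orient n R \<alpha>" "(v, a) \<in> G_orient n R \<alpha>"
        using V that sq by (auto simp: G_orient_iff[OF \<alpha>])
      then have "(b, b) \<in> (G_orient n R \<alpha>)\<^sup>+" using ab(1) by (meson trancl.simps)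
      then show False using G_orient_acyclic[OF \<alpha>] by (simp add: acyclic_def)
    qed
  qed
  from lev show thesis
  proof
    assume l: "tile_level p < tile_level q \<and> tile_level q < tile_level p + int n"
    obtain \<beta> u1 u2 where \<beta>: "ribbon_tiling n R \<beta>" "u1 \<in> \<beta>" "u2 \<in> \<beta>" "u1 \<noteq> u2"
      "\<alpha> - {p, q} = \<beta> - {u1, u2}" "tail_swap n p q u1 u2" "local_replacement n \<alpha> \<beta>"
      by (rule tail_swap_exists[OF \<alpha> p(1) q(1)]) (use l gap p q in auto)
    have "p \<noteq> q" using l by auto
    then have "G_orient n R \<beta> = insert (b, a) (G_orient n R \<alpha> - {(a, b)})"
      using G_orient_tail_swap[OF \<alpha> \<beta>(1) p(1) q(1) _ \<beta>(2-6) _ ab(1)] p(2) q(2) by auto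
    then show thesis using that \<beta>(1,7) by blast
  next
    assume l: "tile_level q < tile_level p \<and> tile_level p < tile_level q + int n"
    obtain \<beta> u1 u2 where \<beta>: "ribbon_tiling n R \<beta>" "u1 \<in> \<beta>" "u2 \<in> \<beta>" "u1 \<noteq> u2"
      "\<alpha> - {q, p} = \<beta> - {u1, u2}" "tail_swap n q p u1 u2" "local_replacement n \<alpha> \<beta>"
      by (rule tail_swap_exists[OF \<alpha> q(1) p(1)]) (use l gap p q in auto)
    have "q \<noteq> p" using l by auto
    then have "G_orient n R \<beta> = insert (b, a) (G_orient n R \<alpha> - {(a, b)})"
      using G_orient_tail_swap[OF \<alpha> \<beta>(1) q(1) p(1) _ \<beta>(2-6) _ ab(1)] p(2) q(2) by auto
    then show thesis using that \<beta>(1,7) by blast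
  qed
qed

section \<open>Reaching every acyclic orientation\<close>

lemma finite_G_orient: "ribbon_tiling n R \<alpha> \<Longrightarrow> finite (G_orient n R \<alpha>)"
  by (rule finite_subset[of _ "G_verts n R \<times> G_verts n R"])
    (auto simp: G_orient_def G_adj_def finite_G_verts)

text \<open>Among the edges on which the two orientations differ, choose one spanning the fewest vertices.\<close>

lemma differing_edge_without_bypass:
  assumes G: "finite G" "acyclic G" and A: "acyclic A" and rev: "\<And>a b. (a, b) \<in> G - A \<Longrightarrow> (b, a) \<in> A"
    and "\<not> G \<subseteq> A"
  obtains a b where "(a, b) \<in> G - A" "\<forall>v. \<not> ((a, v) \<in> G \<and> (v, b) \<in> G)"
proof -
  \<comment> \<open>The vertices strictly between the ends of \<open>e\<close> in the order
    generated by \<open>G\<close>. For a bypass \<open>v\<close> of \<open>e\<close>, both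
    \<open>I (a, v)\<close> and \<open>I (v, b)\<close> miss \<open>v\<close> and are thus
    smaller.\<close>
  define I where "I e = {v. (fst e, v) \<in> G\<^sup>+ \<and> (v, snd e) \<in> G\<^sup>+}" for e
  have fin: "finite (I e)" for e
  proof (rule finite_subset)
    show "I e \<subseteq> Range G" unfolding I_def trancl_range[of G, symmetric] by blast
  qed (use G(1) in \<open>rule finite_Range\<close>)
  obtain e0 where "e0 \<in> G - A" using assms(5) by blast
  then obtain e where e: "e \<in> G - A" "\<And>e'. e' \<in> G - A \<Longrightarrow> card (I e) \<le> card (I e')"
    using ex_has_least_nat[of "\<lambda>e. e \<in> G - A" e0 "\<lambda>e. card (I e)"] by blast
  obtain a b where ab: "e = (a, b)" by (cases e)
  have "\<not> ((a, v) \<in> G \<and> (v, b) \<in> G)" for v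
  proof
    assume v: "(a, v) \<in> G \<and> (v, b) \<in> G"
    have loop: "(v, v) \<notin> G\<^sup>+" using G(2) by (simp add: acyclic_def)
    have vI: "v \<in> I e" using v by (auto simp: I_def ab)
    have "I (a, v) \<subset> I e"
    proof
      show "I (a, v) \<subseteq> I e" using v by (auto simp: I_def ab intro: trancl.trancl_into_trancl)
      show "I (a, v) \<noteq> I e" using vI loop by (auto simp: I_def)
    qed
    then have av: "(a, v) \<in> A" using e(2)[of "(a, v)"] v psubset_card_mono[OF fin] by (meson DiffI not_le)
    have "I (v, b) \<subset> I e"
    proof
      show "I (v, b) \<subseteq> I e" using v by (auto simp: I_def ab intro: trancl_into_trancl2)
      show "I (v, b) \<noteq> I e" using vI loop by (auto simp: I_def)
    qed
    then have vb: "(v, b) \<in> A" using e(2)[of "(v, b)"] v psubset_card_mono[OF fin] by (meson DiffI not_le)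
    \<comment> \<open>By minimality both edges of the bypass belong to \<open>A\<close>, where they
      form a directed triangle with the reversed edge.\<close>
    have "(b, a) \<in> A" using rev e(1) ab by blast
    then have "(a, a) \<in> A\<^sup>+" using av vb by (meson trancl.simps)
    then show False using A by (simp add: acyclic_def)
  qed
  with that e(1) ab show thesis by blast
qed

text \<open>Induction on the number of edges that \<open>A\<close> reverses. Forced edges agree, so
  a differing edge is free; flipping one without bypass removes it from the difference and adds
  none.\<close>

lemma acyclic_orientation_realised:
  assumes A: "is_orientation n R A" "acyclic A" "extends_partial n R A"
    and \<alpha>: "ribbon_tiling n R \<alpha>"
  shows "\<exists>\<beta>. ribbon_tiling n R \<beta> \<and> A = G_orient n R \<beta>"
  using \<alpha>
proof (induction "card (G_orient n R \<alpha> - A)" arbitrary: \<alpha> rule: less_induct)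
  case less
  note \<alpha> = less.prems
  let ?G = "G_orient n R \<alpha>"
  have G: "is_orientation n R ?G" by (rule G_orient_is_orientation[OF \<alpha>])
  have rev: "(b, a) \<in> A" if "(a, b) \<in> ?G - A" for a b
  proof -
    have "G_adj n R a b" using that by (auto simp: G_orient_def)
    then show ?thesis using A(1) that unfolding is_orientation_def by blast
  qed
  show ?case
  proof (cases "?G \<subseteq> A")
    case True
    have "A \<subseteq> ?G"
    proof
      fix e assume e: "e \<in> A"
      obtain a b where ab: "e = (a, b)" by (cases e)
      have adj: "G_adj n R a b" using A(1) e ab by (auto simp: is_orientation_def)
      then have "(b, a) \<notin> A" using A(1) e ab unfolding is_orientation_def by blast
      then show "e \<in> ?G" using G adj True ab unfolding is_orientation_def by blast
    qed
    with True \<alpha> show ?thesis by blast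
  next
    case False
    obtain a b where ab: "(a, b) \<in> ?G - A" "\<forall>v. \<not> ((a, v) \<in> ?G \<and> (v, b) \<in> ?G)"
      by (rule differing_edge_without_bypass[OF finite_G_orient[OF \<alpha>] G_orient_acyclic[OF \<alpha>] A(2) rev False])
    have "\<not> forced_edge n R a b"
      using ab(1) A(3) G_orient_extends_partial[OF \<alpha>] unfolding extends_partial_def by blast
    then have free: "free_pair n a b" using ab(1) by (auto simp: forced_edge_def G_orient_def)
    obtain \<beta> where \<beta>: "ribbon_tiling n R \<beta>" "G_orient n R \<beta> = insert (b, a) (?G - {(a, b)})"
      using edge_flip_realisable[OF \<alpha> _ free ab(2)[rule_format]] ab(1) by (metis DiffD1)
    have "G_orient n R \<beta> - A = (?G - A) - {(a, b)}"
      unfolding \<beta>(2) using rev[OF ab(1)] by auto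
    then have "card (G_orient n R \<beta> - A) < card (?G - A)"
      using card_Diff1_less[OF _ ab(1)] finite_G_orient[OF \<alpha>] by simp
    then show ?thesis using less.hyps \<beta>(1) by blast
  qed
qed

section \<open>Local moves and edge reversals\<close>

lemma edge_reversal_if_local_replacement:
  assumes \<alpha>: "ribbon_tiling n R \<alpha>" and \<beta>: "ribbon_tiling n R \<beta>" and "local_replacement n \<alpha> \<beta>"
  shows "edge_reversal (G_orient n R \<alpha>) (G_orient n R \<beta>)"
proof -
  obtain t1 t2 u1 u2 where t: "t1 \<in> \<alpha>" "t2 \<in> \<alpha>" "t1 \<noteq> t2" and u: "u1 \<in> \<beta>" "u2 \<in> \<beta>" "u1 \<noteq> u2"
    and rest: "\<alpha> - {t1, t2} = \<beta> - {u1, u2}" and sw: "tail_swap n t1 t2 u1 u2"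
    by (rule local_replacement_tail_swap[OF assms])
  have V: "tile_vertex \<alpha> t1 \<in> G_verts n R" "tile_vertex \<alpha> t2 \<in> G_verts n R"
    using t by (auto simp: G_verts_eq[OF \<alpha>])
  have ne: "tile_vertex \<alpha> t1 \<noteq> tile_vertex \<alpha> t2"
    using inj_onD[OF tile_vertex_inj[OF \<alpha>]] t by blast
  have "tile_level t1 < tile_level t2" "tile_level t2 < tile_level t1 + int n"
    using sw by (auto simp: tail_swap_def Let_def)
  then have adj: "G_adj n R (tile_vertex \<alpha> t1) (tile_vertex \<alpha> t2)"
    using V ne by (simp add: G_adj_def tile_vertex_def)
  obtain a b where ab: "{a, b} = {tile_vertex \<alpha> t1, tile_vertex \<alpha> t2}" "(a, b) \<in> G_orient n R \<alpha>"
    using G_orient_total[OF \<alpha> adj] by (metis insert_commute)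
  have "a \<noteq> b" using ab(2) by (auto simp: G_orient_def G_adj_def)
  then show ?thesis
    unfolding edge_reversal_def using G_orient_tail_swap[OF \<alpha> \<beta> t u rest sw ab] ab(2) by blast
qed

text \<open>A vertex between \<open>a\<close> and \<open>b\<close> would form a directed triangle
  with the reversed edge in the acyclic orientation of \<beta>. So some local move on \<alpha>
  reverses this edge, and its result is \<beta> because orientations determine tilings.\<close>

lemma local_replacement_if_edge_reversal:
  assumes \<alpha>: "ribbon_tiling n R \<alpha>" and \<beta>: "ribbon_tiling n R \<beta>"
    and "edge_reversal (G_orient n R \<alpha>) (G_orient n R \<beta>)"
  shows "local_replacement n \<alpha> \<beta>"
proof -
  let ?A = "G_orient n R \<alpha>" and ?B = "G_orient n R \<beta>"
  obtain a b where ab: "(a, b) \<in> ?A" "a \<noteq> b" "?B = insert (b, a) (?A - {(a, b)})"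
    using assms(3) unfolding edge_reversal_def by blast
  have "(a, b) \<notin> ?B" using ab by auto
  then have "\<not> forced_edge n R a b" using forced_edge_invariant[OF \<alpha> \<beta>] ab(1) by blast
  then have free: "free_pair n a b" using ab(1) by (auto simp: forced_edge_def G_orient_def)
  have direct: "\<not> ((a, v) \<in> ?A \<and> (v, b) \<in> ?A)" for v
  proof
    assume v: "(a, v) \<in> ?A \<and> (v, b) \<in> ?A"
    have "v \<noteq> a" "v \<noteq> b" using v by (auto simp: G_orient_def G_adj_def)
    then have "(a, v) \<in> ?B" "(v, b) \<in> ?B" "(b, a) \<in> ?B" using v ab(3) by auto
    then have "(a, a) \<in> ?B\<^sup>+" by (meson trancl.simps)
    then show False using G_orient_acyclic[OF \<beta>] by (simp add: acyclic_def)
  qed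
  obtain \<gamma> where \<gamma>: "ribbon_tiling n R \<gamma>" "local_replacement n \<alpha> \<gamma>" "G_orient n R \<gamma> = insert (b, a) (?A - {(a, b)})"
    by (rule edge_flip_realisable[OF \<alpha> ab(1) free direct])
  have "\<gamma> = \<beta>" using G_orient_inj[OF \<gamma>(1) \<beta>] \<gamma>(3) ab(3) by simp
  with \<gamma>(2) show ?thesis by simp
qed

end

theorem theorem1p3:
  fixes n :: nat and R :: "square set"
  assumes "n > 0"
    and "simply_connected_region R"
    and "\<exists>\<alpha>. ribbon_tiling n R \<alpha>"
  shows
    "(\<forall>\<alpha>. ribbon_tiling n R \<alpha> \<longrightarrow>
        is_orientation n R (G_orient n R \<alpha>) \<and> acyclic (G_orient n R \<alpha>) \<and>
        extends_partial n R (G_orient n R \<alpha>)) \<and>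
     (\<forall>\<alpha> \<beta>. ribbon_tiling n R \<alpha> \<and> ribbon_tiling n R \<beta> \<longrightarrow>
        (\<alpha> = \<beta> \<longleftrightarrow> G_orient n R \<alpha> = G_orient n R \<beta>)) \<and>
     (\<forall>A. is_orientation n R A \<and> acyclic A \<and> extends_partial n R A \<longrightarrow>
        (\<exists>\<alpha>. ribbon_tiling n R \<alpha> \<and> A = G_orient n R \<alpha>)) \<and>
     (\<forall>\<alpha> \<beta>. ribbon_tiling n R \<alpha> \<and> ribbon_tiling n R \<beta> \<longrightarrow>
        (local_replacement n \<alpha> \<beta> \<longleftrightarrow> edge_reversal (G_orient n R \<alpha>) (G_orient n R \<beta>)))"
proof -
  interpret ribbon_region n R using assms(1,2) by unfold_locales
  show ?thesis
  proof (intro conjI allI impI)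
    fix \<alpha> assume \<alpha>: "ribbon_tiling n R \<alpha>"
    show "is_orientation n R (G_orient n R \<alpha>)" by (rule G_orient_is_orientation[OF \<alpha>])
    show "acyclic (G_orient n R \<alpha>)" by (rule G_orient_acyclic[OF \<alpha>])
    show "extends_partial n R (G_orient n R \<alpha>)" by (rule G_orient_extends_partial[OF \<alpha>])
  next
    fix \<alpha> \<beta> assume "ribbon_tiling n R \<alpha> \<and> ribbon_tiling n R \<beta>"
    then show "\<alpha> = \<beta> \<longleftrightarrow> G_orient n R \<alpha> = G_orient n R \<beta>" using G_orient_inj by blast
  next
    fix A assume A: "is_orientation n R A \<and> acyclic A \<and> extends_partial n R A"
    obtain \<alpha> where "ribbon_tiling n R \<alpha>" using assms(3) by blast
    with A show "\<exists>\<alpha>. ribbon_tiling n R \<alpha> \<and> A = G_orient n R \<alpha>"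
      using acyclic_orientation_realised by simp
  next
    fix \<alpha> \<beta> assume "ribbon_tiling n R \<alpha> \<and> ribbon_tiling n R \<beta>"
    then show "local_replacement n \<alpha> \<beta> \<longleftrightarrow> edge_reversal (G_orient n R \<alpha>) (G_orient n R \<beta>)"
      using edge_reversal_if_local_replacement local_replacement_if_edge_reversal by blast
  qed
qed

end
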